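(* There is an algorithm which, given a minimal weighted graph $G=(V,E,w)$ together with the distances $d_G(u,v)$ between all pairs of vertices $u,v\in V$, computes a factorization of $G$ into prime weighted graphs in $O(|E|^2)$ time. If the distances are not given in advance, a factorization of $G$ into prime weighted graphs can be computed in $O(|V|^2\log\log|V|+|E|^2)$ time.
   Context: Graphs are finite, connected, undirected weighted graphs $G=(V,E,w)$ with $w:E\to\mathbb{R}_{>0}$; $d_G$ denotes the shortest-path metric (minimum total edge weight of a path). $G$ is minimal if $w(uv)=d_G(u,v)$ for every edge $uv\in E$. An isomorphism of weighted graphs is a bijection of vertices preserving adjacency, non-adjacency and edge weights. Cartesian product: for $G_i=(V_i,E_i,w_i)$, $1\le i\le m$, the graph $\prod_{i=1}^m G_i$ has vertex set $V_1\times\cdots\times V_m$; $(u_1,\dots,u_m)(v_1,\dots,v_m)$ is an edge iff there is exactly one index $\ell$ with $u_\ell v_\ell\in E_\ell$ and $u_i=v_i$ for all $i\ne\ell$, and its weight is then $w_\ell(u_\ell v_\ell)$. A finite family $\{G_1,\dots,G_m\}$ (repetitions allowed) is a factorization of $G$, with factors $G_i$, if $G$ is isomorphic to $\prod_{i=1}^m G_i$. By convention a factorization does not include the one-vertex graph $K_1$ unless $G=K_1$. $G$ is prime if every factorization of $G$ includes (a graph isomorphic to) $G$ as a factor. Running time counts elementary operations, with each arithmetic operation or comparison on edge weights and distances, and each look-up of a given distance, taking constant time. *)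

theory Defs
  imports "HOL-Library.Landau_Symbols"
begin

section \<open>Weighted graphs\<close>

text \<open>Simple undirected graphs; an edge is a two-element set. The weight function is total, its
  values outside the edge set are irrelevant.\<close>

record 'a wgraph =
  verts :: "'a set"
  edges :: "'a set set"
  weight :: "'a set \<Rightarrow> real"

definition is_path :: "'a wgraph \<Rightarrow> 'a \<Rightarrow> 'a list \<Rightarrow> 'a \<Rightarrow> bool" where
  "is_path G u p v \<longleftrightarrow>
     p \<noteq> [] \<and> hd p = u \<and> last p = v \<and> distinct p \<and> set p \<subseteq> verts G \<and>
     (\<forall>i. Suc i < length p \<longrightarrow> {p ! i, p ! Suc i} \<in> edges G)"

definition path_weight :: "'a wgraph \<Rightarrow> 'a list \<Rightarrow> real" where
  "path_weight G p = (\<Sum>i<length p - 1. weight G {p ! i, p ! Suc i})"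

definition weighted_graph :: "'a wgraph \<Rightarrow> bool" where
  "weighted_graph G \<longleftrightarrow>
     finite (verts G) \<and> verts G \<noteq> {} \<and>
     (\<forall>e \<in> edges G. e \<subseteq> verts G \<and> card e = 2 \<and> weight G e > 0) \<and>
     (\<forall>u \<in> verts G. \<forall>v \<in> verts G. \<exists>p. is_path G u p v)"

definition graph_dist :: "'a wgraph \<Rightarrow> 'a \<Rightarrow> 'a \<Rightarrow> real" where
  "graph_dist G u v = Min (path_weight G ` {p. is_path G u p v})"

definition minimal_graph :: "'a wgraph \<Rightarrow> bool" where
  "minimal_graph G \<longleftrightarrow> (\<forall>u v. {u, v} \<in> edges G \<longrightarrow> weight G {u, v} = graph_dist G u v)"

definition graph_iso :: "'a wgraph \<Rightarrow> 'b wgraph \<Rightarrow> bool" where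
  "graph_iso G H \<longleftrightarrow>
     (\<exists>f. bij_betw f (verts G) (verts H) \<and>
          (\<forall>u \<in> verts G. \<forall>v \<in> verts G.
             ({u, v} \<in> edges G \<longleftrightarrow> {f u, f v} \<in> edges H) \<and>
             ({u, v} \<in> edges G \<longrightarrow> weight H {f u, f v} = weight G {u, v})))"


section \<open>Cartesian products, factorizations, primality\<close>

text \<open>A vertex of the product of \<open>G\<^sub>1, \<dots>, G\<^sub>m\<close> is a list of length \<open>m\<close>.\<close>

definition prod_verts :: "'a wgraph list \<Rightarrow> 'a list set" where
  "prod_verts Gs = {x. length x = length Gs \<and> (\<forall>i < length Gs. x ! i \<in> verts (Gs ! i))}"

definition adj_at :: "'a wgraph list \<Rightarrow> nat \<Rightarrow> 'a list \<Rightarrow> 'a list \<Rightarrow> bool" where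
  "adj_at Gs l x y \<longleftrightarrow>
     l < length Gs \<and> {x ! l, y ! l} \<in> edges (Gs ! l) \<and>
     (\<forall>i < length Gs. i \<noteq> l \<longrightarrow> x ! i = y ! i)"

definition cart_prod :: "'a wgraph list \<Rightarrow> 'a list wgraph" where
  "cart_prod Gs =
     \<lparr>verts = prod_verts Gs,
      edges = {{x, y} | x y. x \<in> prod_verts Gs \<and> y \<in> prod_verts Gs \<and> (\<exists>!l. adj_at Gs l x y)},
      weight = (\<lambda>e. THE r. \<exists>x \<in> prod_verts Gs. \<exists>y \<in> prod_verts Gs. \<exists>l.
                   e = {x, y} \<and> adj_at Gs l x y \<and> r = weight (Gs ! l) {x ! l, y ! l})\<rparr>"

definition is_K1 :: "'a wgraph \<Rightarrow> bool" where
  "is_K1 G \<longleftrightarrow> card (verts G) = 1"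

text \<open>The empty family is not a factorization; otherwise the one-vertex graph would be its
  product and would fail to be prime.\<close>

definition factorization :: "'b wgraph list \<Rightarrow> 'a wgraph \<Rightarrow> bool" where
  "factorization Gs G \<longleftrightarrow>
     Gs \<noteq> [] \<and> (\<forall>H \<in> set Gs. weighted_graph H) \<and> graph_iso G (cart_prod Gs) \<and>
     (\<not> is_K1 G \<longrightarrow> (\<forall>H \<in> set Gs. \<not> is_K1 H))"

text \<open>Factors are taken with natural numbers as vertices. This is no restriction, since every
  finite graph is isomorphic to such a graph.\<close>

definition prime_graph :: "'a wgraph \<Rightarrow> bool" where
  "prime_graph G \<longleftrightarrow>
     weighted_graph G \<and>
     (\<forall>Gs :: nat wgraph list. factorization Gs G \<longrightarrow> (\<exists>H \<in> set Gs. graph_iso G H))"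


section \<open>Model of computation\<close>

text \<open>
  A random access machine with two memories, one for natural numbers (indices, counters, pointers)
  and one for exact real numbers (weights, distances), both with indirect addressing, and two
  append-only output tapes. Every instruction takes one time unit.

  Unit cost would be unrealistically powerful without the following restrictions. Every natural
  number written must be at most the word bound \<open>W\<close>, otherwise the machine is stuck; \<open>W\<close> will be
  polynomial in the size of the input, i.e. words have logarithmically many bits. Reals are never
  converted to natural numbers. The only real constants in a program are natural numbers, so that a
  program contains finitely many bits of information.
\<close>

datatype operand =
    Dir nat  \<comment> \<open>the cell with this index\<close>
  | Ind nat  \<comment> \<open>the cell whose index is in this cell of the natural-number memory\<close>

datatype nat_op = NAdd | NSub | NMul | NDiv | NMod

datatype real_op = RAdd | RSub | RMul | RDiv

datatype instr =
    NConst operand nat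
  | NMove operand operand
  | NArith nat_op operand operand operand
  | RConst operand nat
  | RMove operand operand
  | RArith real_op operand operand operand
  | Jump nat
  | NJumpLe operand operand nat
  | RJumpLe operand operand nat
  | NWrite operand
  | RWrite operand

type_synonym program = "instr list"

record state =
  pc :: nat
  nmem :: "nat \<Rightarrow> nat"
  rmem :: "nat \<Rightarrow> real"
  nout :: "nat list"
  rout :: "real list"

fun cell :: "state \<Rightarrow> operand \<Rightarrow> nat" where
  "cell s (Dir a) = a"
| "cell s (Ind a) = nmem s a"

abbreviation nval :: "state \<Rightarrow> operand \<Rightarrow> nat" where
  "nval s a \<equiv> nmem s (cell s a)"

abbreviation rval :: "state \<Rightarrow> operand \<Rightarrow> real" where
  "rval s a \<equiv> rmem s (cell s a)"

fun nat_op_fun :: "nat_op \<Rightarrow> nat \<Rightarrow> nat \<Rightarrow> nat" where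
  "nat_op_fun NAdd x y = x + y"
| "nat_op_fun NSub x y = x - y"
| "nat_op_fun NMul x y = x * y"
| "nat_op_fun NDiv x y = x div y"
| "nat_op_fun NMod x y = x mod y"

fun real_op_fun :: "real_op \<Rightarrow> real \<Rightarrow> real \<Rightarrow> real" where
  "real_op_fun RAdd x y = x + y"
| "real_op_fun RSub x y = x - y"
| "real_op_fun RMul x y = x * y"
| "real_op_fun RDiv x y = x / y"

definition advance :: "state \<Rightarrow> state" where
  "advance s = s\<lparr>pc := Suc (pc s)\<rparr>"

definition nstore :: "nat \<Rightarrow> state \<Rightarrow> operand \<Rightarrow> nat \<Rightarrow> state option" where
  "nstore W s a x =
     (if x \<le> W then Some (advance (s\<lparr>nmem := (nmem s)(cell s a := x)\<rparr>)) else None)"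

definition rstore :: "state \<Rightarrow> operand \<Rightarrow> real \<Rightarrow> state option" where
  "rstore s a x = Some (advance (s\<lparr>rmem := (rmem s)(cell s a := x)\<rparr>))"

definition jump_if :: "bool \<Rightarrow> state \<Rightarrow> nat \<Rightarrow> state option" where
  "jump_if b s l = Some (if b then s\<lparr>pc := l\<rparr> else advance s)"

fun exec :: "nat \<Rightarrow> instr \<Rightarrow> state \<Rightarrow> state option" where
  "exec W (NConst a k) s = nstore W s a k"
| "exec W (NMove a b) s = nstore W s a (nval s b)"
| "exec W (NArith f a b c) s = nstore W s a (nat_op_fun f (nval s b) (nval s c))"
| "exec W (RConst a k) s = rstore s a (real k)"
| "exec W (RMove a b) s = rstore s a (rval s b)"
| "exec W (RArith f a b c) s = rstore s a (real_op_fun f (rval s b) (rval s c))"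
| "exec W (Jump l) s = jump_if True s l"
| "exec W (NJumpLe a b l) s = jump_if (nval s a \<le> nval s b) s l"
| "exec W (RJumpLe a b l) s = jump_if (rval s a \<le> rval s b) s l"
| "exec W (NWrite a) s = Some (advance (s\<lparr>nout := nout s @ [nval s a]\<rparr>))"
| "exec W (RWrite a) s = Some (advance (s\<lparr>rout := rout s @ [rval s a]\<rparr>))"

definition step :: "nat \<Rightarrow> program \<Rightarrow> state \<Rightarrow> state \<Rightarrow> bool" where
  "step W P s s' \<longleftrightarrow> pc s < length P \<and> exec W (P ! pc s) s = Some s'"

definition initial :: "nat list \<Rightarrow> real list \<Rightarrow> state" where
  "initial ns rs =
     \<lparr>pc = 0,
      nmem = (\<lambda>i. if i < length ns then ns ! i else 0),
      rmem = (\<lambda>i. if i < length rs then rs ! i else 0),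
      nout = [], rout = []\<rparr>"

text \<open>The machine halts by leaving the program.\<close>

definition outputs_in ::
    "nat \<Rightarrow> program \<Rightarrow> nat list \<times> real list \<Rightarrow> nat \<Rightarrow> nat list \<times> real list \<Rightarrow> bool" where
  "outputs_in W P inp t out \<longleftrightarrow>
     (\<exists>s. (step W P ^^ t) (initial (fst inp) (snd inp)) s \<and> length P \<le> pc s \<and>
          out = (nout s, rout s))"


section \<open>Graphs as input and output\<close>

text \<open>A graph on \<open>{0, \<dots>, n - 1}\<close> is given by \<open>n\<close> and a list of its edges with their weights, each
  edge occurring once, in any order and orientation.\<close>

type_synonym graph_code = "nat \<times> (nat \<times> nat \<times> real) list"

fun presents :: "graph_code \<Rightarrow> nat wgraph \<Rightarrow> bool" where
  "presents (n, es) G \<longleftrightarrow>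
     verts G = {..<n} \<and>
     distinct (map (\<lambda>(u, v, _). {u, v}) es) \<and>
     edges G = set (map (\<lambda>(u, v, _). {u, v}) es) \<and>
     (\<forall>(u, v, r) \<in> set es. weight G {u, v} = r)"

fun graph_nats :: "graph_code \<Rightarrow> nat list" where
  "graph_nats (n, es) = n # length es # concat (map (\<lambda>(u, v, _). [u, v]) es)"

fun graph_reals :: "graph_code \<Rightarrow> real list" where
  "graph_reals (n, es) = map (\<lambda>(_, _, r). r) es"

definition graph_input :: "graph_code \<Rightarrow> nat list \<times> real list" where
  "graph_input g = (graph_nats g, graph_reals g)"

definition dist_table :: "nat wgraph \<Rightarrow> nat \<Rightarrow> real list" where
  "dist_table G n = concat (map (\<lambda>u. map (\<lambda>v. graph_dist G u v) [0..<n]) [0..<n])"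

text \<open>For a graph with \<open>n\<close> vertices and \<open>m\<close> edges, the distance from \<open>u\<close> to \<open>v\<close> is found in cell
  \<open>m + u * n + v\<close> of the real memory.\<close>

definition graph_dist_input :: "graph_code \<Rightarrow> nat wgraph \<Rightarrow> nat list \<times> real list" where
  "graph_dist_input g G = (graph_nats g, graph_reals g @ dist_table G (fst g))"

definition family_output :: "graph_code list \<Rightarrow> nat list \<times> real list" where
  "family_output hs = (length hs # concat (map graph_nats hs), concat (map graph_reals hs))"

definition word_bound :: "nat \<Rightarrow> nat wgraph \<Rightarrow> nat" where
  "word_bound c G = (card (verts G) + card (edges G) + 2) ^ c"

definition prime_factorizes_in ::
    "nat \<Rightarrow> program \<Rightarrow> nat list \<times> real list \<Rightarrow> nat wgraph \<Rightarrow> nat \<Rightarrow> bool" where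
  "prime_factorizes_in W P inp G t \<longleftrightarrow>
     (\<exists>hs Hs. outputs_in W P inp t (family_output hs) \<and>
              list_all2 presents hs Hs \<and> factorization Hs G \<and> (\<forall>H \<in> set Hs. prime_graph H))"

end

theory Submission imports Defs begin

text \<open>
  Call two arcs \<open>(a, b)\<close> and \<open>(x, y)\<close> related if \<open>d(a, x) + d(b, y) \<noteq> d(a, y) + d(b, x)\<close>, where
  \<open>d\<close> counts the edges of a shortest path, or if \<open>a = x\<close> and the two arcs are not sides of a square
  whose opposite sides have equal weights. The prime factors correspond to the classes of the
  equivalence relation generated by this. On the one hand, arcs of different factors of a product are never
  related, since \<open>d\<close> is additive and weights are constant along parallel edges. On the other hand,
  adjacent arcs of different classes span a square, so that a path can be reordered to have its arcs
  of a class \<open>C\<close> first; and a vertex reached from \<open>x\<close> both by a path inside \<open>C\<close> and by a path outside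
  \<open>C\<close> is \<open>x\<close>, because \<open>d(x, a) - d(x, b)\<close> is unchanged along arcs not related to \<open>(a, b)\<close>. So the
  graph is the product of the layers of the classes through a vertex, and a nontrivial factorization
  of one of these layers would split a class.

  Since weights enter only through the squares, unweighted distances suffice. A breadth-first search
  from every vertex finds them in time \<open>O(|V| |E|)\<close>, which is \<open>O(|E|\<^sup>2)\<close> for a connected graph. So one
  and the same program serves for both halves of the theorem, and it ignores the table of distances.
\<close>

section \<open>Hop distance and the product relation\<close>

text \<open>The program builds neither the generated equivalence nor a factor by graph search. Arcs
  are inserted one at a time into a labelling: a new arc absorbs every class that contains a related
  arc, and marking the labels to be absorbed before renaming keeps one insertion linear. The layer
  of a class \<open>c\<close> through vertex 0 is recognised from distances alone: \<open>z\<close>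
  belongs to it iff every arc \<open>(a, b)\<close> for which \<open>d(z, a) - d(z, b)\<close>
  differs from \<open>d(0, a) - d(0, b)\<close> has label \<open>c\<close>. So each vertex only
  needs the set of labels on which it differs from 0.

  The obstacle is the machine: addresses, which are quadratic in the indices, and all intermediate
  numbers must stay below a polynomial word bound. In the loop language of the program, the cost of
  a command also bounds by how much it can raise the greatest stored number. A quadratic running
  time therefore bounds all values and all addresses, without a separate analysis of the program.

  Weights are only tested for equality and copied, so the real memory never changes during a run and
  can be a parameter of the semantics.\<close>

locale conn_graph =
  fixes V :: "'a set" and adj :: "'a \<Rightarrow> 'a \<Rightarrow> bool" and w :: "'a \<Rightarrow> 'a \<Rightarrow> real"
  assumes adj_sym: "adj x y \<Longrightarrow> adj y x"
    and adj_V: "adj x y \<Longrightarrow> x \<in> V"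
    and adj_irrefl: "\<not> adj x x"
    and connected: "x \<in> V \<Longrightarrow> y \<in> V \<Longrightarrow> (x, y) \<in> {(a, b). adj a b}\<^sup>*"
    and w_sym: "w x y = w y x"
begin

abbreviation arcs :: "('a \<times> 'a) set" where
  "arcs \<equiv> {(a, b). adj a b}"

lemma adj_V': "adj x y \<Longrightarrow> y \<in> V"
  using adj_V adj_sym by blast

definition hop :: "'a \<Rightarrow> 'a \<Rightarrow> nat" where
  "hop x y = (LEAST k. (x, y) \<in> arcs ^^ k)"

lemma hop_path: "x \<in> V \<Longrightarrow> y \<in> V \<Longrightarrow> (x, y) \<in> arcs ^^ hop x y"
  unfolding hop_def using connected[of x y] rtrancl_imp_relpow by (metis (no_types, lifting) LeastI)

lemma hop_le: "(x, y) \<in> arcs ^^ k \<Longrightarrow> hop x y \<le> k"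
  unfolding hop_def by (rule Least_le)

lemma hop_self [simp]: "hop x x = 0"
  using hop_le[of x x 0] by simp

lemma hop_eq_0: "x \<in> V \<Longrightarrow> y \<in> V \<Longrightarrow> hop x y = 0 \<longleftrightarrow> x = y"
  using hop_path[of x y] by auto

lemma arcs_relpow_sym: "(x, y) \<in> arcs ^^ k \<Longrightarrow> (y, x) \<in> arcs ^^ k"
proof (induction k arbitrary: y)
  case (Suc k)
  then obtain z where "(x, z) \<in> arcs ^^ k" "adj z y" by auto
  then show ?case using Suc.IH[of z] adj_sym[of z y] by (intro relpow_Suc_I2[of _ z]) auto
qed auto

lemma hop_sym: "hop x y = hop y x"
  unfolding hop_def using arcs_relpow_sym by metis

lemma hop_triangle: "x \<in> V \<Longrightarrow> y \<in> V \<Longrightarrow> z \<in> V \<Longrightarrow> hop x z \<le> hop x y + hop y z"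
  using hop_path[of x y] hop_path[of y z] by (intro hop_le) (auto simp: relpow_add)

lemma hop_adj: assumes "adj x y" shows "hop x y = 1"
proof -
  have "hop x y \<le> 1" using assms by (intro hop_le) auto
  moreover have "hop x y \<noteq> 0" using assms hop_eq_0[of x y] adj_V adj_V' adj_irrefl by metis
  ultimately show ?thesis by linarith
qed

lemma hop_step: "x \<in> V \<Longrightarrow> adj y z \<Longrightarrow> hop x z \<le> hop x y + 1"
  using hop_triangle[of x y z] hop_adj[of y z] adj_V adj_V' by metis

lemma hop_pred:
  assumes "x \<in> V" "y \<in> V" "x \<noteq> y"
  obtains p where "adj p y" "hop x y = hop x p + 1"
proof -
  obtain k where k: "hop x y = Suc k" using hop_eq_0[OF assms(1,2)] assms(3) by (metis not0_implies_Suc)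
  then obtain p where p: "(x, p) \<in> arcs ^^ k" "adj p y" using hop_path[OF assms(1,2)] by auto
  have "hop x p \<le> k" using p hop_le by blast
  moreover have "hop x y \<le> hop x p + 1" using hop_step assms p by blast
  ultimately show ?thesis using that[of p] p k by auto
qed

text \<open>Dropping the arcs that \<open>h\<close> contracts leaves a walk between the images.
  Contraction must be allowed: overwriting one coordinate of a product vertex contracts every arc of
  that coordinate.\<close>

lemma hop_weak_hom:
  assumes h: "\<And>x y. adj x y \<Longrightarrow> adj (h x) (h y) \<or> h x = h y"
    and "x \<in> V" "y \<in> V"
  shows "hop (h x) (h y) \<le> hop x y"
proof -
  have "(x, y) \<in> arcs ^^ k \<Longrightarrow> \<exists>j\<le>k. (h x, h y) \<in> arcs ^^ j" for k
  proof (induction k arbitrary: y)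
    case (Suc k)
    then obtain z where z: "(x, z) \<in> arcs ^^ k" "adj z y" by auto
    obtain j where j: "j \<le> k" "(h x, h z) \<in> arcs ^^ j" using Suc.IH[OF z(1)] by auto
    consider "adj (h z) (h y)" | "h z = h y" using h[OF z(2)] by blast
    then show ?case
    proof cases
      case 1
      then have "(h x, h y) \<in> arcs ^^ Suc j" using j by auto
      then show ?thesis using j by (intro exI[of _ "Suc j"]) simp
    next
      case 2 then show ?thesis using j by (intro exI[of _ j]) simp
    qed
  qed auto
  from this[OF hop_path[OF assms(2,3)]] show ?thesis using hop_le le_trans by blast
qed

text \<open>The Djokovic-Winkler relation of the unweighted graph, written for oriented
  arcs.\<close>

definition theta :: "'a \<Rightarrow> 'a \<Rightarrow> 'a \<Rightarrow> 'a \<Rightarrow> bool" where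
  "theta a b x y \<longleftrightarrow> hop a x + hop b y \<noteq> hop a y + hop b x"

text \<open>The condition \<open>c \<noteq> a\<close> rules out walking back. A chord from
  \<open>b\<close> to \<open>e\<close> is not excluded here: it makes the two arcs
  \<open>theta\<close>-related.\<close>

definition spans_square :: "'a \<Rightarrow> 'a \<Rightarrow> 'a \<Rightarrow> bool" where
  "spans_square a b e \<longleftrightarrow> (\<exists>c. c \<noteq> a \<and> adj b c \<and> adj e c \<and> w a b = w e c \<and> w a e = w b c)"

text \<open>The second disjunct is a weighted form of Feder's relation tau: two edges at a common
  vertex are forced into one factor unless they are sides of a suitable square.\<close>

definition related :: "'a \<Rightarrow> 'a \<Rightarrow> 'a \<Rightarrow> 'a \<Rightarrow> bool" where
  "related a b x y \<longleftrightarrow> theta a b x y \<or> (a = x \<and> b \<noteq> y \<and> \<not> spans_square a b y)"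

lemma theta_sym: "theta a b x y = theta x y a b"
  unfolding theta_def by (simp add: hop_sym[of x] hop_sym[of y] add.commute)

lemma related_sym: "related a b x y \<Longrightarrow> related x y a b"
  unfolding related_def spans_square_def using theta_sym by metis

text \<open>These are the maps that are constant on the classes of the equivalence generated by
  \<open>related\<close>. Quantifying over all of them, Boolean ones included, replaces the
  equivalence itself.\<close>

definition compatible :: "('a \<Rightarrow> 'a \<Rightarrow> 'c) \<Rightarrow> bool" where
  "compatible lab \<longleftrightarrow> (\<forall>a b x y. adj a b \<longrightarrow> adj x y \<longrightarrow> related a b x y \<longrightarrow> lab a b = lab x y)"

end

section \<open>Colourings that respect the product relation\<close>

locale coloured_graph = conn_graph V adj w for V :: "'a set" and adj w +
  fixes lab :: "'a \<Rightarrow> 'a \<Rightarrow> 'c"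
  assumes lab_compat: "compatible lab"
begin

lemma lab_theta: "adj a b \<Longrightarrow> adj x y \<Longrightarrow> theta a b x y \<Longrightarrow> lab a b = lab x y"
  using lab_compat unfolding compatible_def related_def by blast

text \<open>An arc and its reversal are \<open>theta\<close>-related because \<open>1 + 1\<close>
  differs from \<open>0 + 0\<close>. So a colour belongs to an edge, not to an orientation.\<close>

lemma lab_sym: "adj a b \<Longrightarrow> lab a b = lab b a"
  using adj_sym by (intro lab_theta) (auto simp: theta_def hop_adj)

text \<open>Arcs at \<open>y\<close> of different colours are not \<open>related\<close>, which puts
  their ends at distance 2 and yields a square. In this square \<open>theta\<close> relates opposite
  sides, so these share their colours.\<close>

lemma square:
  assumes "adj y x" "adj y z" "lab y x \<noteq> lab y z"
  obtains c where "adj x c" "adj z c" "w x c = w y z" "w z c = w y x"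
    "lab x c = lab y z" "lab z c = lab y x"
proof -
  have nr: "\<not> related y x y z" using assms lab_compat unfolding compatible_def by blast
  have "x \<noteq> z" using assms by auto
  then have nt: "\<not> theta y x y z" and "spans_square y x z" using nr unfolding related_def by auto
  then obtain c where c: "c \<noteq> y" "adj x c" "adj z c" "w y x = w z c" "w y z = w x c"
    unfolding spans_square_def by auto
  have "hop y x = 1" "hop y z = 1" "hop x y = 1" using assms adj_sym hop_adj by blast+
  then have xz: "hop x z = 2" "hop z x = 2" using nt unfolding theta_def
    by (simp_all add: hop_sym[of z])
  \<comment> \<open>For opposite sides \<open>theta\<close> compares \<open>1 + 1\<close> with
    \<open>hop y c + 2\<close>, so \<open>c \<noteq> y\<close> is what separates the two
    sums.\<close>
  have "hop y c \<noteq> 0" using hop_eq_0[of y c] c(1,2) assms(1) adj_V adj_V' by metis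
  then have "theta y z x c" "theta y x z c"
    unfolding theta_def using xz hop_adj[OF assms(1)] hop_adj[OF assms(2)] hop_adj[OF c(2)] hop_adj[OF c(3)]
    by simp_all
  then have "lab y z = lab x c" "lab y x = lab z c" using lab_theta assms c by blast+
  then show ?thesis using that c by metis
qed

section \<open>Walks restricted to a set of colours\<close>

definition layer :: "'c set \<Rightarrow> ('a \<times> 'a) set" where
  "layer P = {(x, y). adj x y \<and> lab x y \<in> P}\<^sup>*"

text \<open>Layers are indexed by sets of colours, so that a colayer is again a layer and each lemma
  below applies to both.\<close>

abbreviation colayer :: "'c set \<Rightarrow> ('a \<times> 'a) set" where
  "colayer P \<equiv> layer (- P)"

lemma layer_refl [simp, intro]: "(x, x) \<in> layer P"
  unfolding layer_def by simp

lemma layer_trans: "(x, y) \<in> layer P \<Longrightarrow> (y, z) \<in> layer P \<Longrightarrow> (x, z) \<in> layer P"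
  unfolding layer_def by simp

lemma layer_sym: "(x, y) \<in> layer P \<Longrightarrow> (y, x) \<in> layer P"
proof -
  have "sym {(x, y). adj x y \<and> lab x y \<in> P}"
    using adj_sym lab_sym by (auto intro!: symI)
  from sym_rtrancl[OF this] show "(x, y) \<in> layer P \<Longrightarrow> (y, x) \<in> layer P"
    unfolding layer_def by (rule symD)
qed

lemma layer_arc: "adj x y \<Longrightarrow> lab x y \<in> P \<Longrightarrow> (x, y) \<in> layer P"
  unfolding layer_def by auto

lemma layer_V: "(x, y) \<in> layer P \<Longrightarrow> x \<in> V \<Longrightarrow> y \<in> V"
  unfolding layer_def by (induction rule: rtrancl_induct) (auto intro: adj_V')

lemma layer_mono: "P \<subseteq> Q \<Longrightarrow> (x, y) \<in> layer P \<Longrightarrow> (x, y) \<in> layer Q"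
  unfolding layer_def by (rule subsetD[OF rtrancl_mono]) auto

text \<open>The arc is carried backwards along the path from \<open>z\<close> to \<open>y\<close>.
  Each step of the path spans a square with it, and the opposite side inherits its colour and
  weight.\<close>

lemma transport:
  assumes "(z, y) \<in> layer P" "adj y y'" "lab y y' \<notin> P"
  obtains z' where "adj z z'" "lab z z' = lab y y'" "w z z' = w y y'" "(z', y') \<in> layer P"
proof -
  have "\<exists>z'. adj z z' \<and> lab z z' = lab y y' \<and> w z z' = w y y' \<and> (z', y') \<in> layer P"
    using assms(1) unfolding layer_def
  proof (induction rule: converse_rtrancl_induct)
    case base then show ?case using assms(2) by auto
  next
    case (step x z)
    then obtain z' where z': "adj z z'" "lab z z' = lab y y'" "w z z' = w y y'"
        "(z', y') \<in> layer P" unfolding layer_def by auto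
    have x: "adj z x" "lab z x = lab x z" "lab x z \<in> P" using step adj_sym lab_sym by auto
    have "lab z x \<noteq> lab z z'" using x z' assms(3) by auto
    from square[OF x(1) z'(1) this] obtain c where c: "adj x c" "adj z' c" "w x c = w z z'"
      "lab x c = lab z z'" "lab z' c = lab z x" by metis
    have "(c, z') \<in> layer P"
      using c x lab_sym[of z' c] adj_sym[of z' c] by (intro layer_arc) auto
    then have "(c, y') \<in> layer P" using z'(4) layer_trans by blast
    then show ?case using c z' unfolding layer_def by auto
  qed
  then show ?thesis using that by blast
qed

text \<open>When a path is extended by an arc with colour in \<open>P\<close>,
  \<open>transport\<close> moves this arc back over the whole second part, to the end of the
  first.\<close>

lemma reorder:
  assumes "x \<in> V" "y \<in> V"
  obtains z where "(x, z) \<in> layer P" "(z, y) \<in> colayer P"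
proof -
  have "\<exists>z. (x, z) \<in> layer P \<and> (z, y) \<in> colayer P"
    using connected[OF assms]
  proof (induction rule: rtrancl_induct)
    case (step y y')
    then obtain z where z: "(x, z) \<in> layer P" "(z, y) \<in> colayer P" by auto
    have a: "adj y y'" using step by auto
    show ?case
    proof (cases "lab y y' \<in> P")
      case True
      obtain z' where z': "adj z z'" "lab z z' = lab y y'" "(z', y') \<in> colayer P"
        using transport[OF z(2) a] True by (metis ComplD)
      then have "(x, z') \<in> layer P" using layer_trans[OF z(1) layer_arc[of z z' P]] True by metis
      then show ?thesis using z' by blast
    next
      case False
      then show ?thesis using z layer_trans[OF z(2) layer_arc[OF a, of "- P"]] by blast
    qed
  qed auto
  then show ?thesis using that by blast
qed

lemma layer_hop:
  assumes "(x, y) \<in> layer P" "adj a b" "lab a b \<notin> P"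
  shows "hop x a + hop y b = hop x b + hop y a"
  using assms(1) unfolding layer_def
proof (induction rule: rtrancl_induct)
  case (step y z)
  then have yz: "adj y z" "lab y z \<in> P" by auto
  then have "\<not> theta y z a b" using lab_theta[OF yz(1) assms(2)] assms(3) by metis
  then show ?case using step unfolding theta_def by linarith
qed auto

text \<open>By connectedness \<open>hop x z - hop y z\<close> does not depend on \<open>z\<close>.
  Its values at \<open>z = x\<close> and \<open>z = y\<close> are \<open>- hop y x\<close> and
  \<open>hop x y\<close>, so both vanish.\<close>

lemma hop_separates:
  assumes "x \<in> V" "y \<in> V" "\<And>a b. adj a b \<Longrightarrow> hop x a + hop y b = hop x b + hop y a"
  shows "x = y"
proof -
  have "hop x z + hop y x = hop y z" if "(x, z) \<in> arcs\<^sup>*" for z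
    using that
  proof (induction rule: rtrancl_induct)
    case (step y z) then show ?case using assms(3)[of y z] by auto
  qed auto
  from this[OF connected[OF assms(1,2)]] have "hop x y = 0" by simp
  then show ?thesis using hop_eq_0 assms by auto
qed

lemma layer_inj:
  assumes "(x, y) \<in> layer P" "(x, y) \<in> colayer P" "x \<in> V"
  shows "x = y"
proof (rule hop_separates)
  show "y \<in> V" using assms layer_V by blast
  fix a b assume "adj a b"
  then show "hop x a + hop y b = hop x b + hop y a"
    using layer_hop[OF assms(1), of a b] layer_hop[OF assms(2), of a b] by (cases "lab a b \<in> P") auto
qed (use assms in auto)

text \<open>This turns reachability inside a layer into a condition on distances that a program can
  test. For the converse, take the corner \<open>z\<close> of a reordered path: an arc with colour
  in \<open>P\<close> cannot tell \<open>z\<close> from \<open>y\<close> because of the second part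
  of the path, and any other arc because of the hypothesis and the first part.\<close>

lemma layer_iff_hop:
  assumes "x \<in> V" "y \<in> V"
  shows "(x, y) \<in> layer P \<longleftrightarrow> (\<forall>a b. adj a b \<longrightarrow> lab a b \<notin> P \<longrightarrow> hop x a + hop y b = hop x b + hop y a)"
    (is "_ \<longleftrightarrow> ?R")
proof
  assume R: ?R
  obtain z where z: "(x, z) \<in> layer P" "(z, y) \<in> colayer P" using reorder assms by blast
  have zV: "z \<in> V" using z assms layer_V by blast
  have "z = y"
  proof (rule hop_separates[OF zV assms(2)])
    fix a b assume ab: "adj a b"
    show "hop z a + hop y b = hop z b + hop y a"
    proof (cases "lab a b \<in> P")
      case True then show ?thesis using layer_hop[OF z(2) ab] by simp
    next
      case False
      have "hop x a + hop z b = hop x b + hop z a" using layer_hop[OF z(1) ab False] .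
      moreover have "hop x a + hop y b = hop x b + hop y a" using R ab False by blast
      ultimately show ?thesis by linarith
    qed
  qed
  then show "(x, y) \<in> layer P" using z by simp
qed (use layer_hop in blast)

text \<open>A path that avoids the colour of an arc does not change the difference seen by that arc,
  so no arc distinguishes \<open>x\<close> from \<open>y\<close>. This is what makes the joint
  projection to all factors injective.\<close>

lemma separate_all:
  assumes "x \<in> V" "y \<in> V" "\<And>a b. adj a b \<Longrightarrow> (x, y) \<in> layer (- {lab a b})"
  shows "x = y"
proof (rule hop_separates[OF assms(1,2)])
  fix a b assume ab: "adj a b"
  show "hop x a + hop y b = hop x b + hop y a" using layer_hop[OF assms(3)[OF ab] ab] by simp
qed

text \<open>Transporting the arc to \<open>x\<close> ends at a vertex that shares a
  \<open>P\<close>-layer and a colayer with \<open>y\<close>, hence at \<open>y\<close>. With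
  \<open>P\<close> the complement of one colour it compares parallel copies of a factor.\<close>

lemma lift_arc:
  assumes "(x, u) \<in> layer P" "(y, v) \<in> layer P" "adj u v" "lab u v \<notin> P" "(x, y) \<in> colayer P"
  shows "adj x y \<and> w x y = w u v \<and> lab x y = lab u v"
proof -
  obtain z where z: "adj x z" "lab x z = lab u v" "w x z = w u v" "(z, v) \<in> layer P"
    using transport[OF assms(1,3,4)] .
  have "(z, y) \<in> layer P" using z(4) assms(2) layer_sym layer_trans by blast
  moreover have "(z, y) \<in> colayer P"
    using layer_trans[OF layer_sym[OF layer_arc[of x z "- P"]] assms(5)] z(1,2) assms(4) by simp
  moreover have "z \<in> V" using z adj_V' by blast
  ultimately have "z = y" using layer_inj by blast
  then show ?thesis using z by auto
qed

end

section \<open>Two-factor decompositions\<close>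

text \<open>A product of two factors, given by its coordinate maps. The value types are arbitrary,
  so that one coordinate may consist of a layer and a list.\<close>

locale two_factor = conn_graph V adj w for V :: "'a set" and adj w +
  fixes \<alpha> :: "'a \<Rightarrow> 'b" and \<beta> :: "'a \<Rightarrow> 'c"
  assumes inj: "x \<in> V \<Longrightarrow> y \<in> V \<Longrightarrow> \<alpha> x = \<alpha> y \<Longrightarrow> \<beta> x = \<beta> y \<Longrightarrow> x = y"
    and arc_cases: "adj x y \<Longrightarrow> \<alpha> x = \<alpha> y \<or> \<beta> x = \<beta> y"
    and mix_ex: "x \<in> V \<Longrightarrow> y \<in> V \<Longrightarrow> \<exists>z\<in>V. \<alpha> z = \<alpha> x \<and> \<beta> z = \<beta> y"
    and alpha_arc: "adj x y \<Longrightarrow> \<beta> x = \<beta> y \<Longrightarrow> x' \<in> V \<Longrightarrow> y' \<in> V \<Longrightarrow> \<alpha> x' = \<alpha> x \<Longrightarrow>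
        \<alpha> y' = \<alpha> y \<Longrightarrow> \<beta> x' = \<beta> y' \<Longrightarrow> adj x' y' \<and> w x' y' = w x y"
    and beta_arc: "adj x y \<Longrightarrow> \<alpha> x = \<alpha> y \<Longrightarrow> x' \<in> V \<Longrightarrow> y' \<in> V \<Longrightarrow> \<beta> x' = \<beta> x \<Longrightarrow>
        \<beta> y' = \<beta> y \<Longrightarrow> \<alpha> x' = \<alpha> y' \<Longrightarrow> adj x' y' \<and> w x' y' = w x y"
begin

definition mix :: "'a \<Rightarrow> 'a \<Rightarrow> 'a" where
  "mix x y = (SOME z. z \<in> V \<and> \<alpha> z = \<alpha> x \<and> \<beta> z = \<beta> y)"

lemma mix:
  assumes "x \<in> V" "y \<in> V"
  shows "mix x y \<in> V" "\<alpha> (mix x y) = \<alpha> x" "\<beta> (mix x y) = \<beta> y"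
  using someI_ex[of "\<lambda>z. z \<in> V \<and> \<alpha> z = \<alpha> x \<and> \<beta> z = \<beta> y"] mix_ex[OF assms]
  unfolding mix_def by blast+

lemma mix_eq: "x \<in> V \<Longrightarrow> y \<in> V \<Longrightarrow> z \<in> V \<Longrightarrow> \<alpha> z = \<alpha> x \<Longrightarrow> \<beta> z = \<beta> y \<Longrightarrow> mix x y = z"
  using mix inj by metis

lemma mix_weak_hom_left:
  assumes "z \<in> V" "adj x y" shows "adj (mix x z) (mix y z) \<or> mix x z = mix y z"
proof (cases "\<beta> x = \<beta> y")
  case True
  then show ?thesis
    using alpha_arc[OF assms(2) True, of "mix x z" "mix y z"] mix assms adj_V adj_V' by metis
next
  case False
  then have "\<alpha> x = \<alpha> y" using arc_cases assms by blast
  then show ?thesis unfolding mix_def by simp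
qed

lemma mix_weak_hom_right:
  assumes "z \<in> V" "adj x y" shows "adj (mix z x) (mix z y) \<or> mix z x = mix z y"
proof (cases "\<alpha> x = \<alpha> y")
  case True
  then show ?thesis
    using beta_arc[OF assms(2) True, of "mix z x" "mix z y"] mix assms adj_V adj_V' by metis
next
  case False
  then have "\<beta> x = \<beta> y" using arc_cases assms by blast
  then show ?thesis unfolding mix_def by simp
qed

lemma hop_mix_left: "x \<in> V \<Longrightarrow> y \<in> V \<Longrightarrow> z \<in> V \<Longrightarrow> hop (mix x z) (mix y z) \<le> hop x y"
  by (rule hop_weak_hom[of "\<lambda>u. mix u z"]) (use mix_weak_hom_left in simp_all)

lemma hop_mix_right: "x \<in> V \<Longrightarrow> y \<in> V \<Longrightarrow> z \<in> V \<Longrightarrow> hop (mix z x) (mix z y) \<le> hop x y"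
  by (rule hop_weak_hom) (use mix_weak_hom_right in simp_all)

text \<open>\<open>mix y x\<close> is the corner reached from \<open>x\<close> by adjusting
  \<open>\<alpha>\<close> first. Along a walk, an arc in direction \<open>\<beta>\<close> can
  lengthen only the second leg; an arc in direction \<open>\<alpha>\<close> can lengthen the first
  leg, while the second is merely shifted.\<close>

lemma hop_mix_le:
  assumes "x \<in> V" "(x, y) \<in> arcs ^^ k"
  shows "hop x (mix y x) + hop (mix y x) y \<le> k"
  using assms(2)
proof (induction k arbitrary: y)
  case 0
  then have "mix y x = x" using mix_eq assms by auto
  then show ?case using 0 by auto
next
  case (Suc k)
  then obtain z where z: "(x, z) \<in> arcs ^^ k" "adj z y" by auto
  have zV: "z \<in> V" "y \<in> V" using z adj_V adj_V' by auto
  note IH = Suc.IH[OF z(1)]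
  note m = mix[OF zV(1) assms(1)] mix[OF zV(2) assms(1)]
  show ?case
  proof (cases "\<alpha> z = \<alpha> y")
    case True
    then have e: "mix y x = mix z x" unfolding mix_def by simp
    have "hop (mix z x) y \<le> hop (mix z x) z + 1" using hop_step z m by blast
    then show ?thesis using IH e by simp
  next
    case False
    then have b: "\<beta> z = \<beta> y" using arc_cases z by blast
    have "adj (mix z x) (mix y x)"
      using alpha_arc[OF z(2) b, of "mix z x" "mix y x"] m by simp
    then have 1: "hop x (mix y x) \<le> hop x (mix z x) + 1" using hop_step assms by blast
    have "hop (mix y (mix z x)) (mix y z) \<le> hop (mix z x) z"
      using hop_mix_right zV m by blast
    moreover have "mix y (mix z x) = mix y x" unfolding mix_def using m by (simp add: mix_def)
    moreover have "mix y z = y" using mix_eq zV b by auto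
    ultimately show ?thesis using IH 1 by simp
  qed
qed

lemma hop_mix:
  assumes "x \<in> V" "y \<in> V" shows "hop x y = hop x (mix y x) + hop (mix y x) y"
  using hop_mix_le[OF assms(1) hop_path[OF assms]] hop_triangle[OF assms(1) _ assms(2)]
    mix[OF assms(2,1)] by (meson le_antisym)

text \<open>Replacing the common \<open>\<beta>\<close>-coordinate is a weak homomorphism, and it is
  undone by another one of the same kind; neither lengthens distances.\<close>

lemma hop_shift_alpha:
  assumes "x \<in> V" "z \<in> V" "y \<in> V" "\<beta> x = \<beta> z"
  shows "hop x z = hop (mix x y) (mix z y)"
proof -
  have "hop (mix x y) (mix z y) \<le> hop x z"
    using hop_mix_left assms by blast
  moreover have "hop (mix (mix x y) x) (mix (mix z y) x) \<le> hop (mix x y) (mix z y)"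
    using hop_mix_left assms mix by blast
  moreover have "mix (mix x y) x = x" "mix (mix z y) x = z"
    using assms mix by (auto intro!: mix_eq)
  ultimately show ?thesis by simp
qed

lemma hop_shift_beta:
  assumes "x \<in> V" "z \<in> V" "y \<in> V" "\<alpha> x = \<alpha> z"
  shows "hop x z = hop (mix y x) (mix y z)"
proof -
  have "hop (mix y x) (mix y z) \<le> hop x z"
    using hop_mix_right assms by blast
  moreover have "hop (mix x (mix y x)) (mix x (mix y z)) \<le> hop (mix y x) (mix y z)"
    using hop_mix_right assms mix by blast
  moreover have "mix x (mix y x) = x" "mix x (mix y z) = z"
    using assms mix by (auto intro!: mix_eq)
  ultimately show ?thesis by simp
qed

text \<open>The distance from \<open>p\<close> in \<open>{x, y}\<close> to \<open>q\<close> in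
  \<open>{a, b}\<close> splits at the corner \<open>mix q p\<close>. The \<open>\<alpha>\<close>-leg
  depends on \<open>q\<close> only, since \<open>x\<close> and \<open>y\<close> agree in
  \<open>\<alpha>\<close>, and the \<open>\<beta>\<close>-leg on \<open>p\<close> only, since
  \<open>a\<close> and \<open>b\<close> agree in \<open>\<beta>\<close>. So both sums in
  \<open>theta\<close> have the same four terms.\<close>

lemma not_theta:
  assumes ab: "adj a b" "\<beta> a = \<beta> b" and xy: "adj x y" "\<alpha> x = \<alpha> y"
  shows "\<not> theta a b x y"
proof -
  have V: "a \<in> V" "b \<in> V" "x \<in> V" "y \<in> V" using assms adj_V adj_V' by auto
  have split: "hop p q = hop p (mix q p) + hop (mix q p) q" if "p \<in> {x, y}" "q \<in> {a, b}" for p q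
    using hop_mix V that by blast
  have 1: "hop (mix a p) a = hop (mix b p) b" if "p \<in> {x, y}" for p
  proof -
    have p: "p \<in> V" using that V by auto
    have "hop (mix a p) a = hop (mix b (mix a p)) (mix b a)"
      using hop_shift_beta[of "mix a p" a b] V p mix by simp
    moreover have "mix b (mix a p) = mix b p" unfolding mix_def using mix[OF V(1) p]
      by (simp add: mix_def)
    moreover have "mix b a = b" using mix_eq V ab by auto
    ultimately show ?thesis by simp
  qed
  have 2: "hop x (mix q x) = hop y (mix q y)" if "q \<in> {a, b}" for q
  proof -
    have q: "q \<in> V" using that V by auto
    have "hop x (mix q x) = hop (mix x y) (mix (mix q x) y)"
      using hop_shift_alpha[of x "mix q x" y] V q mix by simp
    moreover have "mix (mix q x) y = mix q y" unfolding mix_def using mix[OF q V(3)]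
      by (simp add: mix_def)
    moreover have "mix x y = y" using mix_eq V xy by auto
    ultimately show ?thesis by simp
  qed
  show ?thesis unfolding theta_def
    using split[of x a] split[of x b] split[of y a] split[of y b] 1[of x] 1[of y] 2[of a] 2[of b]
    by (simp add: hop_sym[of a] hop_sym[of b])
qed

lemma spans_square:
  assumes ab: "adj a b" "\<beta> a = \<beta> b" and ay: "adj a y" "\<alpha> a = \<alpha> y"
  shows "spans_square a b y"
proof -
  have V: "a \<in> V" "b \<in> V" "y \<in> V" using assms adj_V adj_V' by auto
  note m = mix[OF V(2,3)]
  have 1: "adj y (mix b y) \<and> w y (mix b y) = w a b" using alpha_arc[OF ab, of y "mix b y"] m V ay by simp
  have 2: "adj b (mix b y) \<and> w b (mix b y) = w a y" using beta_arc[OF ay, of b "mix b y"] m V ab by simp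
  have "\<alpha> a \<noteq> \<alpha> b" using inj[OF V(1,2)] ab adj_irrefl by auto
  then have "mix b y \<noteq> a" using m by auto
  then show ?thesis unfolding spans_square_def using 1 2 by metis
qed

lemma spans_square_commute: "spans_square a b y = spans_square a y b"
  unfolding spans_square_def by metis

text \<open>The two colours tell along which factor an arc runs. In this form a hypothetical
  factorization enters the proof of primality: as a Boolean colouring that a single class would have
  to respect.\<close>

lemma compatible_beta: "compatible (\<lambda>x y. \<beta> x = \<beta> y)"
  unfolding compatible_def
proof (intro allI impI)
  fix a b x y assume *: "adj a b" "adj x y" "related a b x y"
  show "(\<beta> a = \<beta> b) = (\<beta> x = \<beta> y)"
  proof (rule ccontr)
    assume "\<not> ?thesis"
    then consider "\<beta> a = \<beta> b" "\<alpha> x = \<alpha> y" | "\<beta> x = \<beta> y" "\<alpha> a = \<alpha> b"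
      using arc_cases * by blast
    then show False
    proof cases
      case 1 then show ?thesis using * not_theta spans_square unfolding related_def by blast
    next
      case 2 then show ?thesis
        using * not_theta[OF *(2) 2(1) *(1) 2(2)] spans_square[OF *(2) 2(1)] theta_sym spans_square_commute
        unfolding related_def by blast
    qed
  qed
qed

end

section \<open>Walks and paths\<close>

definition gadj :: "'a wgraph \<Rightarrow> 'a \<Rightarrow> 'a \<Rightarrow> bool" where
  "gadj G u v \<longleftrightarrow> {u, v} \<in> edges G"

definition gweight :: "'a wgraph \<Rightarrow> 'a \<Rightarrow> 'a \<Rightarrow> real" where
  "gweight G u v = weight G {u, v}"

lemma gadj_commute: "gadj G u v = gadj G v u"
  by (simp add: gadj_def insert_commute)

lemma gweight_commute: "gweight G u v = gweight G v u"
  by (simp add: gweight_def insert_commute)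

lemma weighted_graph_gadj:
  assumes "weighted_graph G" "gadj G u v" shows "u \<in> verts G" "v \<in> verts G" "u \<noteq> v"
  using assms unfolding weighted_graph_def gadj_def by (force simp: card_2_iff)+

lemma is_path_rtrancl:
  assumes "is_path G u p v" shows "(u, v) \<in> {(a, b). gadj G a b}\<^sup>*"
proof -
  from assms have p: "p \<noteq> []" "hd p = u" "last p = v"
    "\<And>i. Suc i < length p \<Longrightarrow> gadj G (p ! i) (p ! Suc i)" unfolding is_path_def gadj_def by auto
  have "i < length p \<Longrightarrow> (p ! 0, p ! i) \<in> {(a, b). gadj G a b}\<^sup>*" for i
  proof (induction i)
    case (Suc i)
    then show ?case using p(4)[of i] by (auto intro: rtrancl_into_rtrancl)
  qed auto
  from this[of "length p - 1"] p show ?thesis by (simp add: hd_conv_nth last_conv_nth)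
qed

lemma rtrancl_is_path:
  assumes V: "\<And>a b. gadj G a b \<Longrightarrow> a \<in> verts G" and v: "v \<in> verts G"
    and "(u, v) \<in> {(a, b). gadj G a b}\<^sup>*"
  shows "\<exists>p. is_path G u p v"
  using assms(3)
proof (induction rule: converse_rtrancl_induct)
  case base
  have "is_path G v [v] v" using v by (auto simp: is_path_def)
  then show ?case by blast
next
  case (step x y)
  then obtain p where p: "is_path G y p v" and xy: "gadj G x y" by auto
  show ?case
  proof (cases "x \<in> set p")
    \<comment> \<open>\<open>is_path\<close> demands distinct vertices, so a repeated
      \<open>x\<close> cuts the path down to its part from \<open>x\<close> on.\<close>
    case True
    then obtain q r where qr: "p = q @ x # r" by (meson split_list)
    have "{(x # r) ! i, (x # r) ! Suc i} \<in> edges G" if "Suc i < length (x # r)" for i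
    proof -
      have "{p ! (length q + i), p ! Suc (length q + i)} \<in> edges G"
        using p that unfolding is_path_def qr by (auto simp del: nth_append_length_plus)
      then show ?thesis unfolding qr by (simp add: nth_append)
    qed
    then have "is_path G x (x # r) v" using p qr by (auto simp: is_path_def)
    then show ?thesis by blast
  next
    case False
    have "{(x # p) ! i, (x # p) ! Suc i} \<in> edges G" if "Suc i < length (x # p)" for i
      using that p xy by (cases i) (auto simp: is_path_def gadj_def hd_conv_nth)
    then have "is_path G x (x # p) v" using p xy V False by (auto simp: is_path_def)
    then show ?thesis by blast
  qed
qed

lemma weighted_graphI:
  assumes "finite (verts G)" "verts G \<noteq> {}"
    and "\<And>e. e \<in> edges G \<Longrightarrow> e \<subseteq> verts G \<and> card e = 2 \<and> weight G e > 0"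
    and "\<And>u v. u \<in> verts G \<Longrightarrow> v \<in> verts G \<Longrightarrow> (u, v) \<in> {(a, b). gadj G a b}\<^sup>*"
  shows "weighted_graph G"
proof -
  have "a \<in> verts G" if "gadj G a b" for a b using assms(3) that unfolding gadj_def by auto
  then show ?thesis unfolding weighted_graph_def using assms rtrancl_is_path by metis
qed

lemma conn_graph: "weighted_graph G \<Longrightarrow> conn_graph (verts G) (gadj G) (gweight G)"
proof
  assume G: "weighted_graph G"
  fix x y assume "x \<in> verts G" "y \<in> verts G"
  then obtain p where "is_path G x p y" using G unfolding weighted_graph_def by blast
  then show "(x, y) \<in> {(a, b). gadj G a b}\<^sup>*" by (rule is_path_rtrancl)
qed (use weighted_graph_gadj gadj_commute gweight_commute in metis)+

section \<open>Cartesian products\<close>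

lemma adj_at_sym: "adj_at Gs l x y \<Longrightarrow> adj_at Gs l y x"
  unfolding adj_at_def by (metis insert_commute)

lemma adj_at_neq:
  assumes "\<forall>H \<in> set Gs. weighted_graph H" "adj_at Gs l x y"
  shows "l < length Gs" "x ! l \<noteq> y ! l"
  using assms weighted_graph_gadj(3)[of "Gs ! l"] unfolding adj_at_def gadj_def by auto

lemma adj_at_unique:
  assumes "\<forall>H \<in> set Gs. weighted_graph H" "adj_at Gs l x y" "adj_at Gs k x y"
  shows "l = k"
  using assms adj_at_neq[OF assms(1,2)] unfolding adj_at_def by metis

lemma cart_prod_adj:
  assumes Gs: "\<forall>H \<in> set Gs. weighted_graph H" and "x \<in> prod_verts Gs" "y \<in> prod_verts Gs"
  shows "gadj (cart_prod Gs) x y \<longleftrightarrow> (\<exists>l. adj_at Gs l x y)"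
proof
  assume "gadj (cart_prod Gs) x y"
  then obtain x' y' l where "{x, y} = {x', y'}" "adj_at Gs l x' y'"
    unfolding gadj_def cart_prod_def by auto
  then show "\<exists>l. adj_at Gs l x y" using adj_at_sym by (metis doubleton_eq_iff)
next
  assume "\<exists>l. adj_at Gs l x y"
  then have "\<exists>!l. adj_at Gs l x y" using adj_at_unique[OF Gs] by blast
  then show "gadj (cart_prod Gs) x y" unfolding gadj_def cart_prod_def using assms(2,3) by simp blast
qed

lemma cart_prod_weight:
  assumes Gs: "\<forall>H \<in> set Gs. weighted_graph H" and xy: "x \<in> prod_verts Gs" "y \<in> prod_verts Gs"
    and l: "adj_at Gs l x y"
  shows "gweight (cart_prod Gs) x y = weight (Gs ! l) {x ! l, y ! l}"
proof -
  have "weight (cart_prod Gs) {x, y} = (THE r. \<exists>x' \<in> prod_verts Gs. \<exists>y' \<in> prod_verts Gs. \<exists>l.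
      {x, y} = {x', y'} \<and> adj_at Gs l x' y' \<and> r = weight (Gs ! l) {x' ! l, y' ! l})"
    unfolding cart_prod_def by simp
  also have "\<dots> = weight (Gs ! l) {x ! l, y ! l}"
  proof (rule the_equality)
    show "\<exists>x' \<in> prod_verts Gs. \<exists>y' \<in> prod_verts Gs. \<exists>k. {x, y} = {x', y'} \<and> adj_at Gs k x' y' \<and>
        weight (Gs ! l) {x ! l, y ! l} = weight (Gs ! k) {x' ! k, y' ! k}"
      using xy l by blast
    fix r assume "\<exists>x' \<in> prod_verts Gs. \<exists>y' \<in> prod_verts Gs. \<exists>k. {x, y} = {x', y'} \<and>
        adj_at Gs k x' y' \<and> r = weight (Gs ! k) {x' ! k, y' ! k}"
    then obtain x' y' k where *: "{x, y} = {x', y'}" "adj_at Gs k x' y'"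
        "r = weight (Gs ! k) {x' ! k, y' ! k}" by blast
    then have "adj_at Gs k x y" using adj_at_sym by (metis doubleton_eq_iff)
    then have "k = l" using adj_at_unique[OF Gs] l by blast
    then show "r = weight (Gs ! l) {x ! l, y ! l}"
      using * by (auto simp: doubleton_eq_iff insert_commute)
  qed
  finally show ?thesis unfolding gweight_def .
qed

lemma verts_cart_prod [simp]: "verts (cart_prod Gs) = prod_verts Gs"
  by (simp add: cart_prod_def)

lemma graph_isoI:
  assumes "bij_betw f (verts G) (verts H)"
    and "\<And>u v. u \<in> verts G \<Longrightarrow> v \<in> verts G \<Longrightarrow> gadj G u v \<longleftrightarrow> gadj H (f u) (f v)"
    and "\<And>u v. u \<in> verts G \<Longrightarrow> v \<in> verts G \<Longrightarrow> gadj G u v \<Longrightarrow> gweight H (f u) (f v) = gweight G u v"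
  shows "graph_iso G H"
  using assms unfolding graph_iso_def gadj_def gweight_def by blast

lemma graph_isoE:
  assumes "graph_iso G H"
  obtains f where "bij_betw f (verts G) (verts H)"
    and "\<And>u v. u \<in> verts G \<Longrightarrow> v \<in> verts G \<Longrightarrow> gadj G u v \<longleftrightarrow> gadj H (f u) (f v)"
    and "\<And>u v. u \<in> verts G \<Longrightarrow> v \<in> verts G \<Longrightarrow> gadj G u v \<Longrightarrow> gweight H (f u) (f v) = gweight G u v"
  using assms unfolding graph_iso_def gadj_def gweight_def by metis

text \<open>The coordinates in one-vertex factors carry no information. This leads from "at most one
  nontrivial factor" to the definition of primality, which asks for a factor isomorphic to the whole
  graph.\<close>

lemma factor_of_trivial:
  assumes Gs: "\<forall>H \<in> set Gs. weighted_graph H" and j: "j < length Gs"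
    and K1: "\<And>i. i < length Gs \<Longrightarrow> i \<noteq> j \<Longrightarrow> is_K1 (Gs ! i)"
    and iso: "graph_iso G (cart_prod Gs)"
  shows "graph_iso G (Gs ! j)"
proof -
  obtain f where f: "bij_betw f (verts G) (verts (cart_prod Gs))"
    "\<And>u v. u \<in> verts G \<Longrightarrow> v \<in> verts G \<Longrightarrow> gadj G u v \<longleftrightarrow> gadj (cart_prod Gs) (f u) (f v)"
    "\<And>u v. u \<in> verts G \<Longrightarrow> v \<in> verts G \<Longrightarrow> gadj G u v \<Longrightarrow> gweight (cart_prod Gs) (f u) (f v) = gweight G u v"
    using graph_isoE[OF iso] by metis
  have ne: "\<exists>v. v \<in> verts (Gs ! i)" if "i < length Gs" for i
    using Gs that unfolding weighted_graph_def by (metis nth_mem ex_in_conv)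
  then obtain z0 where z0: "\<And>i. i < length Gs \<Longrightarrow> z0 i \<in> verts (Gs ! i)" by metis
  have eq: "x ! i = y ! i" if "x \<in> prod_verts Gs" "y \<in> prod_verts Gs" "i < length Gs" "i \<noteq> j" for x y i
    using that K1[of i] unfolding prod_verts_def is_K1_def by (metis (mono_tags, lifting) card_1_singletonE mem_Collect_eq singletonD)
  have "bij_betw (\<lambda>x. x ! j) (prod_verts Gs) (verts (Gs ! j))"
  proof (rule bij_betwI')
    fix x y assume xy: "x \<in> prod_verts Gs" "y \<in> prod_verts Gs"
    have "x = y" if "x ! j = y ! j"
    proof (rule nth_equalityI)
      show "length x = length y" using xy by (simp add: prod_verts_def)
      fix i assume "i < length x"
      then show "x ! i = y ! i" using xy eq[OF xy] that by (cases "i = j") (auto simp: prod_verts_def)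
    qed
    then show "x ! j = y ! j \<longleftrightarrow> x = y" by auto
  next
    fix v assume v: "v \<in> verts (Gs ! j)"
    have "map (z0(j := v)) [0..<length Gs] \<in> prod_verts Gs" using z0 v by (auto simp: prod_verts_def)
    then show "\<exists>x\<in>prod_verts Gs. v = x ! j" using j by (intro bexI[of _ "map (z0(j := v)) [0..<length Gs]"]) auto
  qed (use j in \<open>auto simp: prod_verts_def\<close>)
  then have b: "bij_betw ((\<lambda>x. x ! j) \<circ> f) (verts G) (verts (Gs ! j))" using f(1) bij_betw_trans by auto
  have fp: "f u \<in> prod_verts Gs" if "u \<in> verts G" for u using f(1) that by (auto simp: bij_betw_def)
  have at: "adj_at Gs l x y \<longleftrightarrow> l = j \<and> gadj (Gs ! j) (x ! j) (y ! j)"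
    if "x \<in> prod_verts Gs" "y \<in> prod_verts Gs" for l x y
    using eq[OF that] j adj_at_neq[OF Gs, of l x y] unfolding adj_at_def gadj_def by metis
  show ?thesis
  proof (rule graph_isoI[OF b])
    fix u v assume uv: "u \<in> verts G" "v \<in> verts G"
    note P = fp[OF uv(1)] fp[OF uv(2)]
    show "gadj G u v \<longleftrightarrow> gadj (Gs ! j) (((\<lambda>x. x ! j) \<circ> f) u) (((\<lambda>x. x ! j) \<circ> f) v)"
      using f(2)[OF uv] cart_prod_adj[OF Gs P] at[OF P] by auto
    assume a: "gadj G u v"
    then have "adj_at Gs j (f u) (f v)"
      using f(2)[OF uv] cart_prod_adj[OF Gs P] at[OF P] by auto
    from cart_prod_weight[OF Gs P this]
    show "gweight (Gs ! j) (((\<lambda>x. x ! j) \<circ> f) u) (((\<lambda>x. x ! j) \<circ> f) v) = gweight G u v"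
      using f(3)[OF uv a] by (simp add: gweight_def)
  qed
qed

lemma weighted_graph_has_edge:
  assumes "weighted_graph H" "\<not> is_K1 H" obtains u v where "gadj H u v"
proof -
  obtain x where x: "x \<in> verts H" using assms unfolding weighted_graph_def by blast
  moreover have "verts H \<noteq> {x}" using assms(2) unfolding is_K1_def by auto
  ultimately obtain y where y: "y \<in> verts H" "x \<noteq> y" by blast
  then have "(x, y) \<in> {(a, b). gadj H a b}\<^sup>*"
    using conn_graph.connected[OF conn_graph[OF assms(1)]] x by blast
  then show ?thesis using y that by (metis (no_types, lifting) Collect_case_prodD converse_rtranclE)
qed

section \<open>The factors of a compatible colouring\<close>

locale rooted_coloured_graph = coloured_graph V adj w lab
  for V :: "'a set" and adj w and lab :: "'a \<Rightarrow> 'a \<Rightarrow> 'c" +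
  fixes r :: 'a
  assumes root: "r \<in> V"
begin

definition fibre :: "'c \<Rightarrow> 'a set" where
  "fibre c = {z \<in> V. (r, z) \<in> layer {c}}"

text \<open>The projection to the factor of colour \<open>c\<close>: the point where the fibre meets
  the colayer of \<open>x\<close>. It exists by \<open>reorder\<close> and is unique by
  \<open>fibre_inj\<close>.\<close>

definition proj :: "'c \<Rightarrow> 'a \<Rightarrow> 'a" where
  "proj c x = (SOME z. (r, z) \<in> layer {c} \<and> (z, x) \<in> layer (- {c}))"

lemma fibre_iff_hop:
  "z \<in> fibre c \<longleftrightarrow> z \<in> V \<and> (\<forall>a b. adj a b \<longrightarrow> lab a b \<noteq> c \<longrightarrow> hop r a + hop z b = hop r b + hop z a)"
  unfolding fibre_def by (simp add: layer_iff_hop[OF root] cong: conj_cong)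

lemma fibre_V: "z \<in> fibre c \<Longrightarrow> z \<in> V"
  unfolding fibre_def by simp

lemma root_fibre: "r \<in> fibre c"
  unfolding fibre_def using root by simp

lemma proj:
  assumes "x \<in> V" shows "(r, proj c x) \<in> layer {c}" "(proj c x, x) \<in> layer (- {c})"
proof -
  obtain z where "(r, z) \<in> layer {c}" "(z, x) \<in> layer (- {c})"
    using reorder[OF root assms] .
  then have "(r, proj c x) \<in> layer {c} \<and> (proj c x, x) \<in> layer (- {c})"
    unfolding proj_def by (intro someI[of "\<lambda>z. (r, z) \<in> layer {c} \<and> (z, x) \<in> layer (- {c})"] conjI)
  then show "(r, proj c x) \<in> layer {c}" "(proj c x, x) \<in> layer (- {c})" by auto
qed

lemma proj_fibre: "x \<in> V \<Longrightarrow> proj c x \<in> fibre c"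
  unfolding fibre_def using proj layer_V root by blast

lemma fibre_layer: "u \<in> fibre c \<Longrightarrow> v \<in> fibre c \<Longrightarrow> (u, v) \<in> layer {c}"
  unfolding fibre_def using layer_sym layer_trans by blast

lemma fibre_inj: "u \<in> fibre c \<Longrightarrow> v \<in> fibre c \<Longrightarrow> (u, v) \<in> layer (- {c}) \<Longrightarrow> u = v"
  using layer_inj fibre_layer fibre_V by blast

lemma proj_eqI:
  assumes "z \<in> fibre c" "(z, x) \<in> layer (- {c})" shows "proj c x = z"
proof -
  have "x \<in> V" using assms layer_V fibre_V by blast
  then show ?thesis using assms proj proj_fibre fibre_inj layer_sym layer_trans by meson
qed

lemma proj_cong: "x \<in> V \<Longrightarrow> (x, y) \<in> layer (- {c}) \<Longrightarrow> proj c y = proj c x"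
  using proj proj_fibre proj_eqI layer_trans by meson

lemma proj_eq_iff:
  "x \<in> V \<Longrightarrow> y \<in> V \<Longrightarrow> proj c x = proj c y \<longleftrightarrow> (x, y) \<in> layer (- {c})"
  using proj(2) proj_cong layer_sym layer_trans by metis

lemma proj_arc_other: "adj x y \<Longrightarrow> lab x y \<noteq> c \<Longrightarrow> proj c x = proj c y"
  using proj_cong[OF _ layer_arc, of x y c] adj_V[of x y] by simp

lemma proj_arc:
  assumes "adj x y" "lab x y = c"
  shows "adj (proj c x) (proj c y) \<and> w (proj c x) (proj c y) = w x y"
proof -
  have "x \<in> V" "y \<in> V" using assms adj_V adj_V' by auto
  then show ?thesis
    using lift_arc[of "proj c x" x "- {c}" "proj c y" y] proj proj_fibre fibre_layer assms by auto
qed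

lemma fibre_arc_lab:
  assumes "u \<in> fibre c" "v \<in> fibre c" "adj u v" shows "lab u v = c"
proof (rule ccontr)
  assume "lab u v \<noteq> c"
  then have "(u, v) \<in> layer (- {c})" using assms layer_arc[of u v "- {c}"] by simp
  then show False using fibre_inj assms adj_irrefl by metis
qed

text \<open>The coordinates are adjusted one after the other. Moving inside a layer of colour
  \<open>c\<close> changes no projection to another colour, so what was adjusted before is
  kept.\<close>

lemma joint_proj:
  assumes "distinct cs" "\<And>c. c \<in> set cs \<Longrightarrow> z c \<in> fibre c"
  shows "\<exists>x\<in>V. \<forall>c\<in>set cs. proj c x = z c"
  using assms
proof (induction cs)
  case Nil then show ?case using root by auto
next
  case (Cons c cs)
  then obtain x' where x': "x' \<in> V" "\<forall>c\<in>set cs. proj c x' = z c" by auto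
  have zc: "z c \<in> fibre c" using Cons by simp
  obtain x where x: "(x', x) \<in> layer {c}" "(x, z c) \<in> layer (- {c})"
    using reorder[OF x'(1) fibre_V[OF zc]] .
  have "proj c x = z c" using proj_eqI zc x layer_sym by blast
  moreover have "proj c' x = z c'" if "c' \<in> set cs" for c'
  proof -
    have "c \<noteq> c'" using that Cons by auto
    then have "(x', x) \<in> layer (- {c'})" using x(1) layer_mono[of "{c}" "- {c'}"] by blast
    then show ?thesis using proj_cong x' that by metis
  qed
  ultimately show ?case using layer_V x x' by auto
qed

text \<open>\<open>H\<close> is a copy, under the renaming \<open>f\<close>, of the subgraph induced
  on the fibre. The graphs that are output have vertex sets \<open>{..<k}\<close> and are only
  copies.\<close>

definition induces :: "'c \<Rightarrow> ('a \<Rightarrow> 'b) \<Rightarrow> 'b wgraph \<Rightarrow> bool" where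
  "induces c f H \<longleftrightarrow> weighted_graph H \<and> bij_betw f (fibre c) (verts H) \<and>
     (\<forall>u\<in>fibre c. \<forall>v\<in>fibre c. (gadj H (f u) (f v) \<longleftrightarrow> adj u v) \<and> (adj u v \<longrightarrow> gweight H (f u) (f v) = w u v))"

lemma layer_fibre:
  assumes "u \<in> fibre c" "v \<in> fibre c"
  shows "(u, v) \<in> {(a, b). a \<in> fibre c \<and> b \<in> fibre c \<and> adj a b}\<^sup>*"
proof -
  have "(u, v) \<in> layer {c}" using fibre_layer assms .
  then show ?thesis unfolding layer_def
  proof (induction rule: rtrancl_induct)
    case (step y z)
    then have yz: "adj y z" "lab y z = c" by auto
    have "(r, y) \<in> layer {c}"
      using assms step(1) layer_trans[of r u _ y] unfolding fibre_def layer_def by auto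
    then have "y \<in> fibre c" unfolding fibre_def using yz adj_V by auto
    moreover have "z \<in> fibre c"
      using \<open>y \<in> fibre c\<close> layer_trans[OF _ layer_arc[of y z "{c}"]] yz adj_V' unfolding fibre_def by auto
    ultimately show ?case using step yz by (auto intro: rtrancl_into_rtrancl)
  qed auto
qed

lemma inducesI:
  assumes "finite (verts H)" and f: "bij_betw f (fibre c) (verts H)"
    and e: "edges H = {{f u, f v} | u v. u \<in> fibre c \<and> v \<in> fibre c \<and> adj u v}"
    and wt: "\<And>u v. u \<in> fibre c \<Longrightarrow> v \<in> fibre c \<Longrightarrow> adj u v \<Longrightarrow> weight H {f u, f v} = w u v"
    and pos: "\<And>u v. adj u v \<Longrightarrow> w u v > 0"
  shows "induces c f H"
proof -
  have fin: "f u \<in> verts H" if "u \<in> fibre c" for u using f that by (auto simp: bij_betw_def)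
  have finj: "f u = f v \<longleftrightarrow> u = v" if "u \<in> fibre c" "v \<in> fibre c" for u v
    using f that by (auto simp: bij_betw_def inj_on_def)
  have a: "gadj H (f u) (f v) \<longleftrightarrow> adj u v" if uv: "u \<in> fibre c" "v \<in> fibre c" for u v
    unfolding gadj_def e using uv finj adj_sym by (auto simp: doubleton_eq_iff)
  have "weighted_graph H"
  proof (rule weighted_graphI)
    show "verts H \<noteq> {}" using fin root_fibre by blast
    fix d assume "d \<in> edges H"
    then obtain u v where "d = {f u, f v}" "u \<in> fibre c" "v \<in> fibre c" "adj u v" unfolding e by auto
    moreover from this have "f u \<noteq> f v" using finj adj_irrefl by metis
    ultimately show "d \<subseteq> verts H \<and> card d = 2 \<and> weight H d > 0"
      using fin wt pos by auto
  next
    fix x y assume "x \<in> verts H" "y \<in> verts H"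
    then obtain u v where uv: "x = f u" "y = f v" "u \<in> fibre c" "v \<in> fibre c"
      using f unfolding bij_betw_def by (metis imageE)
    have "(f u, f v) \<in> {(a, b). gadj H a b}\<^sup>*"
      using layer_fibre[OF uv(3,4)]
    proof (induction rule: rtrancl_induct)
      case (step y z)
      then have "gadj H (f y) (f z)" using a by auto
      then show ?case using step by (auto intro: rtrancl_into_rtrancl)
    qed auto
    then show "(x, y) \<in> {(a, b). gadj H a b}\<^sup>*" using uv by simp
  qed (use assms in auto)
  then show ?thesis unfolding induces_def using f a wt by (auto simp: gweight_def)
qed

lemma induces_fibre: "induces c f H \<Longrightarrow> u \<in> fibre c \<Longrightarrow> f u \<in> verts H"
  unfolding induces_def by (auto simp: bij_betw_def)

lemma induces_inj: "induces c f H \<Longrightarrow> u \<in> fibre c \<Longrightarrow> v \<in> fibre c \<Longrightarrow> f u = f v \<longleftrightarrow> u = v"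
  unfolding induces_def by (auto simp: bij_betw_def inj_on_def)

text \<open>The map to all projections is injective by \<open>separate_all\<close> and surjective by
  \<open>joint_proj\<close>. An arc of colour \<open>cs ! l\<close> changes coordinate
  \<open>l\<close> only, and conversely an arc of a factor lifts to every parallel layer by
  \<open>lift_arc\<close>.\<close>

lemma iso_cart_prod:
  assumes cs: "distinct cs" "\<And>a b. adj a b \<Longrightarrow> lab a b \<in> set cs"
    and Hs: "length Hs = length cs" "\<And>i. i < length cs \<Longrightarrow> induces (cs ! i) (\<iota> i) (Hs ! i)"
    and G: "verts G = V" "\<And>u v. gadj G u v \<longleftrightarrow> adj u v" "\<And>u v. adj u v \<Longrightarrow> gweight G u v = w u v"
  shows "graph_iso G (cart_prod Hs)"
proof -
  define F where "F x = map (\<lambda>i. \<iota> i (proj (cs ! i) x)) [0..<length cs]" for x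
  have W: "\<forall>H\<in>set Hs. weighted_graph H" using Hs unfolding induces_def by (metis in_set_conv_nth)
  have F: "F x \<in> prod_verts Hs" if "x \<in> V" for x
    using Hs(1) induces_fibre[OF Hs(2) proj_fibre[OF that]] unfolding F_def prod_verts_def by simp
  have Fi: "F x ! i = \<iota> i (proj (cs ! i) x)" if "i < length cs" for x i using that by (simp add: F_def)
  have Feq: "F x ! i = F y ! i \<longleftrightarrow> proj (cs ! i) x = proj (cs ! i) y"
    if "i < length cs" "x \<in> V" "y \<in> V" for x y i
    using that Fi induces_inj[OF Hs(2)] proj_fibre by simp
  have inj: "x = y" if "x \<in> V" "y \<in> V" "\<And>i. i < length cs \<Longrightarrow> F x ! i = F y ! i" for x y
  proof (rule separate_all[OF that(1,2)])
    fix a b assume "adj a b"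
    then obtain i where "i < length cs" "cs ! i = lab a b" using cs by (metis in_set_conv_nth)
    then show "(x, y) \<in> layer (- {lab a b})" using that Feq proj_eq_iff by metis
  qed
  have at: "adj_at Hs l (F x) (F y)" if xy: "adj x y" "lab x y = cs ! l" "l < length cs" for x y l
  proof -
    have V: "x \<in> V" "y \<in> V" using xy adj_V adj_V' by auto
    have "gadj (Hs ! l) (F x ! l) (F y ! l)"
      using proj_arc[OF xy(1,2)] Fi[OF xy(3)] Hs(2)[OF xy(3)] proj_fibre V unfolding induces_def by simp
    moreover have "F x ! i = F y ! i" if "i < length cs" "i \<noteq> l" for i
      using proj_arc_other[OF xy(1), of "cs ! i"] xy that cs Fi by (simp add: nth_eq_iff_index_eq)
    ultimately show ?thesis unfolding adj_at_def gadj_def using Hs xy by auto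
  qed
  have "bij_betw F V (prod_verts Hs)"
  proof (rule bij_betwI')
    fix x y assume "x \<in> V" "y \<in> V" then show "F x = F y \<longleftrightarrow> x = y" using inj by metis
  next
    fix z assume z: "z \<in> prod_verts Hs"
    have "\<exists>u. u \<in> fibre (cs ! i) \<and> \<iota> i u = z ! i" if "i < length cs" for i
    proof -
      have "z ! i \<in> verts (Hs ! i)" using z that Hs unfolding prod_verts_def by auto
      then show ?thesis using Hs(2)[OF that] unfolding induces_def bij_betw_def by (metis imageE)
    qed
    then obtain u where u: "\<And>i. i < length cs \<Longrightarrow> u i \<in> fibre (cs ! i) \<and> \<iota> i (u i) = z ! i" by metis
    \<comment> \<open>\<open>joint_proj\<close> expects its targets indexed by colour, hence the
      position \<open>k c\<close> of a colour in \<open>cs\<close>.\<close>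
    define k where "k c = (THE i. i < length cs \<and> cs ! i = c)" for c
    have k: "k (cs ! i) = i" if "i < length cs" for i
      unfolding k_def using that cs by (auto simp: nth_eq_iff_index_eq)
    have "\<And>c. c \<in> set cs \<Longrightarrow> u (k c) \<in> fibre c" using u k by (metis in_set_conv_nth)
    from joint_proj[OF cs(1) this] obtain x where
      x: "x \<in> V" "\<And>c. c \<in> set cs \<Longrightarrow> proj c x = u (k c)" by blast
    have "F x = z"
    proof (rule nth_equalityI)
      fix i assume "i < length (F x)"
      then have i: "i < length cs" by (simp add: F_def)
      then show "F x ! i = z ! i" using Fi x(2)[of "cs ! i"] k u by simp
    qed (use z Hs in \<open>simp add: prod_verts_def F_def\<close>)
    then show "\<exists>x\<in>V. z = F x" using x by auto
  qed (use F in auto)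
  then show ?thesis
  proof (intro graph_isoI[of F])
    fix x y assume "x \<in> verts G" "y \<in> verts G"
    then have V: "x \<in> V" "y \<in> V" using G by auto
    note P = F[OF V(1)] F[OF V(2)]
    show "gadj G x y \<longleftrightarrow> gadj (cart_prod Hs) (F x) (F y)"
    proof
      assume "gadj G x y"
      then have a: "adj x y" using G by simp
      then obtain l where "l < length cs" "lab x y = cs ! l" using cs(2) by (metis in_set_conv_nth)
      then show "gadj (cart_prod Hs) (F x) (F y)" using cart_prod_adj[OF W P] at a by blast
    next
      assume "gadj (cart_prod Hs) (F x) (F y)"
      then obtain l where l: "adj_at Hs l (F x) (F y)" using cart_prod_adj[OF W P] by blast
      then have ll: "l < length cs" using Hs unfolding adj_at_def by simp
      let ?c = "cs ! l"
      have "gadj (Hs ! l) (F x ! l) (F y ! l)" using l unfolding adj_at_def gadj_def by simp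
      then have a: "adj (proj ?c x) (proj ?c y)"
        using Fi[OF ll] Hs(2)[OF ll] proj_fibre V unfolding induces_def by simp
      \<comment> \<open>The other coordinates of \<open>x\<close> and \<open>y\<close> agree, which
        will force this corner to coincide with \<open>y\<close>. Then \<open>x\<close> and
        \<open>y\<close> lie in one layer and the arc of the factor can be lifted.\<close>
      obtain y' where y': "(x, y') \<in> layer {?c}" "(y', y) \<in> layer (- {?c})"
        using reorder[OF V] .
      have "y' \<in> V" using y' V layer_V by blast
      have "proj (cs ! i) y' = proj (cs ! i) y" if i: "i < length cs" for i
      proof (cases "i = l")
        case True then show ?thesis using proj_eq_iff[OF \<open>y' \<in> V\<close> V(2)] y'(2) by simp
      next
        case False
        then have "cs ! i \<noteq> ?c" using cs i ll by (simp add: nth_eq_iff_index_eq)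
        then have "(x, y') \<in> layer (- {cs ! i})"
          using y'(1) layer_mono[of "{?c}" "- {cs ! i}"] by blast
        moreover have "F x ! i = F y ! i" using l False i Hs unfolding adj_at_def by simp
        ultimately show ?thesis using proj_eq_iff Feq i V \<open>y' \<in> V\<close> by metis
      qed
      then have "y' = y" using inj[OF \<open>y' \<in> V\<close> V(2)] Fi by simp
      then have "(x, y) \<in> layer {?c}" using y' by simp
      moreover have "lab (proj ?c x) (proj ?c y) = ?c" using fibre_arc_lab a proj_fibre V by blast
      ultimately have "adj x y"
        using lift_arc[of x "proj ?c x" "- {?c}" y "proj ?c y"] a proj(2) V layer_sym by auto
      then show "gadj G x y" using G by simp
    qed
    assume "gadj G x y"
    then have a: "adj x y" using G by simp
    then obtain l where l: "l < length cs" "lab x y = cs ! l" using cs(2) by (metis in_set_conv_nth)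
    have "gweight (cart_prod Hs) (F x) (F y) = gweight (Hs ! l) (F x ! l) (F y ! l)"
      using cart_prod_weight[OF W P at[OF a l(2,1)]] by (simp add: gweight_def)
    also have "\<dots> = w x y"
      using Hs(2)[OF l(1)] proj_arc[OF a l(2)] proj_fibre V Fi[OF l(1)] unfolding induces_def by simp
    finally show "gweight (cart_prod Hs) (F x) (F y) = gweight G x y" using G a by simp
  qed (use G in auto)
qed

lemma induces_not_K1:
  assumes "induces c f H" "adj a b" "lab a b = c" shows "\<not> is_K1 H"
proof -
  have V: "a \<in> V" "b \<in> V" using assms adj_V adj_V' by auto
  have "proj c a \<noteq> proj c b" using proj_arc[OF assms(2,3)] adj_irrefl by metis
  then have ne: "f (proj c a) \<noteq> f (proj c b)" using induces_inj[OF assms(1)] proj_fibre V by blast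
  show ?thesis unfolding is_K1_def
    using ne induces_fibre[OF assms(1) proj_fibre] V by (metis card_1_singletonE singletonD)
qed

end

section \<open>Pulling a factorization of one factor back to the whole graph\<close>

locale factored_factor = rooted_coloured_graph V adj w lab r
  for V :: "'a set" and adj w and lab :: "'a \<Rightarrow> 'a \<Rightarrow> 'c" and r +
  fixes c :: 'c and f :: "'a \<Rightarrow> 'b" and H :: "'b wgraph" and Gs :: "'d wgraph list"
    and \<phi> :: "'b \<Rightarrow> 'd list"
  assumes induces: "induces c f H" and Gs: "\<forall>K \<in> set Gs. weighted_graph K"
    and iso: "bij_betw \<phi> (verts H) (prod_verts Gs)"
    and iso_adj: "u \<in> verts H \<Longrightarrow> v \<in> verts H \<Longrightarrow> gadj H u v \<longleftrightarrow> gadj (cart_prod Gs) (\<phi> u) (\<phi> v)"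
    and iso_weight: "u \<in> verts H \<Longrightarrow> v \<in> verts H \<Longrightarrow> gadj H u v \<Longrightarrow>
      gweight (cart_prod Gs) (\<phi> u) (\<phi> v) = gweight H u v"
begin

text \<open>The coordinates are defined on all of \<open>V\<close>, not only on the fibre:
  compatibility of a colouring refers to the relation of the whole graph, so the decomposition has
  to be one of the whole graph too.\<close>

definition coords :: "'a \<Rightarrow> 'd list" where
  "coords x = \<phi> (f (proj c x))"

lemma coords_prod: "x \<in> V \<Longrightarrow> coords x \<in> prod_verts Gs"
  unfolding coords_def using iso induces_fibre[OF induces proj_fibre] by (auto simp: bij_betw_def)

lemma length_coords: "x \<in> V \<Longrightarrow> length (coords x) = length Gs"
  using coords_prod unfolding prod_verts_def by blast

lemma coords_eq_iff:
  assumes "x \<in> V" "y \<in> V" shows "coords x = coords y \<longleftrightarrow> (x, y) \<in> layer (- {c})"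
proof -
  have "coords x = coords y \<longleftrightarrow> f (proj c x) = f (proj c y)"
    unfolding coords_def using iso induces_fibre[OF induces proj_fibre] assms
    by (auto simp: bij_betw_def inj_on_def)
  then show ?thesis using induces_inj[OF induces] proj_fibre proj_eq_iff assms by simp
qed

lemma coords_surj: assumes "z \<in> prod_verts Gs" obtains v where "v \<in> fibre c" "coords v = z"
proof -
  obtain h where h: "h \<in> verts H" "\<phi> h = z" using assms iso unfolding bij_betw_def by (metis imageE)
  then obtain v where v: "v \<in> fibre c" "f v = h" using induces unfolding induces_def bij_betw_def by (metis imageE)
  then have "proj c v = v" using proj_eqI layer_refl by blast
  then show ?thesis using that v h unfolding coords_def by simp
qed

lemma adj_proj_iff:
  assumes "x \<in> V" "y \<in> V"
  shows "adj (proj c x) (proj c y) \<longleftrightarrow> (\<exists>l. adj_at Gs l (coords x) (coords y))"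
proof -
  have "adj (proj c x) (proj c y) \<longleftrightarrow> gadj H (f (proj c x)) (f (proj c y))"
    using induces proj_fibre assms unfolding induces_def by simp
  also have "\<dots> \<longleftrightarrow> gadj (cart_prod Gs) (coords x) (coords y)"
    unfolding coords_def using iso_adj induces_fibre[OF induces proj_fibre] assms by simp
  finally show ?thesis using cart_prod_adj[OF Gs] coords_prod assms by simp
qed

lemma weight_proj:
  assumes "x \<in> V" "y \<in> V" "adj_at Gs l (coords x) (coords y)"
  shows "w (proj c x) (proj c y) = weight (Gs ! l) {coords x ! l, coords y ! l}"
proof -
  have a: "adj (proj c x) (proj c y)" using adj_proj_iff assms by blast
  have "w (proj c x) (proj c y) = gweight H (f (proj c x)) (f (proj c y))"
    using induces proj_fibre assms a unfolding induces_def by simp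
  also have "\<dots> = gweight (cart_prod Gs) (coords x) (coords y)"
    unfolding coords_def using iso_weight induces_fibre[OF induces proj_fibre] assms a
      induces proj_fibre unfolding induces_def by simp
  finally show ?thesis using cart_prod_weight[OF Gs coords_prod coords_prod] assms by simp
qed

lemma adj_at_lift:
  assumes "x \<in> V" "y \<in> V" "(x, y) \<in> layer {c}" "adj_at Gs l (coords x) (coords y)"
  shows "adj x y \<and> w x y = weight (Gs ! l) {coords x ! l, coords y ! l} \<and> lab x y = c"
proof -
  have a: "adj (proj c x) (proj c y)" using adj_proj_iff assms by blast
  then have "lab (proj c x) (proj c y) = c" using fibre_arc_lab proj_fibre assms by blast
  then show ?thesis
    using lift_arc[of x "proj c x" "- {c}" y "proj c y"] a proj(2) layer_sym assms weight_proj by auto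
qed

lemma adj_at_arc: "adj x y \<Longrightarrow> lab x y = c \<Longrightarrow> \<exists>l. adj_at Gs l (coords x) (coords y)"
  using proj_arc[of x y c] adj_proj_iff[of x y] adj_V adj_V' by blast

lemma coords_arc_other: "adj x y \<Longrightarrow> lab x y \<noteq> c \<Longrightarrow> coords x = coords y"
  unfolding coords_def using proj_arc_other by metis

text \<open>The set of vertices in the \<open>c\<close>-layer of \<open>x\<close> serves as a single
  value that stands for all coordinates of colours other than \<open>c\<close>.\<close>

lemma layer_class_eq: "layer {c} `` {x} = layer {c} `` {y} \<longleftrightarrow> (x, y) \<in> layer {c}"
proof
  assume "layer {c} `` {x} = layer {c} `` {y}"
  then show "(x, y) \<in> layer {c}" using layer_refl[of y "{c}"] by (simp add: set_eq_iff)
next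
  assume "(x, y) \<in> layer {c}"
  then have "(x, z) \<in> layer {c} \<longleftrightarrow> (y, z) \<in> layer {c}" for z
    using layer_trans[of x y "{c}" z] layer_trans[of y x "{c}" z] layer_sym[of x y "{c}"] by blast
  then show "layer {c} `` {x} = layer {c} `` {y}" by (simp add: set_eq_iff)
qed

lemma list_update_eq_iff:
  "length x = length y \<Longrightarrow> i < length x \<Longrightarrow>
    x[i := d] = y[i := d] \<longleftrightarrow> (\<forall>k<length x. k \<noteq> i \<longrightarrow> x ! k = y ! k)"
  by (auto simp: list_eq_iff_nth_eq nth_list_update)

text \<open>One factor is coordinate \<open>i\<close>; the other collects everything else. The layer
  stands for the other colours, and overwriting entry \<open>i\<close> by \<open>undefined\<close>
  forgets just this entry of the list.\<close>

lemma two_factor: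
  assumes i: "i < length Gs"
  shows "two_factor V adj w (\<lambda>x. coords x ! i) (\<lambda>x. (layer {c} `` {x}, (coords x)[i := undefined]))"
proof -
  have \<beta>: "(layer {c} `` {x}, (coords x)[i := undefined]) = (layer {c} `` {y}, (coords y)[i := undefined]) \<longleftrightarrow>
      (x, y) \<in> layer {c} \<and> (\<forall>k<length Gs. k \<noteq> i \<longrightarrow> coords x ! k = coords y ! k)"
    if "x \<in> V" "y \<in> V" for x y
    using layer_class_eq list_update_eq_iff[of "coords x" "coords y" i] length_coords that i by simp
  have ceq: "coords x = coords y" if "x \<in> V" "y \<in> V" "\<And>k. k < length Gs \<Longrightarrow> coords x ! k = coords y ! k" for x y
    using that length_coords by (intro nth_equalityI) auto
  show ?thesis
  proof (unfold_locales, goal_cases)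
    case (1 x y)
    then have "(x, y) \<in> layer {c}" using \<beta> by blast
    moreover have "coords x = coords y" using 1 \<beta> ceq by metis
    ultimately show ?case using layer_inj coords_eq_iff 1 by blast
  next
    case (2 x y)
    then have V: "x \<in> V" "y \<in> V" using adj_V adj_V' by auto
    show ?case
    proof (cases "lab x y = c")
      case True
      then obtain l where l: "adj_at Gs l (coords x) (coords y)" using adj_at_arc 2 by blast
      show ?thesis
      proof (cases "l = i")
        case True
        then show ?thesis using l \<beta>[OF V] layer_arc[OF 2, of "{c}"] \<open>lab x y = c\<close> unfolding adj_at_def by auto
      next
        case False then show ?thesis using l i unfolding adj_at_def by auto
      qed
    next
      case False then show ?thesis using coords_arc_other 2 by simp
    qed
  next
    case (3 x y)
    \<comment> \<open>A vertex with the wanted coordinates exists in the fibre of the root; moving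
      it outside colour \<open>c\<close> brings it into the layer of \<open>y\<close>.\<close>
    have "(coords y)[i := coords x ! i] \<in> prod_verts Gs"
      using i coords_prod[OF 3(1)] coords_prod[OF 3(2)] unfolding prod_verts_def by (auto simp: nth_list_update)
    then obtain v where v: "v \<in> fibre c" "coords v = (coords y)[i := coords x ! i]" by (rule coords_surj)
    obtain z where z: "(y, z) \<in> layer {c}" "(z, v) \<in> layer (- {c})" using reorder[OF 3(2) fibre_V[OF v(1)]] .
    have zV: "z \<in> V" using z 3 layer_V by blast
    have "coords z = (coords y)[i := coords x ! i]" using coords_eq_iff[OF zV fibre_V[OF v(1)]] v z by simp
    moreover have "(z, y) \<in> layer {c}" using z layer_sym by blast
    ultimately show ?case using zV 3 i length_coords by (intro bexI[of _ z] conjI) (simp_all add: layer_class_eq)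
  next
    case (4 x y x' y')
    then have V: "x \<in> V" "y \<in> V" using adj_V adj_V' by auto
    have lay: "(x, y) \<in> layer {c}" "(x', y') \<in> layer {c}" using 4 \<beta> V by blast+
    \<comment> \<open>An arc inside a \<open>c\<close>-layer has colour \<open>c\<close>, since
      otherwise its ends would share a layer and a colayer.\<close>
    have "lab x y = c"
    proof (rule ccontr)
      assume "lab x y \<noteq> c"
      then have "(x, y) \<in> layer (- {c})" using 4 by (intro layer_arc) auto
      then show False using layer_inj lay V 4 adj_irrefl by metis
    qed
    then obtain l where l: "adj_at Gs l (coords x) (coords y)" using adj_at_arc 4 by blast
    have li: "l = i" using adj_at_neq[OF Gs l] 4 \<beta>[OF V] by metis
    have "adj_at Gs i (coords x') (coords y')"
      using l 4 \<beta>[of x' y'] i li unfolding adj_at_def by auto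
    then show ?case using adj_at_lift[OF _ _ lay(2)] adj_at_lift[OF V lay(1)] l li 4 by simp
  next
    case (5 x y x' y')
    then have V: "x \<in> V" "y \<in> V" using adj_V adj_V' by auto
    have lay: "(x', x) \<in> layer {c}" "(y', y) \<in> layer {c}" using 5 \<beta> V by blast+
    have ck: "coords x' ! k = coords x ! k" "coords y' ! k = coords y ! k" if "k < length Gs" "k \<noteq> i" for k
      using that 5 \<beta> V by blast+
    show ?case
    proof (cases "lab x y = c")
      case True
      then obtain l where l: "adj_at Gs l (coords x) (coords y)" using adj_at_arc 5 by blast
      have li: "l \<noteq> i" "l < length Gs" using adj_at_neq[OF Gs l] 5 by auto
      have xy: "(x, y) \<in> layer {c}" using layer_arc 5 True by simp
      have lay': "(x', y') \<in> layer {c}" using lay xy layer_sym layer_trans by blast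
      have "coords x' ! k = coords y' ! k" if "k < length Gs" "k \<noteq> l" for k
        using l ck that 5 unfolding adj_at_def by (cases "k = i") auto
      then have "adj_at Gs l (coords x') (coords y')"
        using l ck[OF li(2,1)] li unfolding adj_at_def by auto
      then show ?thesis using adj_at_lift[OF 5(3,4) lay'] adj_at_lift[OF V xy l] ck[OF li(2,1)] by simp
    next
      case False
      then have "coords x = coords y" using coords_arc_other 5 by blast
      then have "coords x' = coords y'" using ck 5 by (intro ceq) metis+
      then have "(x', y') \<in> layer (- {c})" using coords_eq_iff 5 by blast
      then show ?thesis using lift_arc[OF lay 5(1)] False by simp
    qed
  qed
qed

lemma factor_arc:
  assumes "i < length Gs" "\<not> is_K1 (Gs ! i)"
  obtains u v where "adj u v" "lab u v = c" "adj_at Gs i (coords u) (coords v)"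
proof -
  have Wi: "weighted_graph (Gs ! i)" using Gs assms by simp
  obtain p q where pq: "gadj (Gs ! i) p q" using weighted_graph_has_edge[OF Wi assms(2)] .
  have pq': "p \<in> verts (Gs ! i)" "q \<in> verts (Gs ! i)" using weighted_graph_gadj[OF Wi pq] by auto
  have z: "coords r \<in> prod_verts Gs" using coords_prod root by blast
  define x y where "x = (coords r)[i := p]" and "y = (coords r)[i := q]"
  have "x \<in> prod_verts Gs" "y \<in> prod_verts Gs" using z pq' assms(1) unfolding x_def y_def prod_verts_def
    by (auto simp: nth_list_update)
  then obtain u v where u: "u \<in> fibre c" "coords u = x" and v: "v \<in> fibre c" "coords v = y"
    using coords_surj by metis
  have "adj_at Gs i x y" using pq assms length_coords[OF root] unfolding x_def y_def adj_at_def gadj_def by simp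
  then show ?thesis using that[of u v] adj_at_lift[OF fibre_V fibre_V fibre_layer] u v by blast
qed

text \<open>Nontrivial factors \<open>i\<close> and \<open>j\<close> both provide arcs of colour
  \<open>c\<close>. The former keep the complementary coordinate of \<open>i\<close> and the latter
  change it, so a compatible Boolean colouring would split \<open>c\<close>.\<close>

lemma unique_nontrivial_factor:
  assumes minimal: "\<And>(col :: 'a \<Rightarrow> 'a \<Rightarrow> bool) a b x y. compatible col \<Longrightarrow> adj a b \<Longrightarrow> adj x y \<Longrightarrow> lab a b = c \<Longrightarrow> lab x y = c \<Longrightarrow>
      col a b = col x y"
    and "i < length Gs" "\<not> is_K1 (Gs ! i)" "j < length Gs" "\<not> is_K1 (Gs ! j)"
  shows "i = j"
proof (rule ccontr)
  assume ij: "i \<noteq> j"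
  obtain a b where ab: "adj a b" "lab a b = c" "adj_at Gs i (coords a) (coords b)" using factor_arc assms by blast
  obtain x y where xy: "adj x y" "lab x y = c" "adj_at Gs j (coords x) (coords y)" using factor_arc assms by blast
  let ?\<beta> = "\<lambda>x. (layer {c} `` {x}, (coords x)[i := undefined])"
  interpret tf: two_factor V adj w "\<lambda>x. coords x ! i" ?\<beta> using two_factor assms by blast
  have V: "a \<in> V" "b \<in> V" "x \<in> V" "y \<in> V" using ab xy adj_V adj_V' by auto
  have "?\<beta> a = ?\<beta> b"
    using tf.arc_cases[OF ab(1)] adj_at_neq[OF Gs ab(3)] by blast
  moreover have "?\<beta> x \<noteq> ?\<beta> y"
  proof
    assume "?\<beta> x = ?\<beta> y"
    then have "(coords x)[i := undefined] ! j = (coords y)[i := undefined] ! j" by simp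
    then show False using adj_at_neq[OF Gs xy(3)] ij by simp
  qed
  ultimately show False using minimal[OF tf.compatible_beta ab(1) xy(1) ab(2) xy(2)] by blast
qed

end

section \<open>Primality of the factors\<close>

context rooted_coloured_graph
begin

text \<open>The hypothesis \<open>minimal\<close> expresses that the arcs of colour \<open>c\<close>
  belong to a single class of the generated equivalence.\<close>

lemma prime_induced:
  assumes induces: "induces c f H"
    and minimal: "\<And>(col :: 'a \<Rightarrow> 'a \<Rightarrow> bool) a b x y. compatible col \<Longrightarrow> adj a b \<Longrightarrow> adj x y \<Longrightarrow>
      lab a b = c \<Longrightarrow> lab x y = c \<Longrightarrow> col a b = col x y"
  shows "prime_graph H"
  unfolding prime_graph_def
proof (intro conjI allI impI)
  show "weighted_graph H" using induces unfolding induces_def by blast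
  fix Gs :: "nat wgraph list" assume "factorization Gs H"
  then have Gs: "Gs \<noteq> []" "\<forall>K\<in>set Gs. weighted_graph K" "graph_iso H (cart_prod Gs)"
    unfolding factorization_def by auto
  obtain \<phi> where \<phi>: "bij_betw \<phi> (verts H) (verts (cart_prod Gs))"
    "\<And>u v. u \<in> verts H \<Longrightarrow> v \<in> verts H \<Longrightarrow> gadj H u v \<longleftrightarrow> gadj (cart_prod Gs) (\<phi> u) (\<phi> v)"
    "\<And>u v. u \<in> verts H \<Longrightarrow> v \<in> verts H \<Longrightarrow> gadj H u v \<Longrightarrow> gweight (cart_prod Gs) (\<phi> u) (\<phi> v) = gweight H u v"
    using graph_isoE[OF Gs(3)] by metis
  interpret ff: factored_factor V adj w lab r c f H Gs \<phi>
    using induces Gs \<phi> by unfold_locales auto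
  have uniq: "i = j" if "i < length Gs" "\<not> is_K1 (Gs ! i)" "j < length Gs" "\<not> is_K1 (Gs ! j)" for i j
    using ff.unique_nontrivial_factor[OF _ that] minimal by blast
  \<comment> \<open>If all factors have one vertex, any index will do, and index 0 exists because
    the family is not empty.\<close>
  obtain j where "j < length Gs" "\<And>i. i < length Gs \<Longrightarrow> i \<noteq> j \<Longrightarrow> is_K1 (Gs ! i)"
  proof (cases "\<exists>j<length Gs. \<not> is_K1 (Gs ! j)")
    case True then show ?thesis using uniq that by metis
  next
    case False then show ?thesis using that[of 0] Gs(1) by blast
  qed
  then show "\<exists>K\<in>set Gs. graph_iso H K" using factor_of_trivial[OF Gs(2) _ _ Gs(3)] by (metis nth_mem)
qed

end

section \<open>A loop language\<close>

datatype exp = Const nat | Var nat | Arr nat exp exp | Inc exp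

datatype cond = SumEq exp exp exp exp | WeightEq exp exp

datatype com =
    Skip
  | Assign nat exp
  | Store nat exp exp exp
  | Seq com com  (infixr ";;" 60)
  | When bool cond com
  | For nat nat com
  | Out exp
  | ROut exp

text \<open>The entries of \<open>routs\<close> are addresses in the real memory, not reals. The
  store has no real memory of its own: it is constant and appears as the parameter \<open>w\<close>
  of the semantics.\<close>

record store =
  vars :: "nat \<Rightarrow> nat"
  arr :: "nat \<Rightarrow> nat \<Rightarrow> nat \<Rightarrow> nat"
  outs :: "nat list"
  routs :: "nat list"

definition set_var :: "nat \<Rightarrow> nat \<Rightarrow> store \<Rightarrow> store" where
  "set_var x v s = s\<lparr>vars := (vars s)(x := v)\<rparr>"

definition set_arr :: "nat \<Rightarrow> nat \<Rightarrow> nat \<Rightarrow> nat \<Rightarrow> store \<Rightarrow> store" where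
  "set_arr a i j v s = s\<lparr>arr := (arr s)(a := (arr s a)(i := (arr s a i)(j := v)))\<rparr>"

primrec aval :: "exp \<Rightarrow> store \<Rightarrow> nat" where
  "aval (Const k) s = k"
| "aval (Var x) s = vars s x"
| "aval (Arr a e1 e2) s = arr s a (aval e1 s) (aval e2 s)"
| "aval (Inc e) s = Suc (aval e s)"

text \<open>The cost also has to bound values: \<open>aval_le\<close> says that an expression
  exceeds the greatest stored number by at most its cost. This is why a constant \<open>k\<close>
  costs \<open>Suc k\<close>.\<close>

primrec ecost :: "exp \<Rightarrow> nat" where
  "ecost (Const k) = Suc k"
| "ecost (Var x) = 1"
| "ecost (Arr a e1 e2) = ecost e1 + ecost e2 + 10"
| "ecost (Inc e) = ecost e + 2"

primrec holds :: "(nat \<Rightarrow> real) \<Rightarrow> cond \<Rightarrow> store \<Rightarrow> bool" where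
  "holds w (SumEq a b c d) s \<longleftrightarrow> aval a s + aval b s = aval c s + aval d s"
| "holds w (WeightEq a b) s \<longleftrightarrow> w (aval a s) = w (aval b s)"

primrec ccost :: "cond \<Rightarrow> nat" where
  "ccost (SumEq a b c d) = ecost a + ecost b + ecost c + ecost d + 6"
| "ccost (WeightEq a b) = ecost a + ecost b + 4"

primrec iterate :: "(nat \<Rightarrow> 'a \<Rightarrow> 'a) \<Rightarrow> nat \<Rightarrow> 'a \<Rightarrow> 'a" where
  "iterate f 0 s = s"
| "iterate f (Suc n) s = f n (iterate f n s)"

text \<open>After a \<open>For\<close> loop the counter holds the bound, as it does in the compiled
  code, which leaves the loop when the counter has reached the bound.\<close>

primrec ev :: "(nat \<Rightarrow> real) \<Rightarrow> com \<Rightarrow> store \<Rightarrow> store" where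
  "ev w Skip = (\<lambda>s. s)"
| "ev w (Assign x e) = (\<lambda>s. set_var x (aval e s) s)"
| "ev w (Store a i j e) = (\<lambda>s. set_arr a (aval i s) (aval j s) (aval e s) s)"
| "ev w (c1 ;; c2) = (\<lambda>s. ev w c2 (ev w c1 s))"
| "ev w (When b q c) = (\<lambda>s. if holds w q s = b then ev w c s else s)"
| "ev w (For x y c) = (\<lambda>s. set_var x (vars s y) (iterate (\<lambda>i s. ev w c (set_var x i s)) (vars s y) s))"
| "ev w (Out e) = (\<lambda>s. s\<lparr>outs := outs s @ [aval e s]\<rparr>)"
| "ev w (ROut e) = (\<lambda>s. s\<lparr>routs := routs s @ [aval e s]\<rparr>)"

primrec cost :: "(nat \<Rightarrow> real) \<Rightarrow> com \<Rightarrow> store \<Rightarrow> nat" where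
  "cost w Skip = (\<lambda>s. 0)"
| "cost w (Assign x e) = (\<lambda>s. ecost e + 1)"
| "cost w (Store a i j e) = (\<lambda>s. ecost i + ecost j + ecost e + 10)"
| "cost w (c1 ;; c2) = (\<lambda>s. cost w c1 s + cost w c2 (ev w c1 s))"
| "cost w (When b q c) = (\<lambda>s. ccost q + (if holds w q s = b then cost w c s else 0))"
| "cost w (For x y c) = (\<lambda>s. 2 + (\<Sum>k<vars s y.
      cost w c (set_var x k (iterate (\<lambda>i s. ev w c (set_var x i s)) k s)) + 4))"
| "cost w (Out e) = (\<lambda>s. ecost e + 1)"
| "cost w (ROut e) = (\<lambda>s. ecost e + 1)"

primrec assigned :: "com \<Rightarrow> nat set" where
  "assigned Skip = {}"
| "assigned (Assign x e) = {x}"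
| "assigned (Store a i j e) = {}"
| "assigned (c1 ;; c2) = assigned c1 \<union> assigned c2"
| "assigned (When b q c) = assigned c"
| "assigned (For x y c) = insert x (assigned c)"
| "assigned (Out e) = {}"
| "assigned (ROut e) = {}"

primrec stored :: "com \<Rightarrow> nat set" where
  "stored Skip = {}"
| "stored (Assign x e) = {}"
| "stored (Store a i j e) = {a}"
| "stored (c1 ;; c2) = stored c1 \<union> stored c2"
| "stored (When b q c) = stored c"
| "stored (For x y c) = stored c"
| "stored (Out e) = {}"
| "stored (ROut e) = {}"

primrec silent :: "com \<Rightarrow> bool" where
  "silent Skip \<longleftrightarrow> True"
| "silent (Assign x e) \<longleftrightarrow> True"
| "silent (Store a i j e) \<longleftrightarrow> True"
| "silent (c1 ;; c2) \<longleftrightarrow> silent c1 \<and> silent c2"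
| "silent (When b q c) \<longleftrightarrow> silent c"
| "silent (For x y c) \<longleftrightarrow> silent c"
| "silent (Out e) \<longleftrightarrow> False"
| "silent (ROut e) \<longleftrightarrow> False"

lemma set_var_simps [simp]:
  "vars (set_var x v s) = (vars s)(x := v)" "arr (set_var x v s) = arr s"
  "outs (set_var x v s) = outs s" "routs (set_var x v s) = routs s"
  by (simp_all add: set_var_def)

lemma set_arr_simps [simp]:
  "vars (set_arr a i j v s) = vars s" "outs (set_arr a i j v s) = outs s"
  "routs (set_arr a i j v s) = routs s"
  "arr (set_arr a i j v s) = (arr s)(a := (arr s a)(i := (arr s a i)(j := v)))"
  by (simp_all add: set_arr_def)

lemma vars_frame: "x \<notin> assigned c \<Longrightarrow> vars (ev w c s) x = vars s x"
proof (induction c arbitrary: s)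
  case (For z y c)
  have "vars (iterate (\<lambda>i s. ev w c (set_var z i s)) n s) x = vars s x" for n
    using For by (induction n) auto
  then show ?case using For by simp
qed auto

lemma arr_frame: "a \<notin> stored c \<Longrightarrow> arr (ev w c s) a = arr s a"
proof (induction c arbitrary: s)
  case (For z y c)
  have "arr (iterate (\<lambda>i s. ev w c (set_var z i s)) n s) a = arr s a" for n
    using For by (induction n) auto
  then show ?case using For by simp
qed auto

lemma outs_frame: "silent c \<Longrightarrow> outs (ev w c s) = outs s \<and> routs (ev w c s) = routs s"
proof (induction c arbitrary: s)
  case (For z y c)
  have "outs (iterate (\<lambda>i s. ev w c (set_var z i s)) n s) = outs s \<and>
      routs (iterate (\<lambda>i s. ev w c (set_var z i s)) n s) = routs s" for n
    using For by (induction n) auto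
  then show ?case using For by simp
qed auto

section \<open>Compilation\<close>

text \<open>Variables live in cells below 40, the base address of the arrays in cell 40, temporaries in
  cells 41 to 63. Entry \<open>(i, j)\<close> of array \<open>a\<close> is in cell \<open>base + a + 32 * ((i + j)\<^sup>2 + j)\<close>: the
  arrays interleave, so that they never collide.\<close>

definition entry :: "nat \<Rightarrow> nat \<Rightarrow> nat \<Rightarrow> nat \<Rightarrow> nat" where
  "entry off a i j = off + a + 32 * ((i + j) * (i + j) + j)"

text \<open>With \<open>s = i + j\<close>, the number \<open>s * s + j\<close> lies between
  \<open>s * s\<close> and \<open>s * s + s\<close>, hence below the square of \<open>s + 1\<close>.
  So it determines \<open>s\<close>, and then \<open>j\<close>.\<close>

lemma square_pairing_inj:
  fixes i j i' j' :: nat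
  assumes "(i + j) * (i + j) + j = (i' + j') * (i' + j') + j'"
  shows "i = i' \<and> j = j'"
proof -
  have less: "(i + j) * (i + j) + j < (i' + j') * (i' + j') + j'" if "i + j < i' + j'" for i j i' j' :: nat
  proof -
    have "(i + j + 1) * (i + j + 1) \<le> (i' + j') * (i' + j')" using that by (intro mult_mono) auto
    then show ?thesis by (simp add: algebra_simps)
  qed
  have "i + j = i' + j'" using less[of i j i' j'] less[of i' j' i j] assms by linarith
  then show ?thesis using assms by simp
qed

lemma entry_inj:
  assumes "a < 32" "a' < 32" "entry off a i j = entry off a' i' j'"
  shows "a = a' \<and> i = i' \<and> j = j'"
proof -
  have pair: "a = a' \<and> p = p'" if "off + a + 32 * p = off + a' + 32 * p'" for p p' :: nat
  proof -
    have "p = p'"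
      using that assms(1,2) by (cases p p' rule: linorder_cases) linarith+
    then show ?thesis using that by linarith
  qed
  note * = pair[OF assms(3)[unfolded entry_def]]
  show ?thesis using *[THEN conjunct1] square_pairing_inj[OF *[THEN conjunct2]] by (rule conjI)
qed

abbreviation temp :: nat where "temp \<equiv> 41"

definition addr_code :: "nat \<Rightarrow> nat \<Rightarrow> instr list" where
  "addr_code a t =
     [NArith NAdd (Dir t) (Dir t) (Dir (Suc t)), NArith NMul (Dir t) (Dir t) (Dir t),
      NArith NAdd (Dir t) (Dir t) (Dir (Suc t)), NConst (Dir (Suc t)) 32,
      NArith NMul (Dir t) (Dir t) (Dir (Suc t)), NArith NAdd (Dir t) (Dir t) (Dir 40),
      NConst (Dir (Suc t)) a, NArith NAdd (Dir t) (Dir t) (Dir (Suc t))]"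

primrec exp_code :: "nat \<Rightarrow> exp \<Rightarrow> instr list" where
  "exp_code t (Const k) = [NConst (Dir t) k]"
| "exp_code t (Var x) = [NMove (Dir t) (Dir x)]"
| "exp_code t (Arr a e1 e2) = exp_code t e1 @ exp_code (Suc t) e2 @ addr_code a t @ [NMove (Dir t) (Ind t)]"
| "exp_code t (Inc e) = exp_code t e @ [NConst (Dir (Suc t)) 1, NArith NAdd (Dir t) (Dir t) (Dir (Suc t))]"

text \<open>\<open>exp_code t e\<close> uses the temporaries from \<open>t\<close> up to \<open>t + depth e - 1\<close>.\<close>

primrec depth :: "exp \<Rightarrow> nat" where
  "depth (Const k) = 1"
| "depth (Var x) = 1"
| "depth (Arr a e1 e2) = max (depth e1) (Suc (depth e2))"
| "depth (Inc e) = max 2 (depth e)"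

primrec exp_ok :: "exp \<Rightarrow> bool" where
  "exp_ok (Const k) \<longleftrightarrow> True"
| "exp_ok (Var x) \<longleftrightarrow> x < 40"
| "exp_ok (Arr a e1 e2) \<longleftrightarrow> a < 32 \<and> exp_ok e1 \<and> exp_ok e2"
| "exp_ok (Inc e) \<longleftrightarrow> exp_ok e"

text \<open>\<open>cond_code\<close> starts evaluations at temporary 43 at the latest, so a depth of
  20 stays below cell 64.\<close>

abbreviation good :: "exp \<Rightarrow> bool" where
  "good e \<equiv> exp_ok e \<and> depth e \<le> 20"

primrec cond_code :: "cond \<Rightarrow> instr list" where
  "cond_code (SumEq a b c d) =
     exp_code temp a @ exp_code (Suc temp) b @ [NArith NAdd (Dir temp) (Dir temp) (Dir (Suc temp))] @
     exp_code (Suc temp) c @ exp_code (Suc (Suc temp)) d @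
     [NArith NAdd (Dir (Suc temp)) (Dir (Suc temp)) (Dir (Suc (Suc temp)))]"
| "cond_code (WeightEq a b) = exp_code temp a @ exp_code (Suc temp) b"

text \<open>Equality takes two comparisons because the machine only branches on
  \<open>\<le>\<close>. The targets are \<open>l\<close> for equality and \<open>l'\<close>
  otherwise; \<open>p\<close> is the address of the code itself.\<close>

primrec branch_code :: "cond \<Rightarrow> nat \<Rightarrow> nat \<Rightarrow> nat \<Rightarrow> instr list" where
  "branch_code (SumEq a b c d) p l l' =
     [NJumpLe (Dir temp) (Dir (Suc temp)) (p + 2), Jump l', NJumpLe (Dir (Suc temp)) (Dir temp) l, Jump l']"
| "branch_code (WeightEq a b) p l l' =
     [RJumpLe (Ind temp) (Ind (Suc temp)) (p + 2), Jump l', RJumpLe (Ind (Suc temp)) (Ind temp) l, Jump l']"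

primrec cond_ok :: "cond \<Rightarrow> bool" where
  "cond_ok (SumEq a b c d) \<longleftrightarrow> good a \<and> good b \<and> good c \<and> good d"
| "cond_ok (WeightEq a b) \<longleftrightarrow> good a \<and> good b"

primrec compile :: "com \<Rightarrow> nat \<Rightarrow> instr list" where
  "compile Skip p = []"
| "compile (Assign x e) p = exp_code temp e @ [NMove (Dir x) (Dir temp)]"
| "compile (Store a i j e) p = exp_code temp i @ exp_code (Suc temp) j @ addr_code a temp @
     exp_code (Suc temp) e @ [NMove (Ind temp) (Dir (Suc temp))]"
| "compile (c1 ;; c2) p = compile c1 p @ compile c2 (p + length (compile c1 p))"
| "compile (When b q c) p =
     (let p1 = p + length (cond_code q); p2 = p1 + 4; l = p2 + length (compile c p2)
      in cond_code q @ branch_code q p1 (if b then p2 else l) (if b then l else p2) @ compile c p2)"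
| "compile (For x y c) p =
     [NConst (Dir x) 0, NJumpLe (Dir y) (Dir x) (p + 5 + length (compile c (p + 2)))] @ compile c (p + 2) @
     [NConst (Dir temp) 1, NArith NAdd (Dir x) (Dir x) (Dir temp), Jump (p + 1)]"
| "compile (Out e) p = exp_code temp e @ [NWrite (Dir temp)]"
| "compile (ROut e) p = exp_code temp e @ [RWrite (Ind temp)]"

primrec com_ok :: "com \<Rightarrow> bool" where
  "com_ok Skip \<longleftrightarrow> True"
| "com_ok (Assign x e) \<longleftrightarrow> x < 40 \<and> good e"
| "com_ok (Store a i j e) \<longleftrightarrow> a < 32 \<and> good i \<and> good j \<and> good e"
| "com_ok (c1 ;; c2) \<longleftrightarrow> com_ok c1 \<and> com_ok c2"
| "com_ok (When b q c) \<longleftrightarrow> cond_ok q \<and> com_ok c"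
| "com_ok (For x y c) \<longleftrightarrow> x < 40 \<and> y < 40 \<and> x \<noteq> y \<and> x \<notin> assigned c \<and> y \<notin> assigned c \<and> com_ok c"
| "com_ok (Out e) \<longleftrightarrow> good e"
| "com_ok (ROut e) \<longleftrightarrow> good e"

primrec code_at :: "program \<Rightarrow> nat \<Rightarrow> instr list \<Rightarrow> bool" where
  "code_at P p [] \<longleftrightarrow> p \<le> length P"
| "code_at P p (i # is) \<longleftrightarrow> p < length P \<and> P ! p = i \<and> code_at P (Suc p) is"

lemma code_at_le: "code_at P p is \<Longrightarrow> p \<le> length P"
  by (cases "is") auto

lemma code_at_append [simp]:
  "code_at P p (xs @ ys) \<longleftrightarrow> code_at P p xs \<and> code_at P (p + length xs) ys"
  by (induction xs arbitrary: p) (auto dest: code_at_le)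

lemma code_at_self: "code_at (xs @ ys @ zs) (length xs) ys"
proof (induction ys arbitrary: xs)
  case (Cons y ys)
  from Cons[of "xs @ [y]"] show ?case by simp
qed simp

definition runs :: "nat \<Rightarrow> program \<Rightarrow> state \<Rightarrow> nat \<Rightarrow> state \<Rightarrow> bool" where
  "runs W P s t s' \<longleftrightarrow> (step W P ^^ t) s s'"

lemma runs_0 [simp]: "runs W P s 0 s"
  unfolding runs_def by simp

lemma runs_trans: "runs W P s t s' \<Longrightarrow> runs W P s' u s'' \<Longrightarrow> runs W P s (t + u) s''"
  unfolding runs_def by (auto simp: relpowp_add)

lemma runs_Suc:
  "pc s < length P \<Longrightarrow> exec W (P ! pc s) s = Some s' \<Longrightarrow> runs W P s' t s'' \<Longrightarrow> runs W P s (Suc t) s''"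
  unfolding runs_def by (rule relpowp_Suc_I2) (auto simp: step_def)

lemma runs_1: "pc s < length P \<Longrightarrow> exec W (P ! pc s) s = Some s' \<Longrightarrow> runs W P s 1 s'"
  using runs_Suc[OF _ _ runs_0] by simp

section \<open>Simulation of the loop language by the machine\<close>

definition bounded :: "nat \<Rightarrow> store \<Rightarrow> bool" where
  "bounded M s \<longleftrightarrow> (\<forall>x<40. vars s x \<le> M) \<and> (\<forall>a<32. \<forall>i j. arr s a i j \<le> M)"

definition represents :: "(nat \<Rightarrow> real) \<Rightarrow> nat \<Rightarrow> store \<Rightarrow> state \<Rightarrow> bool" where
  "represents w off s S \<longleftrightarrow> 64 \<le> off \<and> (\<forall>x<40. nmem S x = vars s x) \<and> nmem S 40 = off \<and>
     (\<forall>a<32. \<forall>i j. nmem S (entry off a i j) = arr s a i j) \<and>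
     rmem S = w \<and> nout S = outs s \<and> rout S = map w (routs s)"

text \<open>The left-hand side exceeds every address \<open>entry off a i j\<close> with
  \<open>a < 32\<close> and \<open>i, j \<le> B\<close>, and also the sum of any two values up to
  \<open>B\<close>.\<close>

definition fits :: "nat \<Rightarrow> nat \<Rightarrow> nat \<Rightarrow> bool" where
  "fits off B W \<longleftrightarrow> off + 32 * (4 * (B * B) + 2 * B + 1) \<le> W"

lemma fitsE:
  assumes "fits off B W" obtains R where "B * B = R" "off + 128 * R + 64 * B + 32 \<le> W"
  using assms that[of "B * B"] unfolding fits_def by simp

lemma fits_le: "fits off B W \<Longrightarrow> off + 64 * B + 32 \<le> W"
  by (erule fitsE) linarith

definition same :: "nat \<Rightarrow> state \<Rightarrow> state \<Rightarrow> bool" where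
  "same t S S' \<longleftrightarrow> (\<forall>k. k < t \<or> 64 \<le> k \<longrightarrow> nmem S' k = nmem S k) \<and>
     rmem S' = rmem S \<and> nout S' = nout S \<and> rout S' = rout S"

lemma same_refl [simp]: "same t S S"
  by (simp add: same_def)

lemma same_trans: "same t S S' \<Longrightarrow> same u S' S'' \<Longrightarrow> t \<le> u \<Longrightarrow> same t S S''"
  unfolding same_def by (metis order.strict_trans2)

lemma same_nmem: "same t S S' \<Longrightarrow> k < t \<Longrightarrow> nmem S' k = nmem S k"
  unfolding same_def by blast

lemma entry_ge: "off \<le> entry off a i j"
  unfolding entry_def by simp

lemma represents_same:
  assumes "represents w off s S" "same temp S S'" shows "represents w off s S'"
proof -
  have "64 \<le> entry off a i j" for a i j
    using assms(1) le_trans[OF _ entry_ge] unfolding represents_def by blast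
  then have "nmem S' (entry off a i j) = nmem S (entry off a i j)" for a i j
    using assms(2) unfolding same_def by blast
  then show ?thesis using assms unfolding represents_def same_def by auto
qed

primrec straight :: "instr \<Rightarrow> bool" where
  "straight (NConst a k) = True"
| "straight (NMove a b) = True"
| "straight (NArith f a b c) = True"
| "straight (RConst a k) = True"
| "straight (RMove a b) = True"
| "straight (RArith g a b c) = True"
| "straight (Jump l) = False"
| "straight (NJumpLe a b l) = False"
| "straight (RJumpLe a b l) = False"
| "straight (NWrite a) = True"
| "straight (RWrite a) = True"

text \<open>Jump-free code is evaluated without reference to its position in a program;
  \<open>runs_exec_list\<close> transfers the result to steps of the machine.\<close>

primrec exec_list :: "nat \<Rightarrow> instr list \<Rightarrow> state \<Rightarrow> state option" where
  "exec_list W [] S = Some S"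
| "exec_list W (i # is) S = (case exec W i S of None \<Rightarrow> None | Some S' \<Rightarrow> exec_list W is S')"

lemma exec_list_append:
  "exec_list W (xs @ ys) S = (case exec_list W xs S of None \<Rightarrow> None | Some S' \<Rightarrow> exec_list W ys S')"
  by (induction xs arbitrary: S) (auto split: option.split)

lemma exec_straight: "exec W i S = Some S' \<Longrightarrow> straight i \<Longrightarrow> pc S' = Suc (pc S)"
  by (cases i) (auto simp: nstore_def rstore_def advance_def split: if_splits)

lemma runs_exec_list:
  "exec_list W is S = Some S' \<Longrightarrow> list_all straight is \<Longrightarrow> code_at P (pc S) is \<Longrightarrow>
    runs W P S (length is) S' \<and> pc S' = pc S + length is"
proof (induction "is" arbitrary: S)
  case (Cons i "is")
  then obtain S1 where S1: "exec W i S = Some S1" "exec_list W is S1 = Some S'"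
    by (auto split: option.splits)
  then have pc: "pc S1 = Suc (pc S)" using Cons exec_straight by auto
  then have r: "runs W P S1 (length is) S'" "pc S' = pc S1 + length is"
    using Cons.IH[OF S1(2)] Cons.prems by simp_all
  have "runs W P S (Suc (length is)) S'"
    by (rule runs_Suc[OF _ _ r(1)]) (use S1 Cons.prems in simp_all)
  then show ?case using r(2) pc by simp
qed auto

lemma aval_le:
  assumes "bounded M s" "exp_ok e" shows "aval e s \<le> M + ecost e"
  using assms(2)
proof (induction e)
  case (Var x)
  then have "vars s x \<le> M" using assms(1) unfolding bounded_def by simp
  then show ?case by simp
next
  case (Arr a e1 e2)
  then have "arr s a (aval e1 s) (aval e2 s) \<le> M" using assms(1) unfolding bounded_def by simp
  then show ?case by simp
qed auto

lemma length_exp_code: "length (exp_code t e) \<le> ecost e"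
proof (induction e arbitrary: t)
  case (Arr a e1 e2)
  from Arr(1)[of t] Arr(2)[of "Suc t"] show ?case by (simp add: addr_code_def)
next
  case (Inc e)
  from Inc[of t] show ?case by simp
qed auto

lemma straight_exp_code: "list_all straight (exp_code t e)"
  by (induction e arbitrary: t) (auto simp: addr_code_def)

lemma straight_addr_code [simp]: "list_all straight (addr_code a t)"
  by (auto simp: addr_code_def)

lemma length_addr_code [simp]: "length (addr_code a t) = 8"
  by (simp add: addr_code_def)

lemma addr_exec:
  assumes t: "temp \<le> t" "Suc t < 64" and off: "nmem S 40 = off" "64 \<le> off" and a: "a < 32"
    and ij: "nmem S t = i" "nmem S (Suc t) = j" "i \<le> B" "j \<le> B" and fits: "fits off B W"
  shows "\<exists>S'. exec_list W (addr_code a t) S = Some S' \<and> nmem S' t = entry off a i j \<and> same t S S'"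
proof -
  have q: "(i + j) * (i + j) \<le> 4 * (B * B)"
  proof -
    have "(i + j) * (i + j) \<le> (2 * B) * (2 * B)" using ij by (intro mult_mono) auto
    then show ?thesis by simp
  qed
  define Q where "Q = (i + j) * (i + j)"
  obtain R where W: "B * B = R" "off + 128 * R + 64 * B + 32 \<le> W" using fitsE[OF fits] .
  \<comment> \<open>The word bound applies to every intermediate result of the address computation,
    not only to the final address.\<close>
  have 1: "i + j \<le> W" "Q \<le> W" "Q + j \<le> W" "32 \<le> W" "a \<le> W"
      "32 * Q + 32 * j \<le> W" "32 * Q + 32 * j + off \<le> W" "32 * Q + 32 * j + off + a \<le> W"
    using q W(2) ij(3,4) a unfolding Q_def[symmetric] W(1) by linarith+
  then have 2: "(Q + j) * 32 \<le> W" "(Q + j) * 32 + off \<le> W" "(Q + j) * 32 + off + a \<le> W"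
    by (simp_all add: distrib_right mult.commute)
  have 3: "entry off a i j = (Q + j) * 32 + off + a"
    unfolding entry_def Q_def by (simp add: ac_simps)
  show ?thesis
    using assms 1(1-5) 2 unfolding addr_code_def 3
    by (simp add: nstore_def advance_def Q_def[symmetric] same_def)
qed

lemma exp_exec:
  assumes "represents w off s S" "exp_ok e" "temp \<le> t" "t + depth e \<le> 64" "bounded M s"
    "M + ecost e \<le> B" "fits off B W"
  shows "\<exists>S'. exec_list W (exp_code t e) S = Some S' \<and> nmem S' t = aval e s \<and> same t S S'"
  using assms
proof (induction e arbitrary: t S)
  case (Const k)
  then have "k \<le> W" unfolding fits_def by simp
  then show ?case using Const by (simp add: nstore_def advance_def same_def)
next
  case (Var x)
  then have "vars s x \<le> B" unfolding bounded_def by (auto intro: order.trans[OF _ add_leD1])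
  moreover have "B \<le> W" using fits_le[OF Var.prems(7)] by linarith
  ultimately show ?case using Var by (simp add: nstore_def advance_def same_def represents_def)
next
  case (Arr a e1 e2)
  have "M + ecost e1 \<le> B" "M + ecost e2 \<le> B" using Arr.prems by simp_all
  note le = this
  obtain S1 where S1: "exec_list W (exp_code t e1) S = Some S1" "nmem S1 t = aval e1 s" "same t S S1"
    using Arr.IH(1)[of S t] Arr.prems le by fastforce
  have r1: "represents w off s S1"
    using represents_same[OF Arr.prems(1) same_trans[OF same_refl S1(3) Arr.prems(3)]] .
  obtain S2 where S2: "exec_list W (exp_code (Suc t) e2) S1 = Some S2" "nmem S2 (Suc t) = aval e2 s"
      "same (Suc t) S1 S2"
    using Arr.IH(2)[of S1 "Suc t"] Arr.prems le r1 by fastforce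
  have r2: "represents w off s S2"
    using represents_same[OF r1 same_trans[OF same_refl S2(3)]] Arr.prems(3) by simp
  have t: "nmem S2 t = aval e1 s" using S2 S1 same_nmem by simp
  have "aval e1 s \<le> B" "aval e2 s \<le> B" using aval_le[OF Arr.prems(5)] Arr.prems(2) le by fastforce+
  moreover have "Suc t < 64" using Arr.prems(4) by (cases e2) auto
  moreover have "nmem S2 40 = off" "64 \<le> off" using r2 unfolding represents_def by auto
  ultimately obtain S3 where S3: "exec_list W (addr_code a t) S2 = Some S3"
      "nmem S3 t = entry off a (aval e1 s) (aval e2 s)" "same t S2 S3"
    using addr_exec[OF Arr.prems(3) _ _ _ _ t S2(2) _ _ Arr.prems(7), of a] Arr.prems(2) by auto
  have r3: "represents w off s S3"
    using represents_same[OF r2 same_trans[OF same_refl S3(3) Arr.prems(3)]] .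
  have v: "nmem S3 (entry off a (aval e1 s) (aval e2 s)) = arr s a (aval e1 s) (aval e2 s)"
    using r3 Arr.prems(2) unfolding represents_def by simp
  have "arr s a (aval e1 s) (aval e2 s) \<le> M" using Arr.prems unfolding bounded_def by simp
  then have "arr s a (aval e1 s) (aval e2 s) \<le> W" using Arr.prems unfolding fits_def by simp
  moreover have "same t S S3" using same_trans[OF same_trans[OF S1(3) S2(3)] S3(3)] by simp
  ultimately show ?case using S1 S2 S3 v \<open>Suc t < 64\<close>
    by (simp add: exec_list_append nstore_def advance_def same_def)
next
  case (Inc e)
  obtain S1 where S1: "exec_list W (exp_code t e) S = Some S1" "nmem S1 t = aval e s" "same t S S1"
    using Inc.IH[of S t] Inc.prems by fastforce
  have "aval e s \<le> M + ecost e" using aval_le Inc.prems by simp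
  moreover obtain R where "off + 128 * R + 64 * B + 32 \<le> W" using fitsE[OF Inc.prems(7)] .
  ultimately have "Suc (aval e s) \<le> W" using Inc.prems(6) by simp
  moreover have "Suc t < 64" using Inc.prems(4) by simp
  ultimately show ?case using S1 by (simp add: exec_list_append nstore_def advance_def same_def)
qed

lemma represents_set_var:
  assumes "represents w off s S" "x < 40"
  shows "represents w off (set_var x v s) (S\<lparr>pc := p, nmem := (nmem S)(x := v)\<rparr>)"
proof -
  have "entry off a i j \<noteq> x" for a i j
    using assms entry_ge[of off a i j] unfolding represents_def by linarith
  then show ?thesis using assms unfolding represents_def by auto
qed

lemma represents_set_arr:
  assumes "represents w off s S" "a < 32"
  shows "represents w off (set_arr a i j v s) (S\<lparr>pc := p, nmem := (nmem S)(entry off a i j := v)\<rparr>)"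
proof -
  have ge: "64 \<le> entry off a i j"
    using assms entry_ge[of off a i j] unfolding represents_def by linarith
  have "((nmem S)(entry off a i j := v)) (entry off a' i' j') = arr (set_arr a i j v s) a' i' j'"
    if "a' < 32" for a' i' j'
  proof (cases "a' = a \<and> i' = i \<and> j' = j")
    case False
    then have "entry off a' i' j' \<noteq> entry off a i j" using entry_inj[OF that assms(2)] by metis
    then show ?thesis using False that assms unfolding represents_def by auto
  qed simp
  then show ?thesis using assms ge unfolding represents_def by auto
qed

lemma represents_pc: "represents w off s S \<Longrightarrow> represents w off s (S\<lparr>pc := p\<rparr>)"
  unfolding represents_def by simp

lemma bounded_mono: "bounded M s \<Longrightarrow> M \<le> M' \<Longrightarrow> bounded M' s"
  unfolding bounded_def by (meson le_trans)

lemma bounded_set_var: "bounded M s \<Longrightarrow> v \<le> M \<Longrightarrow> bounded M (set_var x v s)"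
  unfolding bounded_def by simp

lemma bounded_set_arr: "bounded M s \<Longrightarrow> v \<le> M \<Longrightarrow> bounded M (set_arr a i j v s)"
  unfolding bounded_def by simp

lemma cond_exec:
  assumes r: "represents w off s S" and ok: "cond_ok q" and bd: "bounded M s"
    and B: "M + ccost q \<le> B" and fits: "fits off B W"
  shows "\<exists>S'. exec_list W (cond_code q) S = Some S' \<and> represents w off s S' \<and>
    (case q of SumEq a b c d \<Rightarrow> nmem S' temp = aval a s + aval b s \<and> nmem S' (Suc temp) = aval c s + aval d s
      | WeightEq a b \<Rightarrow> nmem S' temp = aval a s \<and> nmem S' (Suc temp) = aval b s)"
proof (cases q)
  case (SumEq a b c d)
  have g: "exp_ok a" "exp_ok b" "exp_ok c" "exp_ok d" "depth a \<le> 20" "depth b \<le> 20" "depth c \<le> 20" "depth d \<le> 20"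
    using ok SumEq by auto
  have le: "M + ecost a \<le> B" "M + ecost b \<le> B" "M + ecost c \<le> B" "M + ecost d \<le> B"
    using B SumEq by auto
  obtain R where "off + 128 * R + 64 * B + 32 \<le> W" using fitsE[OF fits] .
  then have av: "aval a s + aval b s \<le> W" "aval c s + aval d s \<le> W"
    using aval_le[OF bd g(1)] aval_le[OF bd g(2)] aval_le[OF bd g(3)] aval_le[OF bd g(4)] le by linarith+
  obtain S1 where S1: "exec_list W (exp_code temp a) S = Some S1" "nmem S1 temp = aval a s" "same temp S S1"
    using exp_exec[OF r g(1) _ _ bd le(1) fits, of temp] g by auto
  note r1 = represents_same[OF r S1(3)]
  obtain S2 where S2: "exec_list W (exp_code (Suc temp) b) S1 = Some S2" "nmem S2 (Suc temp) = aval b s"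
      "same (Suc temp) S1 S2"
    using exp_exec[OF r1 g(2) _ _ bd le(2) fits, of "Suc temp"] g by auto
  have s2: "nmem S2 temp = aval a s" using S1 S2 same_nmem by simp
  define S3 where "S3 = S2\<lparr>pc := Suc (pc S2), nmem := (nmem S2)(temp := aval a s + aval b s)\<rparr>"
  have e3: "exec W (NArith NAdd (Dir temp) (Dir temp) (Dir (Suc temp))) S2 = Some S3"
    using av S2 s2 by (simp add: S3_def nstore_def advance_def)
  have sm3: "same temp S S3" using same_trans[OF S1(3) S2(3)] unfolding S3_def same_def by simp
  note r3 = represents_same[OF r sm3]
  obtain S4 where S4: "exec_list W (exp_code (Suc temp) c) S3 = Some S4" "nmem S4 (Suc temp) = aval c s"
      "same (Suc temp) S3 S4"
    using exp_exec[OF r3 g(3) _ _ bd le(3) fits, of "Suc temp"] g by auto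
  have sm4: "same temp S S4" using same_trans[OF sm3 S4(3)] by simp
  note r4 = represents_same[OF r sm4]
  obtain S5 where S5: "exec_list W (exp_code (Suc (Suc temp)) d) S4 = Some S5"
      "nmem S5 (Suc (Suc temp)) = aval d s" "same (Suc (Suc temp)) S4 S5"
    using exp_exec[OF r4 g(4) _ _ bd le(4) fits, of "Suc (Suc temp)"] g by auto
  have s5: "nmem S5 (Suc temp) = aval c s" "nmem S5 temp = aval a s + aval b s"
    using S4 S5 same_nmem[OF S5(3)] same_nmem[OF S4(3), of temp] by (simp_all add: S3_def)
  define S6 where "S6 = S5\<lparr>pc := Suc (pc S5), nmem := (nmem S5)(Suc temp := aval c s + aval d s)\<rparr>"
  have e6: "exec W (NArith NAdd (Dir (Suc temp)) (Dir (Suc temp)) (Dir (Suc (Suc temp)))) S5 = Some S6"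
    using av S5 s5 by (simp add: S6_def nstore_def advance_def)
  have "same temp S S6" using same_trans[OF sm4 S5(3)] unfolding S6_def same_def by simp
  note r6 = represents_same[OF r this]
  have "exec_list W (cond_code q) S = Some S6"
    using S1 S2 e3 S4 S5 e6 by (simp add: SumEq exec_list_append del: exec.simps)
  moreover have "nmem S6 temp = aval a s + aval b s" "nmem S6 (Suc temp) = aval c s + aval d s"
    using s5 by (simp_all add: S6_def)
  ultimately show ?thesis using r6 SumEq by auto
next
  case (WeightEq a b)
  have g: "exp_ok a" "exp_ok b" "depth a \<le> 20" "depth b \<le> 20" using ok WeightEq by auto
  have le: "M + ecost a \<le> B" "M + ecost b \<le> B" using B WeightEq by auto
  obtain S1 where S1: "exec_list W (exp_code temp a) S = Some S1" "nmem S1 temp = aval a s" "same temp S S1"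
    using exp_exec[OF r g(1) _ _ bd le(1) fits, of temp] g by auto
  note r1 = represents_same[OF r S1(3)]
  obtain S2 where S2: "exec_list W (exp_code (Suc temp) b) S1 = Some S2" "nmem S2 (Suc temp) = aval b s"
      "same (Suc temp) S1 S2"
    using exp_exec[OF r1 g(2) _ _ bd le(2) fits, of "Suc temp"] g by auto
  have s2: "nmem S2 temp = aval a s" using S1 S2 same_nmem by simp
  have "same temp S S2" using same_trans[OF S1(3) S2(3)] by simp
  note r2 = represents_same[OF r this]
  have "exec_list W (cond_code q) S = Some S2"
    using S1 S2 by (simp add: WeightEq exec_list_append)
  then show ?thesis using r2 s2 S2 WeightEq by auto
qed

lemma straight_cond_code: "list_all straight (cond_code q)"
  by (cases q) (auto simp: straight_exp_code)

lemma length_cond_code: "length (cond_code q) + 4 \<le> ccost q"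
proof (cases q)
  case (SumEq a b c d)
  then show ?thesis using length_exp_code[of temp a] length_exp_code[of "Suc temp" b]
    length_exp_code[of "Suc temp" c] length_exp_code[of "Suc (Suc temp)" d] by simp
next
  case (WeightEq a b)
  then show ?thesis using length_exp_code[of temp a] length_exp_code[of "Suc temp" b] by simp
qed

lemma length_branch_code [simp]: "length (branch_code q p l l') = 4"
  by (cases q) auto

lemma test_runs:
  assumes r: "represents w off s S" and "code_at P (pc S) (branch_code q (pc S) l l')"
    and c: "case q of SumEq a b c d \<Rightarrow> nmem S temp = aval a s + aval b s \<and> nmem S (Suc temp) = aval c s + aval d s
      | WeightEq a b \<Rightarrow> nmem S temp = aval a s \<and> nmem S (Suc temp) = aval b s"
  shows "\<exists>t\<le>4. runs W P S t (S\<lparr>pc := if holds w q s then l else l'\<rparr>)"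
proof -
  \<comment> \<open>Natural numbers are embedded into the reals here, so that sums and weights are
    both compared as two reals \<open>x\<close> and \<open>y\<close>.\<close>
  obtain x y :: real and i1 i2 where
    code: "pc S + 3 < length P" "P ! pc S = i1" "P ! Suc (pc S) = Jump l'" "P ! (pc S + 2) = i2"
      "P ! (pc S + 3) = Jump l'"
    and i1: "\<And>p. exec W i1 (S\<lparr>pc := p\<rparr>) = jump_if (x \<le> y) (S\<lparr>pc := p\<rparr>) (pc S + 2)"
    and i2: "\<And>p. exec W i2 (S\<lparr>pc := p\<rparr>) = jump_if (y \<le> x) (S\<lparr>pc := p\<rparr>) l"
    and h: "holds w q s \<longleftrightarrow> x = y"
  proof (cases q)
    case (SumEq a b c d)
    show ?thesis
      by (rule that[of "NJumpLe (Dir temp) (Dir (Suc temp)) (pc S + 2)" "NJumpLe (Dir (Suc temp)) (Dir temp) l"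
            "real (nmem S temp)" "real (nmem S (Suc temp))"])
        (use assms SumEq in \<open>auto simp: numeral_2_eq_2 numeral_3_eq_3 of_nat_add[symmetric] simp del: of_nat_add\<close>)
  next
    case (WeightEq a b)
    have "rmem S = w" using r unfolding represents_def by simp
    then show ?thesis
      by (intro that[of "RJumpLe (Ind temp) (Ind (Suc temp)) (pc S + 2)" "RJumpLe (Ind (Suc temp)) (Ind temp) l"
            "w (nmem S temp)" "w (nmem S (Suc temp))"])
        (use assms WeightEq in \<open>auto simp: numeral_2_eq_2 numeral_3_eq_3\<close>)
  qed
  have S: "S\<lparr>pc := pc S\<rparr> = S" by simp
  show ?thesis
  proof (cases "x \<le> y")
    case False
    have "runs W P S 2 (S\<lparr>pc := l'\<rparr>)"
      using runs_Suc[OF _ _ runs_1, of S P W "S\<lparr>pc := Suc (pc S)\<rparr>" "S\<lparr>pc := l'\<rparr>"] code i1[of "pc S"] False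
      by (simp add: jump_if_def advance_def numeral_2_eq_2)
    then show ?thesis using False h by (intro exI[of _ 2]) auto
  next
    case xy: True
    have 1: "runs W P S 1 (S\<lparr>pc := pc S + 2\<rparr>)"
      using runs_1[of S P W "S\<lparr>pc := pc S + 2\<rparr>"] code i1[of "pc S"] xy by (simp add: jump_if_def)
    show ?thesis
    proof (cases "y \<le> x")
      case True
      have "runs W P (S\<lparr>pc := pc S + 2\<rparr>) 1 (S\<lparr>pc := l\<rparr>)"
        using runs_1[of "S\<lparr>pc := pc S + 2\<rparr>" P W "S\<lparr>pc := l\<rparr>"] code i2[of "pc S + 2"] True
        by (simp add: jump_if_def)
      from runs_trans[OF 1 this] show ?thesis using True xy h by (intro exI[of _ 2]) (auto simp: numeral_2_eq_2)
    next
      case False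
      have 2: "runs W P (S\<lparr>pc := pc S + 2\<rparr>) 1 (S\<lparr>pc := pc S + 3\<rparr>)"
        using runs_1[of "S\<lparr>pc := pc S + 2\<rparr>" P W "S\<lparr>pc := pc S + 3\<rparr>"] code i2[of "pc S + 2"] False
        by (simp add: jump_if_def advance_def)
      have 3: "runs W P (S\<lparr>pc := pc S + 3\<rparr>) 1 (S\<lparr>pc := l'\<rparr>)"
        using runs_1[of "S\<lparr>pc := pc S + 3\<rparr>" P W "S\<lparr>pc := l'\<rparr>"] code
        by (simp add: jump_if_def)
      have "runs W P S 3 (S\<lparr>pc := l'\<rparr>)"
        using runs_trans[OF 1 runs_trans[OF 2 3]] by (simp add: numeral_3_eq_3)
      then show ?thesis using False h by (intro exI[of _ 3]) auto
    qed
  qed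
qed

text \<open>One induction yields the simulation, the time bound and the bound on values: a command
  raises the greatest value by at most its cost. Hence a \<open>B\<close> that covers the initial
  values and the total cost covers the whole run, and \<open>fits\<close> keeps the machine from
  getting stuck.\<close>

lemma compile_correct:
  assumes "code_at P (pc S) (compile c (pc S))" "represents w off s S" "com_ok c" "bounded M s"
    "M + cost w c s \<le> B" "fits off B W"
  shows "\<exists>t S'. t \<le> cost w c s \<and> runs W P S t S' \<and> pc S' = pc S + length (compile c (pc S)) \<and>
    represents w off (ev w c s) S' \<and> bounded (M + cost w c s) (ev w c s)"
  using assms
proof (induction c arbitrary: S s M)
  case Skip
  then show ?case by (intro exI[of _ 0] exI[of _ S]) (auto intro: bounded_mono)
next
  case (Assign x e)
  have av: "aval e s \<le> M + ecost e" using aval_le Assign.prems by simp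
  then have W: "aval e s \<le> W" using Assign.prems(5) fits_le[OF Assign.prems(6)] by simp
  obtain S1 where S1: "exec_list W (exp_code temp e) S = Some S1" "nmem S1 temp = aval e s" "same temp S S1"
    using exp_exec[OF Assign.prems(2) _ _ _ Assign.prems(4) _ Assign.prems(6), of e temp] Assign.prems by auto
  note r1 = represents_same[OF Assign.prems(2) S1(3)]
  let ?S = "S1\<lparr>pc := Suc (pc S1), nmem := (nmem S1)(x := aval e s)\<rparr>"
  have "exec_list W (compile (Assign x e) (pc S)) S = Some ?S"
    using S1 W by (simp add: exec_list_append nstore_def advance_def)
  moreover have "list_all straight (compile (Assign x e) (pc S))" by (simp add: straight_exp_code)
  ultimately have "runs W P S (length (compile (Assign x e) (pc S))) ?S \<and> pc ?S = pc S + length (compile (Assign x e) (pc S))"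
    using Assign.prems(1) by (rule runs_exec_list)
  moreover have "length (compile (Assign x e) (pc S)) \<le> cost w (Assign x e) s"
    using length_exp_code[of temp e] by simp
  moreover have "represents w off (ev w (Assign x e) s) ?S"
    using represents_set_var[OF r1] Assign.prems by simp
  moreover have "bounded (M + cost w (Assign x e) s) (ev w (Assign x e) s)"
    using bounded_set_var[OF bounded_mono[OF Assign.prems(4)]] av by simp
  ultimately show ?case by blast
next
  case (Store a i j e)
  let ?c = "Store a i j e"
  have g: "exp_ok i" "exp_ok j" "exp_ok e" "depth i \<le> 20" "depth j \<le> 20" "depth e \<le> 20" "a < 32"
    using Store.prems(3) by auto
  have le: "M + ecost i \<le> B" "M + ecost j \<le> B" "M + ecost e \<le> B" using Store.prems(5) by auto
  have av: "aval i s \<le> B" "aval j s \<le> B" "aval e s \<le> B" "aval e s \<le> M + ecost e"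
    using aval_le[OF Store.prems(4) g(1)] aval_le[OF Store.prems(4) g(2)] aval_le[OF Store.prems(4) g(3)] le
    by linarith+
  then have W: "aval e s \<le> W" using fits_le[OF Store.prems(6)] by simp
  obtain S1 where S1: "exec_list W (exp_code temp i) S = Some S1" "nmem S1 temp = aval i s" "same temp S S1"
    using exp_exec[OF Store.prems(2) g(1) _ _ Store.prems(4) le(1) Store.prems(6), of temp] g by auto
  note r1 = represents_same[OF Store.prems(2) S1(3)]
  obtain S2 where S2: "exec_list W (exp_code (Suc temp) j) S1 = Some S2" "nmem S2 (Suc temp) = aval j s"
      "same (Suc temp) S1 S2"
    using exp_exec[OF r1 g(2) _ _ Store.prems(4) le(2) Store.prems(6), of "Suc temp"] g by auto
  have s2: "nmem S2 temp = aval i s" using S1 S2 same_nmem by simp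
  have sm2: "same temp S S2" using same_trans[OF S1(3) S2(3)] by simp
  note r2 = represents_same[OF Store.prems(2) sm2]
  have o2: "nmem S2 40 = off" "64 \<le> off" using r2 unfolding represents_def by auto
  obtain S3 where S3: "exec_list W (addr_code a temp) S2 = Some S3"
      "nmem S3 temp = entry off a (aval i s) (aval j s)" "same temp S2 S3"
    using addr_exec[OF _ _ o2 g(7) s2 S2(2) av(1,2) Store.prems(6)] by auto
  have sm3: "same temp S S3" using same_trans[OF sm2 S3(3)] by simp
  note r3 = represents_same[OF Store.prems(2) sm3]
  obtain S4 where S4: "exec_list W (exp_code (Suc temp) e) S3 = Some S4" "nmem S4 (Suc temp) = aval e s"
      "same (Suc temp) S3 S4"
    using exp_exec[OF r3 g(3) _ _ Store.prems(4) le(3) Store.prems(6), of "Suc temp"] g by auto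
  have s4: "nmem S4 temp = entry off a (aval i s) (aval j s)" using S3 S4 same_nmem by simp
  have sm4: "same temp S S4" using same_trans[OF sm3 S4(3)] by simp
  note r4 = represents_same[OF Store.prems(2) sm4]
  let ?S = "S4\<lparr>pc := Suc (pc S4), nmem := (nmem S4)(entry off a (aval i s) (aval j s) := aval e s)\<rparr>"
  have "exec_list W (compile ?c (pc S)) S = Some ?S"
    using S1 S2 S3 S4 s4 W by (simp add: exec_list_append nstore_def advance_def)
  moreover have "list_all straight (compile ?c (pc S))" by (simp add: straight_exp_code)
  ultimately have "runs W P S (length (compile ?c (pc S))) ?S \<and> pc ?S = pc S + length (compile ?c (pc S))"
    using Store.prems(1) by (rule runs_exec_list)
  moreover have "length (compile ?c (pc S)) \<le> cost w ?c s"
    using length_exp_code[of temp i] length_exp_code[of "Suc temp" j] length_exp_code[of "Suc temp" e] by simp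
  moreover have "represents w off (ev w ?c s) ?S"
    using represents_set_arr[OF r4 g(7)] by simp
  moreover have "bounded (M + cost w ?c s) (ev w ?c s)"
    using bounded_set_arr[OF bounded_mono[OF Store.prems(4)]] av(4) by simp
  ultimately show ?case by blast
next
  case (Seq c1 c2)
  let ?p = "pc S + length (compile c1 (pc S))"
  obtain t1 S1 where S1: "t1 \<le> cost w c1 s" "runs W P S t1 S1" "pc S1 = ?p"
      "represents w off (ev w c1 s) S1" "bounded (M + cost w c1 s) (ev w c1 s)"
    using Seq.IH(1)[of S s M] Seq.prems by auto
  obtain t2 S2 where S2: "t2 \<le> cost w c2 (ev w c1 s)" "runs W P S1 t2 S2"
      "pc S2 = ?p + length (compile c2 ?p)"
      "represents w off (ev w c2 (ev w c1 s)) S2"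
      "bounded (M + cost w c1 s + cost w c2 (ev w c1 s)) (ev w c2 (ev w c1 s))"
    using Seq.IH(2)[of S1 "ev w c1 s" "M + cost w c1 s"] Seq.prems S1 by (auto simp: add.assoc)
  show ?case
    by (intro exI[of _ "t1 + t2"] exI[of _ S2]) (use S1 S2 runs_trans[OF S1(2) S2(2)] in \<open>simp add: add.assoc\<close>)
next
  case (When b q c)
  let ?p1 = "pc S + length (cond_code q)"
  let ?l = "?p1 + 4 + length (compile c (?p1 + 4))"
  have code: "code_at P (pc S) (cond_code q)"
    "code_at P ?p1 (branch_code q ?p1 (if b then ?p1 + 4 else ?l) (if b then ?l else ?p1 + 4))"
    "code_at P (?p1 + 4) (compile c (?p1 + 4))"
    using When.prems(1) by (simp_all add: Let_def)
  have len: "pc S + length (compile (When b q c) (pc S)) = ?l" by (simp add: Let_def)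
  have ok: "cond_ok q" "com_ok c" "M + ccost q \<le> B" using When.prems by auto
  obtain S1 where S1: "exec_list W (cond_code q) S = Some S1" "represents w off s S1"
    "case q of SumEq a b c d \<Rightarrow> nmem S1 temp = aval a s + aval b s \<and> nmem S1 (Suc temp) = aval c s + aval d s
      | WeightEq a b \<Rightarrow> nmem S1 temp = aval a s \<and> nmem S1 (Suc temp) = aval b s"
    using cond_exec[OF When.prems(2) ok(1) When.prems(4) ok(3) When.prems(6)] by auto
  have r1: "runs W P S (length (cond_code q)) S1" "pc S1 = ?p1"
    using runs_exec_list[OF S1(1) straight_cond_code code(1)] by auto
  let ?l1 = "if holds w q s = b then ?p1 + 4 else ?l"
  have target: "(if holds w q s then if b then ?p1 + 4 else ?l else if b then ?l else ?p1 + 4) = ?l1" by auto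
  have "code_at P (pc S1) (branch_code q (pc S1) (if b then ?p1 + 4 else ?l) (if b then ?l else ?p1 + 4))"
    using code(2) unfolding r1(2) .
  from test_runs[OF S1(2) this S1(3), of W, unfolded target]
  obtain t2 where t2: "t2 \<le> 4" "runs W P S1 t2 (S1\<lparr>pc := ?l1\<rparr>)" by blast
  have r2: "runs W P S (length (cond_code q) + t2) (S1\<lparr>pc := ?l1\<rparr>)" using runs_trans[OF r1(1) t2(2)] .
  have c2: "length (cond_code q) + t2 \<le> ccost q" using length_cond_code[of q] t2(1) by linarith
  show ?case
  proof (cases "holds w q s = b")
    case False
    then show ?thesis unfolding len
      by (intro exI[of _ "length (cond_code q) + t2"] exI[of _ "S1\<lparr>pc := ?l1\<rparr>"])
        (use r2 c2 represents_pc[OF S1(2)] bounded_mono[OF When.prems(4)] in auto)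
  next
    case True
    have prem: "M + cost w c s \<le> B" using When.prems(5) True by simp
    obtain t3 S3 where S3: "t3 \<le> cost w c s" "runs W P (S1\<lparr>pc := ?p1 + 4\<rparr>) t3 S3" "pc S3 = ?l"
        "represents w off (ev w c s) S3" "bounded (M + cost w c s) (ev w c s)"
      using When.IH[of "S1\<lparr>pc := ?p1 + 4\<rparr>" s M] code(3) represents_pc[OF S1(2)] ok(2) When.prems(4,6) prem by auto
    have "runs W P S (length (cond_code q) + t2 + t3) S3" using runs_trans[OF r2, of t3 S3] S3(2) True by simp
    moreover have "bounded (M + cost w (When b q c) s) (ev w (When b q c) s)"
      using bounded_mono[OF S3(5)] True by simp
    ultimately show ?thesis unfolding len
      by (intro exI[of _ "length (cond_code q) + t2 + t3"] exI[of _ S3]) (use S3 c2 True in auto)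
  qed
next
  case (For x y c)
  let ?f = "\<lambda>i s. ev w c (set_var x i s)"
  let ?it = "\<lambda>k. iterate ?f k s"
  let ?ck = "\<lambda>k. cost w c (set_var x k (?it k)) + 4"
  let ?N = "vars s y"
  let ?p = "pc S"
  let ?b = "compile c (?p + 2)"
  have ok: "x < 40" "y < 40" "x \<noteq> y" "x \<notin> assigned c" "y \<notin> assigned c" "com_ok c"
    using For.prems(3) by auto
  have code: "?p < length P" "P ! ?p = NConst (Dir x) 0" "Suc ?p < length P"
    "P ! Suc ?p = NJumpLe (Dir y) (Dir x) (?p + 5 + length ?b)" "code_at P (?p + 2) ?b"
    "?p + 2 + length ?b < length P" "P ! (?p + 2 + length ?b) = NConst (Dir temp) 1"
    "Suc (?p + 2 + length ?b) < length P"
    "P ! (Suc (?p + 2 + length ?b)) = NArith NAdd (Dir x) (Dir x) (Dir temp)"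
    "Suc (Suc (?p + 2 + length ?b)) < length P"
    "P ! (Suc (Suc (?p + 2 + length ?b))) = Jump (?p + 1)"
    using For.prems(1) by (simp_all add: add.assoc)
  have N: "?N \<le> M" using For.prems(4) ok unfolding bounded_def by simp
  have BW: "B < W" using fits_le[OF For.prems(6)] by linarith
  have sum_le: "M + 2 + (\<Sum>i<k. ?ck i) \<le> B" if "k \<le> ?N" for k
  proof -
    have "(\<Sum>i<k. ?ck i) \<le> (\<Sum>i<?N. ?ck i)" using that by (intro sum_mono2) auto
    moreover have "M + (2 + (\<Sum>i<?N. ?ck i)) \<le> B" using For.prems(5) by (simp only: cost.simps)
    ultimately show ?thesis by linarith
  qed
  have y: "vars (?it k) y = ?N" for k
    using ok by (induction k) (simp_all add: vars_frame)
  have loop: "\<exists>t T. t \<le> 1 + (\<Sum>i<k. ?ck i) \<and> runs W P S t T \<and> pc T = ?p + 1 \<and>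
      represents w off (set_var x k (?it k)) T \<and> bounded (M + (\<Sum>i<k. ?ck i)) (?it k)" if "k \<le> ?N" for k
    using that
  proof (induction k)
    case 0
    let ?T = "S\<lparr>pc := Suc ?p, nmem := (nmem S)(x := 0)\<rparr>"
    have "runs W P S 1 ?T" using code by (intro runs_1) (simp_all add: nstore_def advance_def)
    then show ?case using represents_set_var[OF For.prems(2) ok(1)] For.prems(4)
      by (intro exI[of _ 1] exI[of _ ?T]) simp
  next
    case (Suc k)
    let ?s = "set_var x k (?it k)"
    obtain t T where T: "t \<le> 1 + (\<Sum>i<k. ?ck i)" "runs W P S t T" "pc T = ?p + 1"
        "represents w off ?s T" "bounded (M + (\<Sum>i<k. ?ck i)) (?it k)"
      using Suc by auto
    have ny: "nmem T y = ?N" "nmem T x = k" using T(4) ok y unfolding represents_def by auto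
    let ?T1 = "T\<lparr>pc := ?p + 2\<rparr>"
    have 1: "runs W P T 1 ?T1"
      using code T(3) ny Suc.prems by (intro runs_1) (simp_all add: jump_if_def advance_def)
    have le: "M + (\<Sum>i<k. ?ck i) + cost w c ?s \<le> B" using sum_le[OF Suc.prems] by simp
    have bd: "bounded (M + (\<Sum>i<k. ?ck i)) ?s" using bounded_set_var[OF T(5)] Suc.prems N by simp
    obtain t2 T2 where T2: "t2 \<le> cost w c ?s" "runs W P ?T1 t2 T2" "pc T2 = ?p + 2 + length ?b"
        "represents w off (ev w c ?s) T2" "bounded (M + (\<Sum>i<k. ?ck i) + cost w c ?s) (ev w c ?s)"
      using For.IH[of ?T1 ?s "M + (\<Sum>i<k. ?ck i)"] code(5) represents_pc[OF T(4)] ok(6) bd le For.prems(6)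
      by auto
    have x2: "nmem T2 x = k" using T2(4) ok vars_frame[OF ok(4), of w ?s] unfolding represents_def by auto
    let ?T3 = "T2\<lparr>pc := Suc (pc T2), nmem := (nmem T2)(temp := 1)\<rparr>"
    let ?T4 = "T2\<lparr>pc := Suc (Suc (pc T2)), nmem := ((nmem T2)(temp := 1))(x := Suc k)\<rparr>"
    let ?T5 = "T2\<lparr>pc := ?p + 1, nmem := ((nmem T2)(temp := 1))(x := Suc k)\<rparr>"
    have "exec W (P ! pc T2) T2 = Some ?T3" "exec W (P ! pc ?T3) ?T3 = Some ?T4" "exec W (P ! pc ?T4) ?T4 = Some ?T5"
      using code T2(3) x2 ok BW sum_le[OF Suc.prems] N Suc.prems
      by (simp_all add: nstore_def advance_def jump_if_def)
    then have 3: "runs W P T2 3 ?T5"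
      using runs_Suc[of T2 P W ?T3 2 ?T5] runs_Suc[of ?T3 P W ?T4 1 ?T5] runs_1[of ?T4 P W ?T5] code T2(3)
      by (simp add: eval_nat_numeral)
    have sm: "same temp T2 ?T3" unfolding same_def by simp
    have r5: "represents w off (set_var x (Suc k) (ev w c ?s)) ?T5"
      using represents_set_var[OF represents_same[OF T2(4) sm] ok(1), of "Suc k" "?p + 1"] by simp
    have run: "runs W P S (t + (1 + (t2 + 3))) ?T5"
      using runs_trans[OF T(2) runs_trans[OF 1 runs_trans[OF T2(2) 3]]] .
    have "bounded (M + (\<Sum>i<Suc k. ?ck i)) (?it (Suc k))" using bounded_mono[OF T2(5)] by simp
    then show ?case using run r5 T(1) T2(1)
      by (intro exI[of _ "t + (1 + (t2 + 3))"] exI[of _ ?T5]) simp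
  qed
  obtain t T where T: "t \<le> 1 + (\<Sum>i<?N. ?ck i)" "runs W P S t T" "pc T = ?p + 1"
      "represents w off (set_var x ?N (?it ?N)) T" "bounded (M + (\<Sum>i<?N. ?ck i)) (?it ?N)"
    using loop[of ?N] by auto
  let ?T1 = "T\<lparr>pc := ?p + 5 + length ?b\<rparr>"
  have ny: "nmem T y = ?N" "nmem T x = ?N" using T(4) ok y unfolding represents_def by auto
  have "runs W P T 1 ?T1" using code T(3) ny by (intro runs_1) (simp_all add: jump_if_def)
  from runs_trans[OF T(2) this] have run: "runs W P S (t + 1) ?T1" .
  have "bounded (M + cost w (For x y c) s) (ev w (For x y c) s)"
    using bounded_mono[OF bounded_set_var[OF T(5)], of ?N "M + cost w (For x y c) s" x] N by simp
  then show ?case using run represents_pc[OF T(4)] T(1)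
    by (intro exI[of _ "t + 1"] exI[of _ ?T1]) simp
next
  case (Out e)
  have av: "aval e s \<le> M + ecost e" using aval_le Out.prems by simp
  obtain S1 where S1: "exec_list W (exp_code temp e) S = Some S1" "nmem S1 temp = aval e s" "same temp S S1"
    using exp_exec[OF Out.prems(2) _ _ _ Out.prems(4) _ Out.prems(6), of e temp] Out.prems by auto
  note r1 = represents_same[OF Out.prems(2) S1(3)]
  let ?S = "S1\<lparr>pc := Suc (pc S1), nout := nout S1 @ [aval e s]\<rparr>"
  have "exec_list W (compile (Out e) (pc S)) S = Some ?S"
    using S1 by (simp add: exec_list_append advance_def)
  moreover have "list_all straight (compile (Out e) (pc S))" by (simp add: straight_exp_code)
  ultimately have "runs W P S (length (compile (Out e) (pc S))) ?S \<and> pc ?S = pc S + length (compile (Out e) (pc S))"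
    using Out.prems(1) by (rule runs_exec_list)
  moreover have "length (compile (Out e) (pc S)) \<le> cost w (Out e) s"
    using length_exp_code[of temp e] by simp
  moreover have "represents w off (ev w (Out e) s) ?S" using r1 unfolding represents_def by simp
  moreover have "bounded (M + cost w (Out e) s) (ev w (Out e) s)"
    using bounded_mono[OF Out.prems(4)] unfolding bounded_def by (simp add: trans_le_add1)
  ultimately show ?case by blast
next
  case (ROut e)
  obtain S1 where S1: "exec_list W (exp_code temp e) S = Some S1" "nmem S1 temp = aval e s" "same temp S S1"
    using exp_exec[OF ROut.prems(2) _ _ _ ROut.prems(4) _ ROut.prems(6), of e temp] ROut.prems by auto
  note r1 = represents_same[OF ROut.prems(2) S1(3)]
  let ?S = "S1\<lparr>pc := Suc (pc S1), rout := rout S1 @ [rmem S1 (aval e s)]\<rparr>"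
  have "exec_list W (compile (ROut e) (pc S)) S = Some ?S"
    using S1 by (simp add: exec_list_append advance_def)
  moreover have "list_all straight (compile (ROut e) (pc S))" by (simp add: straight_exp_code)
  ultimately have "runs W P S (length (compile (ROut e) (pc S))) ?S \<and> pc ?S = pc S + length (compile (ROut e) (pc S))"
    using ROut.prems(1) by (rule runs_exec_list)
  moreover have "length (compile (ROut e) (pc S)) \<le> cost w (ROut e) s"
    using length_exp_code[of temp e] by simp
  moreover have "represents w off (ev w (ROut e) s) ?S" using r1 unfolding represents_def by simp
  moreover have "bounded (M + cost w (ROut e) s) (ev w (ROut e) s)"
    using bounded_mono[OF ROut.prems(4)] unfolding bounded_def by (simp add: trans_le_add1)
  ultimately show ?case by blast
qed

section \<open>Relocating the input\<close>

text \<open>Initially the input occupies the cells that the compiled code uses as registers, and only the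
  cells 0 and 1, which hold \<open>n\<close> and \<open>m\<close>, have a known meaning. So cell 0 itself becomes a pointer:
  it runs through \<open>n + 64 m, n + 65 m, \<dots>\<close>, all of them beyond the input if \<open>m > 0\<close>, and
  \<open>n\<close> is recovered in the end by subtraction.\<close>

definition save_code :: "nat \<Rightarrow> instr list" where
  "save_code k = concat (map (\<lambda>i. [NMove (Ind 0) (Dir i), NArith NAdd (Dir 0) (Dir 0) (Dir 1)]) [2..<k])"

text \<open>After 64 increments and the saving of the 62 cells from 2 to 63, cell 0 holds
  \<open>n + 126 * m\<close>. Subtraction recovers \<open>n\<close>, cell 41 is set to the first
  saved cell, and the arrays start 64 cells further on.\<close>

definition unpack_code :: "instr list" where
  "unpack_code =
     [NMove (Dir 2) (Dir 0), NConst (Dir 3) 126, NArith NMul (Dir 3) (Dir 3) (Dir 1),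
      NArith NSub (Dir 0) (Dir 0) (Dir 3), NConst (Dir 3) 64, NArith NMul (Dir 3) (Dir 3) (Dir 1),
      NArith NAdd (Dir 41) (Dir 0) (Dir 3), NConst (Dir 40) 64, NArith NAdd (Dir 40) (Dir 40) (Dir 2)]"

definition restore_code :: "nat \<Rightarrow> instr list" where
  "restore_code k = concat (map (\<lambda>i. [NConst (Dir 42) (32 * (i * i)), NArith NAdd (Dir 42) (Dir 42) (Dir 40),
     NMove (Ind 42) (Ind 41), NArith NAdd (Dir 41) (Dir 41) (Dir 1)]) [2..<k])"

text \<open>Input cells from 64 on stay in place and are copied by a loop: its counter is in cell
  43, its bound \<open>2 * m + 2\<close> in cell 44, the constants 1 and 32 in cells 46 and
  47.\<close>

definition copy_init :: "instr list" where
  "copy_init = [NArith NAdd (Dir 44) (Dir 1) (Dir 1), NConst (Dir 45) 2, NArith NAdd (Dir 44) (Dir 44) (Dir 45),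
     NConst (Dir 46) 1, NConst (Dir 47) 32, NConst (Dir 43) 64]"

definition copy_body :: "instr list" where
  "copy_body = [NArith NMul (Dir 42) (Dir 43) (Dir 43), NArith NMul (Dir 42) (Dir 42) (Dir 47),
     NArith NAdd (Dir 42) (Dir 42) (Dir 40), NMove (Ind 42) (Ind 43), NArith NAdd (Dir 43) (Dir 43) (Dir 46)]"

definition clear_code :: "nat \<Rightarrow> instr list" where
  "clear_code k = map (\<lambda>i. NConst (Dir i) 0) [2..<k]"

definition setup_code :: "instr list" where
  "setup_code = replicate 64 (NArith NAdd (Dir 0) (Dir 0) (Dir 1)) @ save_code 64 @ unpack_code @
     restore_code 64 @ copy_init"

definition prologue :: "instr list" where
  "prologue = setup_code @ [NJumpLe (Dir 44) (Dir 43) (length setup_code + 7)] @ copy_body @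
     [Jump (length setup_code)] @ clear_code 40"

lemma straight_clear_code: "list_all straight (clear_code k)"
  by (auto simp: clear_code_def list_all_iff)

lemma straight_save_code: "list_all straight (save_code k)"
  by (auto simp: save_code_def list_all_iff)

lemma straight_restore_code: "list_all straight (restore_code k)"
  by (auto simp: restore_code_def list_all_iff)

lemma list_all_replicate: "P x \<Longrightarrow> list_all P (replicate k x)"
  by (induction k) auto

lemma straight_setup_code: "list_all straight setup_code"
  unfolding setup_code_def list_all_append
  by (intro conjI straight_save_code straight_restore_code list_all_replicate)
    (simp_all add: unpack_code_def copy_init_def)

section \<open>Correctness of the relocation\<close>

definition init_store :: "(nat \<Rightarrow> nat) \<Rightarrow> store" where
  "init_store inp = \<lparr>vars = (\<lambda>_. 0)(0 := inp 0, 1 := inp 1),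
     arr = (\<lambda>a i j. if a = 0 \<and> j = 0 \<and> 2 \<le> i then inp i else 0), outs = [], routs = []\<rparr>"

text \<open>\<open>off\<close> lies beyond all saved cells, the last of which is
  \<open>n + 125 * m\<close>. The bound \<open>64 \<le> B\<close> makes room for the restored cells
  below 64, and \<open>2 * m + 2 \<le> B\<close> for the rest of the input.\<close>

locale input_layout =
  fixes inp :: "nat \<Rightarrow> nat" and n m off B W :: nat
  assumes inp_n: "inp 0 = n" and inp_m: "inp 1 = m" and inp_end: "2 * m + 2 \<le> k \<Longrightarrow> inp k = 0"
    and trivial: "m = 0 \<Longrightarrow> n = 1"
    and off: "off = n + 126 * m + 64"
    and B: "64 \<le> B" "2 * m + 2 \<le> B" and fits: "fits off B W" and inp_le: "inp k \<le> W"
begin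

lemma off_W: assumes "l \<le> B"
  shows "off + 32 * (l * l) \<le> W" "32 * (l * l) \<le> W" "l * l \<le> W" "l \<le> W"
proof -
  obtain R where R: "B * B = R" "off + 128 * R + 64 * B + 32 \<le> W" using fitsE[OF fits] .
  have "l * l \<le> R" unfolding R(1)[symmetric] using assms by (intro mult_mono) auto
  then show "off + 32 * (l * l) \<le> W" "32 * (l * l) \<le> W" "l * l \<le> W" "l \<le> W"
    using R(2) assms by linarith+
qed

lemma off_le_W: "off + 4096 \<le> W"
  using fits_le[OF fits] B by linarith

lemma saved_less: "l < 64 \<Longrightarrow> n + (62 + l) * m < off"
  using off mult_le_mono1[of "62 + l" 126 m] by linarith

lemma saved_ge:
  assumes "0 < m" "2 \<le> l" shows "64 \<le> n + (62 + l) * m" "2 * m + 2 \<le> n + (62 + l) * m"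
proof -
  have "64 * m \<le> (62 + l) * m" using assms by (intro mult_le_mono1) auto
  then show "64 \<le> n + (62 + l) * m" "2 * m + 2 \<le> n + (62 + l) * m" using assms by linarith+
qed

lemma saved_inj: "0 < m \<Longrightarrow> n + (62 + l) * m = n + (62 + l') * m \<longleftrightarrow> l = l'"
  by simp

definition keeps :: "state \<Rightarrow> state \<Rightarrow> bool" where
  "keeps S S' \<longleftrightarrow> rmem S' = rmem S \<and> nout S' = nout S \<and> rout S' = rout S"

lemma keeps_trans: "keeps S S' \<Longrightarrow> keeps S' S'' \<Longrightarrow> keeps S S''"
  unfolding keeps_def by simp

definition saved :: "nat \<Rightarrow> state \<Rightarrow> bool" where
  "saved i S \<longleftrightarrow> nmem S 0 = n + (62 + i) * m \<and> nmem S 1 = m \<and>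
     (\<forall>k. 2 \<le> k \<and> k < 64 \<longrightarrow> nmem S k = inp k) \<and>
     (\<forall>k. 64 \<le> k \<and> k < 2 * m + 2 \<longrightarrow> nmem S k = inp k) \<and>
     (\<forall>l. 2 \<le> l \<and> l < i \<longrightarrow> nmem S (n + (62 + l) * m) = inp l) \<and> (\<forall>k\<ge>off. nmem S k = 0)"

lemma increments:
  "nmem S 1 = m \<Longrightarrow> nmem S 0 + j * m \<le> W \<Longrightarrow>
    exec_list W (replicate j (NArith NAdd (Dir 0) (Dir 0) (Dir 1))) S =
      Some (S\<lparr>pc := pc S + j, nmem := (nmem S)(0 := nmem S 0 + j * m)\<rparr>)"
  by (induction j arbitrary: S) (simp_all add: nstore_def advance_def add.assoc)

lemma save_step:
  assumes S: "saved i S" and i: "2 \<le> i" "i < 64"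
  shows "\<exists>S'. exec_list W [NMove (Ind 0) (Dir i), NArith NAdd (Dir 0) (Dir 0) (Dir 1)] S = Some S' \<and>
    saved (Suc i) S' \<and> keeps S S'"
proof -
  define p where "p = n + (62 + i) * m"
  have S0: "nmem S 0 = p" "nmem S 1 = m" "nmem S i = inp i" using S i unfolding saved_def p_def by auto
  have pm: "p + m = n + (62 + Suc i) * m" unfolding p_def by (simp add: algebra_simps)
  have "(62 + Suc i) * m \<le> 126 * m" using i by (intro mult_le_mono1) simp
  then have pmW: "p + m \<le> W" using off off_le_W unfolding pm by linarith
  have p_off: "p < off" using saved_less i unfolding p_def by simp
  let ?f = "((nmem S)(p := inp i))(0 := p + m)"
  let ?S = "S\<lparr>pc := pc S + 2, nmem := ?f\<rparr>"
  \<comment> \<open>If \<open>m = 0\<close>, the pointer stays at cell 1, and the zero written there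
    equals the \<open>m\<close> that it overwrites.\<close>
  have p1: "((nmem S)(p := inp i)) 1 = m"
  proof (cases "m = 0")
    case True
    then show ?thesis using S0 inp_end[of i] i by simp
  next
    case False
    then show ?thesis using S0 saved_ge(1)[of i] i unfolding p_def[symmetric] by simp
  qed
  have p0: "p \<noteq> 0"
    using saved_ge(1)[of i] i trivial unfolding p_def[symmetric] by (cases "m = 0") (auto simp: p_def)
  have "exec_list W [NMove (Ind 0) (Dir i), NArith NAdd (Dir 0) (Dir 0) (Dir 1)] S = Some ?S"
    using S0 inp_le[of i] p0 p1 pmW by (simp add: nstore_def advance_def)
  moreover have "saved (Suc i) ?S"
  proof (cases "m = 0")
    case True
    then have "p = 1" "inp k = 0" if "2 \<le> k" for k using trivial inp_end that unfolding p_def by auto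
    note t = this(2) and p = this(1)[of 2, simplified]
    show ?thesis using S True t t[OF i(1)] off trivial[OF True] unfolding saved_def p by auto
  next
    case False
    then have m: "0 < m" by simp
    note ge = saved_ge[OF m i(1), folded p_def]
    have l: "p = n + (62 + l) * m \<longleftrightarrow> l = i" for l unfolding p_def saved_inj[OF m] by (rule eq_commute)
    have "nmem ?S (n + (62 + l) * m) = inp l" if "2 \<le> l" "l < Suc i" for l
    proof -
      have "n + (62 + l) * m \<noteq> 0" using saved_ge(1)[OF m that(1)] by linarith
      moreover have "l \<noteq> i \<Longrightarrow> nmem S (n + (62 + l) * m) = inp l" using S that unfolding saved_def by auto
      ultimately show ?thesis using l[of l] by (auto simp: p_def)
    qed
    then show ?thesis using S ge p_off off pm unfolding saved_def by auto
  qed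
  moreover have "keeps S ?S" unfolding keeps_def by simp
  ultimately show ?thesis by blast
qed

lemma save:
  assumes S: "saved 2 S" and "2 \<le> i" "i \<le> 64"
  shows "\<exists>S'. exec_list W (save_code i) S = Some S' \<and> saved i S' \<and> keeps S S'"
  using assms(2,3)
proof (induction i rule: dec_induct)
  case base
  then show ?case using S by (simp add: save_code_def keeps_def)
next
  case (step i)
  then obtain S1 where S1: "exec_list W (save_code i) S = Some S1" "saved i S1" "keeps S S1" by auto
  obtain S2 where S2: "exec_list W [NMove (Ind 0) (Dir i), NArith NAdd (Dir 0) (Dir 0) (Dir 1)] S1 = Some S2"
      "saved (Suc i) S2" "keeps S1 S2" using save_step[OF S1(2)] step by auto
  have "save_code (Suc i) = save_code i @ [NMove (Ind 0) (Dir i), NArith NAdd (Dir 0) (Dir 0) (Dir 1)]"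
    using step by (simp add: save_code_def)
  then have "exec_list W (save_code (Suc i)) S = Some S2" using S1 S2(1) by (simp only: exec_list_append) simp
  then show ?case using S2 keeps_trans[OF S1(3)] by blast
qed

definition copied :: "nat \<Rightarrow> state \<Rightarrow> bool" where
  "copied i S \<longleftrightarrow> nmem S 0 = n \<and> nmem S 1 = m \<and> nmem S 40 = off \<and>
     (\<forall>k. 64 \<le> k \<and> k < 2 * m + 2 \<longrightarrow> nmem S k = inp k) \<and>
     (\<forall>l. 2 \<le> l \<and> l < i \<longrightarrow> nmem S (off + 32 * (l * l)) = inp l) \<and>
     (\<forall>k\<ge>off. (\<forall>l. 2 \<le> l \<and> l < i \<longrightarrow> k \<noteq> off + 32 * (l * l)) \<longrightarrow> nmem S k = 0)"

definition restorable :: "nat \<Rightarrow> state \<Rightarrow> bool" where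
  "restorable i S \<longleftrightarrow> copied i S \<and> nmem S 41 = n + (62 + i) * m \<and>
     (\<forall>l. 2 \<le> l \<and> l < 64 \<longrightarrow> nmem S (n + (62 + l) * m) = inp l)"

text \<open>Shared by the restoring and the copying step: apart from the new entry, these write only
  to the scratch cells 41, 42 and 43.\<close>

lemma copied_update:
  assumes "copied i S" "\<And>k. k \<noteq> 41 \<and> k \<noteq> 42 \<and> k \<noteq> 43 \<and> k \<noteq> off + 32 * (i * i) \<Longrightarrow> nmem S' k = nmem S k"
    and "nmem S' (off + 32 * (i * i)) = inp i" "2 \<le> i"
  shows "copied (Suc i) S'"
proof -
  have off64: "64 \<le> off" and lt: "2 * m + 2 \<le> off" using off by simp_all
  have same: "nmem S' k = nmem S k" if "k < 41 \<or> (43 < k \<and> k < off)" for k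
    using that off64 by (intro assms(2)) auto
  have inj: "off + 32 * (l * l) = off + 32 * (i * i) \<longleftrightarrow> l = i" for l
    by (simp add: power2_eq_square[symmetric])
  have "nmem S' (off + 32 * (l * l)) = inp l" if "2 \<le> l" "l < Suc i" for l
  proof (cases "l = i")
    case True then show ?thesis using assms by simp
  next
    case False
    then have "nmem S' (off + 32 * (l * l)) = nmem S (off + 32 * (l * l))"
      using off64 inj[of l] by (intro assms(2)) auto
    then show ?thesis using False that assms(1) unfolding copied_def by simp
  qed
  moreover have "nmem S' k = 0" if "off \<le> k" "\<And>l. 2 \<le> l \<Longrightarrow> l < Suc i \<Longrightarrow> k \<noteq> off + 32 * (l * l)" for k
  proof -
    have "nmem S' k = nmem S k" using that(1) that(2)[of i] off64 assms(4) by (intro assms(2)) auto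
    then show ?thesis using that assms(1) unfolding copied_def by simp
  qed
  ultimately show ?thesis using same assms(1) lt off64 unfolding copied_def by auto
qed

lemma restore_step:
  assumes S: "restorable i S" and i: "2 \<le> i" "i < 64"
  shows "\<exists>S'. exec_list W [NConst (Dir 42) (32 * (i * i)), NArith NAdd (Dir 42) (Dir 42) (Dir 40),
     NMove (Ind 42) (Ind 41), NArith NAdd (Dir 41) (Dir 41) (Dir 1)] S = Some S' \<and>
    restorable (Suc i) S' \<and> keeps S S'"
proof -
  define p where "p = n + (62 + i) * m"
  define q where "q = off + 32 * (i * i)"
  have pm: "p + m = n + (62 + Suc i) * m" unfolding p_def by (simp add: algebra_simps)
  have "(62 + Suc i) * m \<le> 126 * m" using i by (intro mult_le_mono1) simp
  then have pmW: "p + m \<le> W" using off off_le_W unfolding pm by linarith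
  have p_off: "p < off" using saved_less i unfolding p_def by simp
  have qW: "32 * (i * i) \<le> W" "q \<le> W" using off_W[of i] B i unfolding q_def by simp_all
  have q_off: "off \<le> q" "64 \<le> off" using off unfolding q_def by simp_all
  have S0: "nmem S 41 = p" "nmem S 1 = m" "nmem S 40 = off" "nmem S p = inp i"
    using S i unfolding restorable_def copied_def p_def by auto
  \<comment> \<open>The saved cells avoid the registers in use: they all are cell 1 if
    \<open>m = 0\<close> and lie at 64 or beyond otherwise.\<close>
  have low: "n + (62 + l) * m = 1 \<or> 64 \<le> n + (62 + l) * m" if "2 \<le> l" for l :: nat
    using saved_ge(1)[of l] trivial that by (cases "m = 0") auto
  have p42: "p \<noteq> 42" "p \<noteq> 41" using low[OF i(1)] unfolding p_def[symmetric] by auto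
  let ?f = "((nmem S)(42 := q, q := inp i))(41 := p + m)"
  let ?S = "S\<lparr>pc := Suc (Suc (Suc (Suc (pc S)))), nmem := ?f\<rparr>"
  have "exec_list W [NConst (Dir 42) (32 * (i * i)), NArith NAdd (Dir 42) (Dir 42) (Dir 40),
     NMove (Ind 42) (Ind 41), NArith NAdd (Dir 41) (Dir 41) (Dir 1)] S = Some ?S"
    using S0 inp_le[of i] p42 pmW qW q_off unfolding q_def by (simp add: nstore_def advance_def add.commute)
  moreover have "restorable (Suc i) ?S"
    unfolding restorable_def
  proof (intro conjI allI impI)
    show "copied (Suc i) ?S"
      using S copied_update[of i S ?S] i q_off unfolding restorable_def q_def by simp
    show "nmem ?S 41 = n + (62 + Suc i) * m" using pm by simp
    fix l :: nat assume l: "2 \<le> l \<and> l < 64"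
    have "n + (62 + l) * m < off" using saved_less l by simp
    then show "nmem ?S (n + (62 + l) * m) = inp l"
      using S l low[of l] q_off unfolding restorable_def by auto
  qed
  moreover have "keeps S ?S" unfolding keeps_def by simp
  ultimately show ?thesis by blast
qed

lemma restore:
  assumes S: "restorable 2 S" and "2 \<le> i" "i \<le> 64"
  shows "\<exists>S'. exec_list W (restore_code i) S = Some S' \<and> restorable i S' \<and> keeps S S'"
  using assms(2,3)
proof (induction i rule: dec_induct)
  case base
  then show ?case using S by (simp add: restore_code_def keeps_def)
next
  case (step i)
  let ?c = "[NConst (Dir 42) (32 * (i * i)), NArith NAdd (Dir 42) (Dir 42) (Dir 40),
     NMove (Ind 42) (Ind 41), NArith NAdd (Dir 41) (Dir 41) (Dir 1)]"
  obtain S1 where S1: "exec_list W (restore_code i) S = Some S1" "restorable i S1" "keeps S S1"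
    using step by auto
  obtain S2 where S2: "exec_list W ?c S1 = Some S2" "restorable (Suc i) S2" "keeps S1 S2"
    using restore_step[OF S1(2)] step by auto
  have "restore_code (Suc i) = restore_code i @ ?c"
    using step by (simp add: restore_code_def)
  then have "exec_list W (restore_code (Suc i)) S = Some S2" using S1 S2(1) by (simp only: exec_list_append) simp
  then show ?case using S2 keeps_trans[OF S1(3)] by blast
qed

lemma unpack:
  assumes S: "saved 64 S"
  shows "\<exists>S'. exec_list W unpack_code S = Some S' \<and> restorable 2 S' \<and> keeps S S'"
proof -
  have S0: "nmem S 0 = n + 126 * m" "nmem S 1 = m" using S unfolding saved_def by auto
  let ?f = "(nmem S)(2 := n + 126 * m, 3 := 64 * m, 0 := n, 41 := n + 64 * m, 40 := off)"
  let ?S = "S\<lparr>pc := Suc (Suc (Suc (Suc (Suc (Suc (Suc (Suc (Suc (pc S))))))))), nmem := ?f\<rparr>"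
  have "n + 126 * m + 64 \<le> W" "126 \<le> W" using off off_le_W by linarith+
  then have "exec_list W unpack_code S = Some ?S"
    using S0 unfolding unpack_code_def by (simp add: nstore_def advance_def off fun_upd_twist add.commute fun_eq_iff)
  moreover have "restorable 2 ?S"
  proof -
    have low: "n + (62 + l) * m = 1 \<or> 64 \<le> n + (62 + l) * m" if "2 \<le> l" for l :: nat
      using saved_ge(1)[of l] trivial that by (cases "m = 0") auto
    have "nmem ?S (n + (62 + l) * m) = inp l" if "2 \<le> l" "l < 64" for l :: nat
      using S that low[of l] unfolding saved_def by auto
    then show ?thesis using S off unfolding restorable_def copied_def saved_def by auto
  qed
  moreover have "keeps S ?S" unfolding keeps_def by simp
  ultimately show ?thesis by blast
qed

definition copying :: "nat \<Rightarrow> state \<Rightarrow> bool" where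
  "copying k S \<longleftrightarrow> copied k S \<and> nmem S 43 = k \<and> nmem S 44 = 2 * m + 2 \<and> nmem S 46 = 1 \<and> nmem S 47 = 32"

lemma copy_start:
  assumes S: "restorable 64 S"
  shows "\<exists>S'. exec_list W copy_init S = Some S' \<and> copying 64 S' \<and> keeps S S'"
proof -
  have S0: "nmem S 1 = m" using S unfolding restorable_def copied_def by auto
  let ?f = "(nmem S)(44 := 2 * m + 2, 45 := 2, 46 := 1, 47 := 32, 43 := 64)"
  let ?S = "S\<lparr>pc := Suc (Suc (Suc (Suc (Suc (Suc (pc S)))))), nmem := ?f\<rparr>"
  have "2 * m + 2 \<le> W" "64 \<le> W" using off off_le_W by linarith+
  then have "exec_list W copy_init S = Some ?S"
    using S0 unfolding copy_init_def by (simp add: nstore_def advance_def fun_upd_twist mult_2)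
  moreover have "copying 64 ?S"
    using S off unfolding restorable_def copying_def copied_def by auto
  moreover have "keeps S ?S" unfolding keeps_def by simp
  ultimately show ?thesis by blast
qed

lemma copy_step:
  assumes S: "copying k S" and k: "64 \<le> k" "k < 2 * m + 2"
  shows "\<exists>S'. exec_list W copy_body S = Some S' \<and> copying (Suc k) S' \<and> keeps S S'"
proof -
  define q where "q = off + 32 * (k * k)"
  have qW: "k * k \<le> W" "32 * (k * k) \<le> W" "q \<le> W" using off_W[of k] B k unfolding q_def by simp_all
  have kW: "Suc k \<le> W" using k off off_le_W by linarith
  have q_off: "off \<le> q" "64 \<le> off" "k < off" using off k unfolding q_def by simp_all
  have S0: "nmem S 40 = off" "nmem S k = inp k" "nmem S 43 = k" "nmem S 46 = 1" "nmem S 47 = 32"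
    using S k unfolding copying_def copied_def by auto
  let ?f = "((nmem S)(42 := q, q := inp k))(43 := Suc k)"
  let ?S = "S\<lparr>pc := Suc (Suc (Suc (Suc (Suc (pc S))))), nmem := ?f\<rparr>"
  have "exec_list W copy_body S = Some ?S"
    using S0 inp_le[of k] qW kW q_off k unfolding q_def copy_body_def
    by (simp add: nstore_def advance_def add.commute mult.commute)
  moreover have "copying (Suc k) ?S"
    using S copied_update[of k S ?S] k q_off unfolding copying_def q_def by simp
  moreover have "keeps S ?S" unfolding keeps_def by simp
  ultimately show ?thesis by blast
qed

lemma setup_exec:
  assumes S: "nmem S = inp"
  shows "\<exists>S'. exec_list W setup_code S = Some S' \<and> copying 64 S' \<and> keeps S S'"
proof -
  let ?S1 = "S\<lparr>pc := pc S + 64, nmem := (nmem S)(0 := n + 64 * m)\<rparr>"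
  have "n + 64 * m \<le> W" using off off_le_W by linarith
  then have 1: "exec_list W (replicate 64 (NArith NAdd (Dir 0) (Dir 0) (Dir 1))) S = Some ?S1"
    using increments[of S 64] S inp_n inp_m by simp
  have "saved 2 ?S1" unfolding saved_def using S inp_m inp_end off by auto
  then obtain S2 where 2: "exec_list W (save_code 64) ?S1 = Some S2" "saved 64 S2" "keeps ?S1 S2"
    using save[of ?S1 64] by auto
  obtain S3 where 3: "exec_list W unpack_code S2 = Some S3" "restorable 2 S3" "keeps S2 S3"
    using unpack[OF 2(2)] by auto
  obtain S4 where 4: "exec_list W (restore_code 64) S3 = Some S4" "restorable 64 S4" "keeps S3 S4"
    using restore[OF 3(2), of 64] by auto
  obtain S5 where 5: "exec_list W copy_init S4 = Some S5" "copying 64 S5" "keeps S4 S5"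
    using copy_start[OF 4(2)] by auto
  have "exec_list W setup_code S = Some S5"
    unfolding setup_code_def by (simp only: exec_list_append 1 2(1) 3(1) 4(1) 5(1) option.case)
  moreover have "keeps S S5" using 2(3) 3(3) 4(3) 5(3) unfolding keeps_def by simp
  ultimately show ?thesis using 5(2) by blast
qed

text \<open>A round takes one test, the five instructions of the body and one jump. The final
  counter is left open because a short input ends before cell 64, in which case no round is
  executed.\<close>

lemma copy_loop:
  assumes code: "code_at P L ([NJumpLe (Dir 44) (Dir 43) (L + 7)] @ copy_body @ [Jump L])"
    and S: "copying k S" "64 \<le> k" "pc S = L"
  shows "\<exists>t S' k'. t \<le> 7 * (2 * m + 2 - k) + 1 \<and> runs W P S t S' \<and> copying k' S' \<and> 2 * m + 2 \<le> k' \<and>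
    keeps S S' \<and> pc S' = L + 7"
  using S
proof (induction "2 * m + 2 - k" arbitrary: k S)
  case 0
  let ?S = "S\<lparr>pc := L + 7\<rparr>"
  have "runs W P S 1 ?S"
    using code 0 by (intro runs_1) (auto simp: jump_if_def copying_def)
  moreover have "copying k ?S" using 0 unfolding copying_def copied_def by simp
  ultimately show ?case using 0
    by (intro exI[of _ 1] exI[of _ ?S] exI[of _ k]) (simp add: keeps_def)
next
  case (Suc d)
  then have k: "k < 2 * m + 2" by simp
  let ?S1 = "S\<lparr>pc := L + 1\<rparr>"
  have 1: "runs W P S 1 ?S1"
    using code Suc.prems k by (intro runs_1) (auto simp: jump_if_def advance_def copying_def)
  have "copying k ?S1" using Suc.prems unfolding copying_def copied_def by simp
  then obtain S2 where S2: "exec_list W copy_body ?S1 = Some S2" "copying (Suc k) S2" "keeps ?S1 S2"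
    using copy_step[of k ?S1] Suc.prems k by auto
  have cb: "length copy_body = 5" by (simp add: copy_body_def)
  have "runs W P ?S1 (length copy_body) S2 \<and> pc S2 = pc ?S1 + length copy_body"
    by (rule runs_exec_list[OF S2(1)]) (use code in \<open>simp_all add: copy_body_def\<close>)
  then have 2: "runs W P ?S1 5 S2" "pc S2 = L + 6" using cb by auto
  let ?S3 = "S2\<lparr>pc := L\<rparr>"
  have 3: "runs W P S2 1 ?S3"
    using code 2(2) by (intro runs_1) (auto simp: jump_if_def copy_body_def eval_nat_numeral)
  have "copying (Suc k) ?S3" using S2(2) unfolding copying_def copied_def by simp
  moreover have "d = 2 * m + 2 - Suc k" using Suc by simp
  ultimately obtain t S' k' where t: "t \<le> 7 * (2 * m + 2 - Suc k) + 1" "runs W P ?S3 t S'" "copying k' S'"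
    "2 * m + 2 \<le> k'" "keeps ?S3 S'" "pc S' = L + 7"
    using Suc.hyps(1)[of "Suc k" ?S3] Suc.prems by auto
  have "runs W P S (1 + (5 + (1 + t))) S'"
    using runs_trans[OF 1 runs_trans[OF 2(1) runs_trans[OF 3 t(2)]]] .
  moreover have "keeps S S'" using S2(3) t(5) unfolding keeps_def by simp
  moreover have "1 + (5 + (1 + t)) \<le> 7 * (2 * m + 2 - k) + 1" using t(1) k by linarith
  ultimately show ?case using t by blast
qed

lemma clear: "2 \<le> i \<Longrightarrow> \<exists>S'. exec_list W (clear_code i) S = Some S' \<and> keeps S S' \<and>
    nmem S' = (\<lambda>k. if 2 \<le> k \<and> k < i then 0 else nmem S k)"
proof (induction i rule: dec_induct)
  case base
  have "nmem S = (\<lambda>k. if 2 \<le> k \<and> k < 2 then 0 else nmem S k)" by (rule ext) auto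
  then show ?case by (simp add: clear_code_def keeps_def)
next
  case (step i)
  then obtain S' where S': "exec_list W (clear_code i) S = Some S'" "keeps S S'"
    "nmem S' = (\<lambda>k. if 2 \<le> k \<and> k < i then 0 else nmem S k)" by auto
  let ?S = "S'\<lparr>pc := Suc (pc S'), nmem := (nmem S')(i := 0)\<rparr>"
  have "clear_code (Suc i) = clear_code i @ [NConst (Dir i) 0]" using step by (simp add: clear_code_def)
  then have "exec_list W (clear_code (Suc i)) S = Some ?S"
    using S' by (simp add: exec_list_append nstore_def advance_def)
  moreover have "nmem ?S = (\<lambda>k. if 2 \<le> k \<and> k < Suc i then 0 else nmem S k)"
    using S'(3) step(1) by (auto simp: fun_eq_iff)
  ultimately show ?case using S'(2) unfolding keeps_def by (intro exI[of _ ?S]) simp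
qed

lemma prologue_runs:
  assumes code: "code_at P 0 prologue" and S: "nmem S = inp" "nout S = []" "rout S = []" "pc S = 0"
  shows "\<exists>t S'. t \<le> length prologue + 14 * m + 15 \<and> runs W P S t S' \<and> pc S' = length prologue \<and>
    represents (rmem S) off (init_store inp) S'"
proof -
  let ?L = "length setup_code"
  have code1: "code_at P 0 setup_code"
    and code2: "code_at P ?L ([NJumpLe (Dir 44) (Dir 43) (?L + 7)] @ copy_body @ [Jump ?L])"
    and code3: "code_at P (?L + 7) (clear_code 40)"
    using code unfolding prologue_def by (simp_all add: copy_body_def eval_nat_numeral)
  have lenp: "length prologue = ?L + 7 + length (clear_code 40)" by (simp add: prologue_def copy_body_def)
  obtain S1 where S1: "exec_list W setup_code S = Some S1" "copying 64 S1" "keeps S S1" using setup_exec[OF S(1)] by auto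
  have r1: "runs W P S ?L S1" "pc S1 = ?L"
    using runs_exec_list[OF S1(1) straight_setup_code] code1 S(4) by auto
  obtain t k S2 where S2: "t \<le> 7 * (2 * m + 2 - 64) + 1" "runs W P S1 t S2" "copying k S2" "2 * m + 2 \<le> k"
    "keeps S1 S2" "pc S2 = ?L + 7"
    using copy_loop[OF code2 S1(2) _ r1(2)] by auto
  obtain S3 where S3: "exec_list W (clear_code 40) S2 = Some S3" "keeps S2 S3"
    "nmem S3 = (\<lambda>k. if 2 \<le> k \<and> k < 40 then 0 else nmem S2 k)"
    using clear[of 40 S2] by auto
  have r3: "runs W P S2 (length (clear_code 40)) S3" "pc S3 = length prologue"
    using runs_exec_list[OF S3(1) straight_clear_code] code3 S2(6) lenp by auto
  have "nmem S3 (entry off a i j) = (if a = 0 \<and> j = 0 \<and> 2 \<le> i then inp i else 0)" if a: "a < 32" for a i j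
  proof -
    have ge: "64 \<le> entry off a i j" "off \<le> entry off a i j" using entry_ge[of off a i j] off by linarith+
    have e0: "off + 32 * (l * l) = entry off 0 l 0" for l unfolding entry_def by simp
    have c: "copied k S2" using S2(3) unfolding copying_def by simp
    have "nmem S3 (entry off a i j) = nmem S2 (entry off a i j)" using S3(3) ge by simp
    also have "\<dots> = (if a = 0 \<and> j = 0 \<and> 2 \<le> i then inp i else 0)"
    proof (cases "a = 0 \<and> j = 0 \<and> 2 \<le> i \<and> i < k")
      case True
      then have "nmem S2 (off + 32 * (i * i)) = inp i" using c unfolding copied_def by simp
      then show ?thesis using True e0[of i] by simp
    next
      case False
      have ne: "entry off a i j \<noteq> off + 32 * (l * l)" if "2 \<le> l" "l < k" for l
      proof
        assume "entry off a i j = off + 32 * (l * l)"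
        then have "a = 0 \<and> i = l \<and> j = 0" using entry_inj[OF a, of 0 off i j l 0] unfolding e0 by simp
        then show False using False that by simp
      qed
      from c have "\<forall>k'\<ge>off. (\<forall>l. 2 \<le> l \<and> l < k \<longrightarrow> k' \<noteq> off + 32 * (l * l)) \<longrightarrow> nmem S2 k' = 0"
        unfolding copied_def by (elim conjE)
      then have "nmem S2 (entry off a i j) = 0" using ne ge(2) by simp
      moreover have "inp i = 0" if "k \<le> i" using inp_end[of i] S2(4) that by linarith
      ultimately show ?thesis using False by auto
    qed
    finally show ?thesis .
  qed
  moreover have "nmem S3 0 = n" "nmem S3 1 = m" "nmem S3 40 = off"
    using S2(3) S3(3) unfolding copying_def copied_def by auto
  ultimately have "represents (rmem S) off (init_store inp) S3"
    using S1(3) S2(5) S3(2,3) S(2,3) off inp_n inp_m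
    unfolding represents_def init_store_def keeps_def by auto
  moreover have "runs W P S (?L + (t + length (clear_code 40))) S3"
    using runs_trans[OF r1(1) runs_trans[OF S2(2) r3(1)]] .
  moreover have "?L + (t + length (clear_code 40)) \<le> length prologue + 14 * m + 15" using S2(1) lenp by linarith
  ultimately show ?thesis using r3(2) by blast
qed

end

definition program_of :: "com \<Rightarrow> program" where
  "program_of c = prologue @ compile c (length prologue)"

lemma program_outputs:
  fixes ns :: "nat list" and rs :: "real list" and c :: com and n m :: nat
  defines "inp \<equiv> (\<lambda>i. if i < length ns then ns ! i else 0)"
    and "w \<equiv> (\<lambda>i. if i < length rs then rs ! i else 0)"
  assumes ns: "length ns = 2 * m + 2" "ns ! 0 = n" "ns ! 1 = m" "m = 0 \<Longrightarrow> n = 1"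
    and le: "\<And>x. x \<in> set ns \<Longrightarrow> x \<le> M" and M: "64 \<le> M" "2 * m + 2 \<le> M"
    and ok: "com_ok c" and fits: "fits (n + 126 * m + 64) (M + cost w c (init_store inp)) W"
  shows "\<exists>t \<le> length prologue + 14 * m + 15 + cost w c (init_store inp).
    outputs_in W (program_of c) (ns, rs) t
      (outs (ev w c (init_store inp)), map w (routs (ev w c (init_store inp))))"
proof -
  let ?off = "n + 126 * m + 64" and ?B = "M + cost w c (init_store inp)" and ?P = "program_of c"
  have inp_M: "inp k \<le> M" for k using le unfolding inp_def by simp
  interpret input_layout inp n m ?off ?B W
  proof
    have "M \<le> W" using fits_le[OF fits] by simp
    then show "inp k \<le> W" for k using inp_M le_trans by blast
  qed (use ns M fits in \<open>auto simp: inp_def\<close>)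
  let ?S = "initial ns rs"
  have S: "nmem ?S = inp" "nout ?S = []" "rout ?S = []" "pc ?S = 0" "rmem ?S = w"
    by (simp_all add: initial_def inp_def w_def fun_eq_iff)
  have code1: "code_at ?P 0 prologue" using code_at_self[of "[]" prologue] by (simp add: program_of_def)
  have code2: "code_at ?P (length prologue) (compile c (length prologue))"
    using code_at_self[of prologue "compile c (length prologue)" "[]"] by (simp add: program_of_def)
  obtain t1 S1 where S1: "t1 \<le> length prologue + 14 * m + 15" "runs W ?P ?S t1 S1" "pc S1 = length prologue"
      "represents w ?off (init_store inp) S1"
    using prologue_runs[OF code1 S(1-4)] S(5) by auto
  have "bounded M (init_store inp)" using inp_M unfolding bounded_def init_store_def by auto
  then obtain t2 S2 where S2: "t2 \<le> cost w c (init_store inp)" "runs W ?P S1 t2 S2"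
      "pc S2 = length prologue + length (compile c (length prologue))"
      "represents w ?off (ev w c (init_store inp)) S2"
    using compile_correct[of ?P S1 c w ?off "init_store inp" M ?B W] code2 S1 ok fits by auto
  have "runs W ?P ?S (t1 + t2) S2" using runs_trans[OF S1(2) S2(2)] .
  then have "outputs_in W ?P (ns, rs) (t1 + t2)
      (outs (ev w c (init_store inp)), map w (routs (ev w c (init_store inp))))"
    using S2(3,4) unfolding outputs_in_def runs_def represents_def by (auto simp: program_of_def)
  then show ?thesis using S1(1) S2(1) by (intro exI[of _ "t1 + t2"]) simp
qed

section \<open>Presented graphs\<close>

locale presented_graph =
  fixes G :: "nat wgraph" and n :: nat and es :: "(nat \<times> nat \<times> real) list"
  assumes G: "weighted_graph G" and presents: "presents (n, es) G"
begin

sublocale conn_graph "{..<n}" "gadj G" "gweight G"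
  using conn_graph[OF G] presents by simp

abbreviation m :: nat where "m \<equiv> length es"

definition edge_fst :: "nat \<Rightarrow> nat" where "edge_fst e = fst (es ! e)"

definition edge_snd :: "nat \<Rightarrow> nat" where "edge_snd e = fst (snd (es ! e))"

definition tail :: "nat \<Rightarrow> nat" where
  "tail i = (if even i then edge_fst (i div 2) else edge_snd (i div 2))"

definition head :: "nat \<Rightarrow> nat" where
  "head i = (if even i then edge_snd (i div 2) else edge_fst (i div 2))"

definition edge_weight :: "nat \<Rightarrow> real" where "edge_weight e = snd (snd (es ! e))"

lemma edges_conv: "map (\<lambda>(u, v, _). {u, v}) es = map (\<lambda>e. {edge_fst e, edge_snd e}) [0..<m]"
  by (rule nth_equalityI) (auto simp: edge_fst_def edge_snd_def split: prod.split)

lemma edges_eq: "edges G = (\<lambda>e. {edge_fst e, edge_snd e}) ` {..<m}"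
  using presents edges_conv by (auto simp: lessThan_atLeast0)

lemma edge_inj:
  assumes "e < m" "e' < m" "{edge_fst e, edge_snd e} = {edge_fst e', edge_snd e'}" shows "e = e'"
proof -
  have "distinct (map (\<lambda>e. {edge_fst e, edge_snd e}) [0..<m])" using presents edges_conv by simp
  then have "inj_on (\<lambda>e. {edge_fst e, edge_snd e}) {..<m}" by (simp add: distinct_map lessThan_atLeast0)
  then show ?thesis using assms unfolding inj_on_def by blast
qed

lemma card_edges: "card (edges G) = m"
proof -
  have "inj_on (\<lambda>e. {edge_fst e, edge_snd e}) {..<m}" using edge_inj unfolding inj_on_def by blast
  then show ?thesis unfolding edges_eq by (simp add: card_image)
qed

lemma verts: "verts G = {..<n}"
  using presents by simp

lemma n_pos: "0 < n"
  using G verts unfolding weighted_graph_def by auto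

lemma edge_adj: "e < m \<Longrightarrow> gadj G (edge_fst e) (edge_snd e)"
  unfolding gadj_def edges_eq by blast

lemma edge_weight: "e < m \<Longrightarrow> gweight G (edge_fst e) (edge_snd e) = edge_weight e"
proof -
  assume e: "e < m"
  obtain u v r where uvr: "es ! e = (u, v, r)" by (cases "es ! e")
  then have "(u, v, r) \<in> set es" using e by (metis nth_mem)
  then have "weight G {u, v} = r" using presents by auto
  then show ?thesis using uvr by (simp add: gweight_def edge_fst_def edge_snd_def edge_weight_def)
qed

lemma arc_adj: "i < 2 * m \<Longrightarrow> gadj G (tail i) (head i)"
  using edge_adj[of "i div 2"] adj_sym[of "edge_fst (i div 2)"] unfolding tail_def head_def by auto

lemma arc_less: "i < 2 * m \<Longrightarrow> tail i < n" "i < 2 * m \<Longrightarrow> head i < n"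
  using arc_adj adj_V adj_V' by blast+

lemma arc_weight: "i < 2 * m \<Longrightarrow> gweight G (tail i) (head i) = edge_weight (i div 2)"
  using edge_weight[of "i div 2"] w_sym unfolding tail_def head_def by auto

lemma arc_ex:
  assumes "gadj G a b" obtains i where "i < 2 * m" "tail i = a" "head i = b"
proof -
  obtain e where e: "e < m" "{a, b} = {edge_fst e, edge_snd e}" using assms unfolding gadj_def edges_eq by auto
  then consider "a = edge_fst e" "b = edge_snd e" | "a = edge_snd e" "b = edge_fst e" by (auto simp: doubleton_eq_iff)
  then show ?thesis
  proof cases
    case 1 then show ?thesis using that[of "2 * e"] e unfolding tail_def head_def by simp
  next
    case 2 then show ?thesis using that[of "Suc (2 * e)"] e unfolding tail_def head_def by simp
  qed
qed

lemma arc_inj: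
  assumes "i < 2 * m" "j < 2 * m" "tail i = tail j" "head i = head j" shows "i = j"
proof -
  have "{tail i, head i} = {edge_fst (i div 2), edge_snd (i div 2)}"
    "{tail j, head j} = {edge_fst (j div 2), edge_snd (j div 2)}"
    unfolding tail_def head_def by auto
  then have d: "i div 2 = j div 2" using assms edge_inj[of "i div 2" "j div 2"] by auto
  have "edge_fst (i div 2) \<noteq> edge_snd (i div 2)"
    using edge_adj[of "i div 2"] assms(1) adj_irrefl by (metis less_mult_imp_div_less mult.commute)
  then have "even i = even j" using assms(3) d unfolding tail_def by (auto split: if_splits)
  then show ?thesis using d by (metis div_mult_mod_eq mod2_eq_if)
qed

text \<open>Every vertex except 0 owns an edge to a neighbour one step closer to 0. No edge is owned
  twice, since each end would have to be closer to 0 than the other.\<close>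

lemma n_le: "n \<le> m + 1"
proof -
  define p where "p v = (SOME p. gadj G p v \<and> hop 0 v = hop 0 p + 1)" for v
  have p: "gadj G (p v) v \<and> hop 0 v = hop 0 (p v) + 1" if "v \<in> {1..<n}" for v
  proof -
    have "\<exists>q. gadj G q v \<and> hop 0 v = hop 0 q + 1" using hop_pred[of 0 v] that n_pos by auto
    then show ?thesis unfolding p_def by (rule someI_ex)
  qed
  have "inj_on (\<lambda>v. {p v, v}) {1..<n}"
  proof (rule inj_onI)
    fix u v assume uv: "u \<in> {1..<n}" "v \<in> {1..<n}" "{p u, u} = {p v, v}"
    show "u = v"
    proof (rule ccontr)
      assume "u \<noteq> v"
      then have "p u = v" "p v = u" using uv(3) by (auto simp: doubleton_eq_iff)
      then show False using p[OF uv(1)] p[OF uv(2)] by simp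
    qed
  qed
  moreover have "(\<lambda>v. {p v, v}) ` {1..<n} \<subseteq> edges G" using p unfolding gadj_def by auto
  moreover have "finite (edges G)" unfolding edges_eq by simp
  ultimately have "card {1..<n} \<le> card (edges G)" by (rule card_inj_on_le)
  then show ?thesis using card_edges by simp
qed

lemma trivial: "m = 0 \<Longrightarrow> n = 1"
  using n_le n_pos by simp

lemma sum_degrees: "(\<Sum>v<n. card {i. i < 2 * m \<and> tail i = v}) = 2 * m"
proof -
  have "(\<Sum>v<n. card {i. i < 2 * m \<and> tail i = v}) = (\<Sum>v<n. \<Sum>i | i \<in> {..<2 * m} \<and> tail i = v. 1)"
    by simp
  also have "\<dots> = (\<Sum>i<2 * m. 1)" using arc_less by (intro sum.group) auto
  finally show ?thesis by simp
qed

definition cell_in :: "nat \<Rightarrow> nat" where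
  "cell_in i = (if i < length (graph_nats (n, es)) then graph_nats (n, es) ! i else 0)"

lemma concat_pairs:
  "length (concat (map (\<lambda>e. [f e, g e]) xs)) = 2 * length xs"
  "e < length xs \<Longrightarrow> concat (map (\<lambda>e. [f e, g e]) xs) ! (2 * e) = f (xs ! e)"
  "e < length xs \<Longrightarrow> concat (map (\<lambda>e. [f e, g e]) xs) ! Suc (2 * e) = g (xs ! e)"
proof (induction xs arbitrary: e)
  case (Cons x xs)
  { case 1 then show ?case using Cons by simp }
  { case 2 then show ?case using Cons(2)[of "e - 1"] by (cases e) auto }
  { case 3 then show ?case using Cons(3)[of "e - 1"] by (cases e) auto }
qed auto

lemma graph_nats_eq: "graph_nats (n, es) = n # m # concat (map (\<lambda>e. [edge_fst e, edge_snd e]) [0..<m])"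
proof -
  have "map (\<lambda>(u, v, _). [u, v]) es = map (\<lambda>e. [edge_fst e, edge_snd e]) [0..<m]"
    by (rule nth_equalityI) (auto simp: edge_fst_def edge_snd_def split: prod.split)
  then show ?thesis by simp
qed

lemma length_graph_nats: "length (graph_nats (n, es)) = 2 * m + 2"
  unfolding graph_nats_eq by (simp add: concat_pairs(1)[of edge_fst edge_snd])

lemma cell_in:
  "cell_in 0 = n" "cell_in (Suc 0) = m"
  "e < m \<Longrightarrow> cell_in (Suc (Suc (2 * e))) = edge_fst e"
  "e < m \<Longrightarrow> cell_in (Suc (Suc (Suc (2 * e)))) = edge_snd e"
  unfolding cell_in_def length_graph_nats unfolding graph_nats_eq
  by (simp_all add: concat_pairs(2,3)[of _ _ edge_fst edge_snd])

lemma graph_nats_le: "x \<in> set (graph_nats (n, es)) \<Longrightarrow> x \<le> n + m"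
  unfolding graph_nats_eq using edge_adj adj_V adj_V' by fastforce

lemma graph_reals_nth: "e < m \<Longrightarrow> graph_reals (n, es) ! e = edge_weight e"
  by (auto simp: edge_weight_def split: prod.split)

end

section \<open>Loops\<close>

text \<open>A loop rule whose invariant also sees the cost \<open>C\<close> accumulated so far. The
  frame facts for untouched variables and arrays are supplied to the step, so invariants need not
  repeat them. The counter is excluded because each round overwrites it.\<close>

lemma For_rule_cost:
  assumes N: "vars s y = N" and I0: "I 0 s 0"
    and step: "\<And>k s' C. k < N \<Longrightarrow> (\<And>v. v \<notin> insert x (assigned c) \<Longrightarrow> vars s' v = vars s v) \<Longrightarrow>
      (\<And>a. a \<notin> stored c \<Longrightarrow> arr s' a = arr s a) \<Longrightarrow> I k s' C \<Longrightarrow>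
      I (Suc k) (ev w c (set_var x k s')) (C + (cost w c (set_var x k s') + 4))"
    and post: "\<And>s' C. (\<And>v. v \<notin> insert x (assigned c) \<Longrightarrow> vars s' v = vars s v) \<Longrightarrow>
      (\<And>a. a \<notin> stored c \<Longrightarrow> arr s' a = arr s a) \<Longrightarrow> I N s' C \<Longrightarrow> Q (set_var x N s') (2 + C)"
  shows "Q (ev w (For x y c) s) (cost w (For x y c) s)"
proof -
  let ?it = "\<lambda>k. iterate (\<lambda>i s. ev w c (set_var x i s)) k s"
  have fr: "v \<notin> insert x (assigned c) \<Longrightarrow> vars (?it k) v = vars s v"
    "a \<notin> stored c \<Longrightarrow> arr (?it k) a = arr s a" for k v a
    by (induction k) (simp_all add: vars_frame arr_frame)
  have "k \<le> N \<Longrightarrow> I k (?it k) (\<Sum>i<k. cost w c (set_var x i (?it i)) + 4)" for k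
    by (induction k) (use I0 step fr in auto)
  then show ?thesis using N post fr by simp
qed

lemma For_rule:
  assumes N: "vars s y = N" and I0: "I 0 s"
    and step: "\<And>k s'. k < N \<Longrightarrow> (\<And>v. v \<notin> insert x (assigned c) \<Longrightarrow> vars s' v = vars s v) \<Longrightarrow>
      (\<And>a. a \<notin> stored c \<Longrightarrow> arr s' a = arr s a) \<Longrightarrow> I k s' \<Longrightarrow> I (Suc k) (ev w c (set_var x k s'))"
    and post: "\<And>s'. (\<And>v. v \<notin> insert x (assigned c) \<Longrightarrow> vars s' v = vars s v) \<Longrightarrow>
      (\<And>a. a \<notin> stored c \<Longrightarrow> arr s' a = arr s a) \<Longrightarrow> I N s' \<Longrightarrow> Q (set_var x N s')"
  shows "Q (ev w (For x y c) s)"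
  by (rule For_rule_cost[where I = "\<lambda>k s' C. I k s'" and Q = "\<lambda>s' C. Q s'", OF N]) (fact I0 step post)+

lemma cost_For:
  assumes "vars s y \<le> N"
    and "\<And>k s'. k < vars s y \<Longrightarrow> (\<And>v. v \<notin> insert x (assigned c) \<Longrightarrow> vars s' v = vars s v) \<Longrightarrow>
      (\<And>a. a \<notin> stored c \<Longrightarrow> arr s' a = arr s a) \<Longrightarrow> cost w c (set_var x k s') \<le> K"
  shows "cost w (For x y c) s \<le> 2 + N * (K + 4)"
proof -
  let ?it = "\<lambda>k. iterate (\<lambda>i s. ev w c (set_var x i s)) k s"
  have fr: "v \<notin> insert x (assigned c) \<Longrightarrow> vars (?it k) v = vars s v"
    "a \<notin> stored c \<Longrightarrow> arr (?it k) a = arr s a" for k v a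
    by (induction k) (simp_all add: vars_frame arr_frame)
  have "(\<Sum>k<vars s y. cost w c (set_var x k (?it k)) + 4) \<le> (\<Sum>k<vars s y. K + 4)"
    using assms(2) fr by (intro sum_mono add_right_mono) auto
  also have "\<dots> \<le> N * (K + 4)" using assms(1) by simp
  finally show ?thesis by simp
qed

primrec max_cost :: "(nat \<Rightarrow> nat) \<Rightarrow> com \<Rightarrow> nat" where
  "max_cost L Skip = 0"
| "max_cost L (Assign x e) = ecost e + 1"
| "max_cost L (Store a i j e) = ecost i + ecost j + ecost e + 10"
| "max_cost L (c1 ;; c2) = max_cost L c1 + max_cost L c2"
| "max_cost L (When b q c) = ccost q + max_cost L c"
| "max_cost L (For x y c) = 2 + L y * (max_cost L c + 4)"
| "max_cost L (Out e) = ecost e + 1"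
| "max_cost L (ROut e) = ecost e + 1"

text \<open>\<open>Y\<close> contains the variables that bound loops. A loop may run up to the
  counter of an outer loop, as in \<open>labels\<close>, if the limit of that counter covers the
  bound of the outer loop.\<close>

primrec limits_ok :: "nat set \<Rightarrow> (nat \<Rightarrow> nat) \<Rightarrow> com \<Rightarrow> bool" where
  "limits_ok Y L Skip \<longleftrightarrow> True"
| "limits_ok Y L (Assign x e) \<longleftrightarrow> x \<notin> Y"
| "limits_ok Y L (Store a i j e) \<longleftrightarrow> True"
| "limits_ok Y L (c1 ;; c2) \<longleftrightarrow> limits_ok Y L c1 \<and> limits_ok Y L c2"
| "limits_ok Y L (When b q c) \<longleftrightarrow> limits_ok Y L c"
| "limits_ok Y L (For x y c) \<longleftrightarrow> y \<in> Y \<and> (x \<in> Y \<longrightarrow> L y \<le> L x) \<and> limits_ok Y L c"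
| "limits_ok Y L (Out e) \<longleftrightarrow> True"
| "limits_ok Y L (ROut e) \<longleftrightarrow> True"

lemma limits_cost:
  "limits_ok Y L c \<Longrightarrow> (\<And>y. y \<in> Y \<Longrightarrow> vars s y \<le> L y) \<Longrightarrow>
    cost w c s \<le> max_cost L c \<and> (\<forall>y\<in>Y. vars (ev w c s) y \<le> L y)"
proof (induction c arbitrary: s)
  case (Seq c1 c2)
  then show ?case using Seq.IH(1)[of s] Seq.IH(2)[of "ev w c1 s"] by fastforce
next
  case (For x y c)
  let ?it = "\<lambda>k. iterate (\<lambda>i s. ev w c (set_var x i s)) k s"
  have ok: "y \<in> Y" "x \<in> Y \<longrightarrow> L y \<le> L x" "limits_ok Y L c" using For.prems by auto
  have le: "vars s y \<le> L y" using For.prems ok by blast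
  have set: "vars (set_var x k s') z \<le> L z" if "z \<in> Y" "k \<le> vars s y" "\<And>z. z \<in> Y \<Longrightarrow> vars s' z \<le> L z" for k s' z
    using that ok le by (auto intro: order.trans)
  have it: "k \<le> vars s y \<Longrightarrow> z \<in> Y \<Longrightarrow> vars (?it k) z \<le> L z" for k z
  proof (induction k arbitrary: z)
    case 0 then show ?case using For.prems by simp
  next
    case (Suc k)
    then show ?case using For.IH[OF ok(3), of "set_var x k (?it k)"] set[of _ k "?it k"] by simp
  qed
  have "cost w c (set_var x k (?it k)) \<le> max_cost L c" if "k < vars s y" for k
    using For.IH[OF ok(3), of "set_var x k (?it k)"] set[of _ k "?it k"] it[of k] that by simp
  then have "(\<Sum>k<vars s y. cost w c (set_var x k (?it k)) + 4) \<le> (\<Sum>k<vars s y. max_cost L c + 4)"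
    by (intro sum_mono add_right_mono) auto
  also have "\<dots> \<le> L y * (max_cost L c + 4)" using le by simp
  finally have "cost w (For x y c) s \<le> max_cost L (For x y c)" by simp
  moreover have "\<forall>z\<in>Y. vars (ev w (For x y c) s) z \<le> L z"
    using set[of _ "vars s y" "?it (vars s y)"] it[of "vars s y"] by simp
  ultimately show ?case by blast
qed (auto simp: trans_le_add1)

section \<open>The program\<close>

abbreviation (input) "v_n \<equiv> 0 :: nat"
abbreviation (input) "v_m \<equiv> Suc 0"
abbreviation (input) "v_arcs \<equiv> 2 :: nat"
abbreviation (input) "v_e \<equiv> 3 :: nat"
abbreviation (input) "v_k \<equiv> 4 :: nat"
abbreviation (input) "v_i \<equiv> 5 :: nat"
abbreviation (input) "v_j \<equiv> 6 :: nat"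
abbreviation (input) "v_s \<equiv> 7 :: nat"
abbreviation (input) "v_h \<equiv> 8 :: nat"
abbreviation (input) "v_t \<equiv> 9 :: nat"
abbreviation (input) "v_v \<equiv> 10 :: nat"
abbreviation (input) "v_u \<equiv> 11 :: nat"
abbreviation (input) "v_z \<equiv> 12 :: nat"
abbreviation (input) "v_c \<equiv> 13 :: nat"
abbreviation (input) "v_labels \<equiv> 14 :: nat"
abbreviation (input) "v_count \<equiv> 15 :: nat"
abbreviation (input) "v_lim \<equiv> 16 :: nat"

abbreviation (input) "a_in \<equiv> 0 :: nat"
abbreviation (input) "a_tail \<equiv> 17 :: nat"
abbreviation (input) "a_head \<equiv> 2 :: nat"
abbreviation (input) "a_edge \<equiv> 3 :: nat"
abbreviation (input) "a_arc \<equiv> 4 :: nat"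
abbreviation (input) "a_nbr \<equiv> 5 :: nat"
abbreviation (input) "a_deg \<equiv> 6 :: nat"
abbreviation (input) "a_hop \<equiv> 7 :: nat"
abbreviation (input) "a_queue \<equiv> 8 :: nat"
abbreviation (input) "a_square \<equiv> 9 :: nat"
abbreviation (input) "a_lab \<equiv> 10 :: nat"
abbreviation (input) "a_mark \<equiv> 11 :: nat"
abbreviation (input) "a_diff \<equiv> 12 :: nat"
abbreviation (input) "a_ndiff \<equiv> 13 :: nat"
abbreviation (input) "a_id \<equiv> 14 :: nat"
abbreviation (input) "a_fst \<equiv> 15 :: nat"
abbreviation (input) "a_snd \<equiv> 16 :: nat"

abbreviation Arr1 :: "nat \<Rightarrow> exp \<Rightarrow> exp" where
  "Arr1 a e \<equiv> Arr a e (Const 0)"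

abbreviation Store1 :: "nat \<Rightarrow> exp \<Rightarrow> exp \<Rightarrow> com" where
  "Store1 a e \<equiv> Store a e (Const 0)"

abbreviation Eq :: "exp \<Rightarrow> exp \<Rightarrow> cond" where
  "Eq a b \<equiv> SumEq a (Const 0) b (Const 0)"

abbreviation (input) "tail_i \<equiv> Arr1 a_tail (Var v_i)"
abbreviation (input) "head_i \<equiv> Arr1 a_head (Var v_i)"
abbreviation (input) "tail_j \<equiv> Arr1 a_tail (Var v_j)"
abbreviation (input) "head_j \<equiv> Arr1 a_head (Var v_j)"

text \<open>The arcs \<open>2 e\<close> and \<open>2 e + 1\<close> are the two orientations of the edge \<open>e\<close>. Positions in
  \<open>a_edge\<close> and \<open>a_square\<close> and the values in \<open>a_arc\<close> and \<open>a_hop\<close> are shifted by one, so that 0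
  can stand for an undefined entry.\<close>

definition read_edges :: com where
  "read_edges = Assign v_k (Const 0) ;;
     For v_e v_m (
       Store1 a_fst (Var v_e) (Arr1 a_in (Inc (Inc (Var v_k)))) ;;
       Store1 a_snd (Var v_e) (Arr1 a_in (Inc (Inc (Inc (Var v_k))))) ;;
       Store1 a_tail (Var v_k) (Arr1 a_fst (Var v_e)) ;;
       Store1 a_head (Var v_k) (Arr1 a_snd (Var v_e)) ;;
       Assign v_k (Inc (Var v_k)) ;;
       Store1 a_edge (Var v_k) (Var v_e) ;;
       Store1 a_tail (Var v_k) (Arr1 a_snd (Var v_e)) ;;
       Store1 a_head (Var v_k) (Arr1 a_fst (Var v_e)) ;;
       Assign v_k (Inc (Var v_k)) ;;
       Store1 a_edge (Var v_k) (Var v_e)) ;;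
     Assign v_arcs (Var v_k)"

definition list_arcs :: com where
  "list_arcs = For v_i v_arcs (
     Store a_arc tail_i head_i (Inc (Var v_i)) ;;
     Store a_nbr tail_i (Arr1 a_deg tail_i) head_i ;;
     Store1 a_deg tail_i (Inc (Arr1 a_deg tail_i)))"

definition visit :: com where
  "visit = Assign v_u (Arr a_nbr (Var v_v) (Var v_k)) ;;
     When True (Eq (Arr a_hop (Var v_s) (Var v_u)) (Const 0)) (
       Store a_hop (Var v_s) (Var v_u) (Inc (Arr a_hop (Var v_s) (Var v_v))) ;;
       Store a_queue (Var v_s) (Var v_t) (Var v_u) ;;
       Assign v_t (Inc (Var v_t)))"

definition expand :: com where
  "expand = Assign v_v (Arr a_queue (Var v_s) (Var v_h)) ;;
     Assign v_lim (Arr1 a_deg (Var v_v)) ;;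
     For v_k v_lim visit"

text \<open>The loop over queue positions needs no test for an empty queue: in a connected graph
  every vertex is queued exactly once, so there are exactly \<open>n\<close> positions to
  expand.\<close>

definition search :: com where
  "search = Store a_hop (Var v_s) (Var v_s) (Const 1) ;;
     Store a_queue (Var v_s) (Const 0) (Var v_s) ;;
     Assign v_t (Const 1) ;;
     For v_h v_n expand"

definition hops :: com where
  "hops = For v_s v_n search"

text \<open>The loops run over pairs of opposite sides, and the other two sides are looked up in the
  adjacency matrix. Running over adjacent sides would need a third loop to find the fourth
  corner.\<close>

definition squares :: com where
  "squares = For v_i v_arcs (For v_j v_arcs (
     When False (Eq (Arr a_arc tail_i tail_j) (Const 0)) (
     When False (Eq (Arr a_arc head_i head_j) (Const 0)) (
     When False (Eq tail_i head_j) (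
     When True (WeightEq (Arr1 a_edge (Inc (Var v_i))) (Arr1 a_edge (Inc (Var v_j)))) (
     When True (WeightEq (Arr1 a_edge (Arr a_arc tail_i tail_j)) (Arr1 a_edge (Arr a_arc head_i head_j))) (
       Store a_square (Var v_i) (Arr a_arc tail_i tail_j) (Const 1))))))))"

definition mark_arc :: com where
  "mark_arc =
     When False (SumEq (Arr a_hop tail_i tail_j) (Arr a_hop head_i head_j)
                       (Arr a_hop tail_i head_j) (Arr a_hop head_i tail_j)) (
       Store a_mark (Var v_i) (Arr1 a_lab (Var v_j)) (Const 1)) ;;
     When True (Eq tail_i tail_j) (
       When True (Eq (Arr a_square (Var v_i) (Inc (Var v_j))) (Const 0)) (
         Store a_mark (Var v_i) (Arr1 a_lab (Var v_j)) (Const 1)))"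

definition merge_arc :: com where
  "merge_arc = When True (Eq (Arr a_mark (Var v_i) (Arr1 a_lab (Var v_j))) (Const 1)) (
     Store1 a_lab (Var v_j) (Var v_i))"

text \<open>Arc \<open>i\<close> becomes the label of all classes with an arc related to it. The
  first pass only marks labels, because such an arc may come after other members of its class; the
  second renames. Row \<open>i\<close> of the marks is used for arc \<open>i\<close> only, so no
  marks are ever cleared.\<close>

definition labels :: com where
  "labels = For v_i v_arcs (
     Store1 a_lab (Var v_i) (Var v_i) ;; For v_j v_i mark_arc ;; For v_j v_i merge_arc)"

definition differences :: com where
  "differences = For v_z v_n (For v_i v_arcs (
     When False (SumEq (Arr a_hop (Var v_z) tail_i) (Arr a_hop (Const 0) head_i)
                       (Arr a_hop (Var v_z) head_i) (Arr a_hop (Const 0) tail_i)) (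
       When True (Eq (Arr a_diff (Arr1 a_lab (Var v_i)) (Var v_z)) (Const 0)) (
         Store a_diff (Arr1 a_lab (Var v_i)) (Var v_z) (Const 1) ;;
         Store1 a_ndiff (Var v_z) (Inc (Arr1 a_ndiff (Var v_z)))))))"

abbreviation is_label :: cond where
  "is_label \<equiv> Eq (Arr1 a_lab (Var v_c)) (Var v_c)"

text \<open>A membership test in constant time: the set of labels on which a vertex differs from the
  root is contained in \<open>{c}\<close> iff its size equals the indicator of \<open>c\<close> in
  it.\<close>

abbreviation in_fibre :: "exp \<Rightarrow> cond" where
  "in_fibre e \<equiv> Eq (Arr1 a_ndiff e) (Arr a_diff (Var v_c) e)"

text \<open>If there are no edges, then 0 serves as the only label, and the one-vertex graph is output.\<close>

definition count_labels :: com where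
  "count_labels = Assign v_labels (Var v_arcs) ;;
     When True (Eq (Var v_m) (Const 0)) (Assign v_labels (Const 1)) ;;
     Assign v_count (Const 0) ;;
     For v_c v_labels (When True is_label (Assign v_count (Inc (Var v_count)))) ;;
     Out (Var v_count)"

abbreviation on_fibre_edges :: "com \<Rightarrow> com" where
  "on_fibre_edges c \<equiv> For v_e v_m (
     When True (in_fibre (Arr1 a_fst (Var v_e))) (When True (in_fibre (Arr1 a_snd (Var v_e))) c))"

definition number_vertices :: com where
  "number_vertices = Assign v_t (Const 0) ;;
     For v_z v_n (When True (in_fibre (Var v_z)) (
       Store a_id (Var v_c) (Var v_z) (Var v_t) ;; Assign v_t (Inc (Var v_t)))) ;;
     Out (Var v_t)"

definition count_edges :: com where
  "count_edges = Assign v_t (Const 0) ;; on_fibre_edges (Assign v_t (Inc (Var v_t))) ;; Out (Var v_t)"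

definition write_edges :: com where
  "write_edges = on_fibre_edges (
     Out (Arr a_id (Var v_c) (Arr1 a_fst (Var v_e))) ;;
     Out (Arr a_id (Var v_c) (Arr1 a_snd (Var v_e))) ;;
     ROut (Var v_e))"

definition write_factors :: com where
  "write_factors = For v_c v_labels (When True is_label (
     number_vertices ;; count_edges ;; write_edges))"

definition factorize :: com where
  "factorize = read_edges ;; list_arcs ;; hops ;; squares ;; labels ;; differences ;;
     count_labels ;; write_factors"

lemmas factorize_defs = read_edges_def list_arcs_def visit_def expand_def search_def hops_def
  squares_def mark_arc_def merge_arc_def labels_def differences_def count_labels_def
  number_vertices_def count_edges_def write_edges_def write_factors_def

lemma factorize_ok: "com_ok factorize"
  by (simp add: factorize_def factorize_defs)

section \<open>Correctness of the phases\<close>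

context presented_graph
begin

definition input_read :: "store \<Rightarrow> bool" where
  "input_read s \<longleftrightarrow> vars s v_n = n \<and> vars s v_m = m \<and> vars s v_arcs = 2 * m \<and>
     (\<forall>i<2 * m. arr s a_tail i 0 = tail i \<and> arr s a_head i 0 = head i \<and> arr s a_edge (Suc i) 0 = i div 2) \<and>
     (\<forall>e<m. arr s a_fst e 0 = edge_fst e \<and> arr s a_snd e 0 = edge_snd e)"

lemma input_read_frame:
  assumes "input_read s" "{v_n, v_m, v_arcs} \<inter> assigned c = {}"
    "{a_tail, a_head, a_edge, a_fst, a_snd} \<inter> stored c = {}"
  shows "input_read (ev w c s)"
  using assms unfolding input_read_def by (simp add: vars_frame arr_frame)

lemma read_edges:
  assumes "vars s v_n = n" "vars s v_m = m" "\<And>i. 2 \<le> i \<Longrightarrow> arr s a_in i 0 = cell_in i"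
  shows "input_read (ev w read_edges s)"
proof -
  let ?I = "\<lambda>k s. vars s v_k = 2 * k \<and>
     (\<forall>i<2 * k. arr s a_tail i 0 = tail i \<and> arr s a_head i 0 = head i \<and> arr s a_edge (Suc i) 0 = i div 2) \<and>
     (\<forall>e<k. arr s a_fst e 0 = edge_fst e \<and> arr s a_snd e 0 = edge_snd e)"
  have final: "input_read (set_var v_arcs (vars s' v_k) s')"
    if "vars s' v_n = n" "vars s' v_m = m" "?I m s'" for s'
    using that unfolding input_read_def by simp
  show ?thesis
    unfolding read_edges_def ev.simps(4)
  proof (rule For_rule[where N = m and I = ?I], goal_cases)
    case (3 k s')
    have k: "vars s' v_k = 2 * k" using 3 by simp
    have inp: "arr s' a_in = arr s a_in" using 3(3)[of a_in] by simp
    have c: "arr s a_in (Suc (Suc (2 * k))) 0 = edge_fst k" "arr s a_in (Suc (Suc (Suc (2 * k)))) 0 = edge_snd k"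
      using assms(3) cell_in(3,4)[OF 3(1)] by simp_all
    have less: "i < 2 * Suc k \<longleftrightarrow> i < 2 * k \<or> i = 2 * k \<or> i = Suc (2 * k)" for i by auto
    show ?case
      unfolding less using 3(4) by (auto simp: k inp c tail_def head_def less_Suc_eq)
  next
    case (4 s')
    then show ?case using final[of "set_var v_e m s'"] assms by simp
  qed (use assms in auto)
qed

definition degree :: "nat \<Rightarrow> nat" where
  "degree v = card {i. i < 2 * m \<and> tail i = v}"

definition arcs_listed :: "store \<Rightarrow> bool" where
  "arcs_listed s \<longleftrightarrow> (\<forall>i<2 * m. arr s a_arc (tail i) (head i) = Suc i) \<and>
     (\<forall>a b. arr s a_arc a b \<noteq> 0 \<longrightarrow> gadj G a b) \<and>
     (\<forall>v. arr s a_deg v 0 = degree v \<and> arr s a_nbr v ` {..<degree v} = {u. gadj G v u})"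

lemma list_arcs:
  assumes s: "input_read s" and zero: "\<And>i j. arr s a_arc i j = 0" "\<And>i. arr s a_deg i 0 = 0"
  shows "arcs_listed (ev w list_arcs s)"
proof -
  let ?d = "\<lambda>k v. card {i. i < k \<and> tail i = v}"
  let ?I = "\<lambda>k s. (\<forall>i<k. arr s a_arc (tail i) (head i) = Suc i) \<and>
     (\<forall>a b. arr s a_arc a b \<noteq> 0 \<longrightarrow> gadj G a b) \<and>
     (\<forall>v. arr s a_deg v 0 = ?d k v \<and> arr s a_nbr v ` {..<?d k v} = head ` {i. i < k \<and> tail i = v})"
  show ?thesis
    unfolding list_arcs_def
  proof (rule For_rule[where N = "2 * m" and I = ?I], goal_cases)
    case 1 then show ?case using s unfolding input_read_def by blast
  next
    case 2 then show ?case using zero by simp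
  next
    case (3 k s')
    have th: "arr s' a_tail k 0 = tail k" "arr s' a_head k 0 = head k"
      using 3(1) 3(3)[of a_tail] 3(3)[of a_head] s unfolding input_read_def by simp_all
    have ds: "{i. i < Suc k \<and> tail i = v} = (if v = tail k then insert k {i. i < k \<and> tail i = v} else {i. i < k \<and> tail i = v})" for v
      by (auto simp: less_Suc_eq)
    have d: "?d (Suc k) v = (if v = tail k then Suc (?d k v) else ?d k v)" for v
      unfolding ds by (subst card_insert_disjoint[symmetric]) auto
    let ?body = "Store a_arc tail_i head_i (Inc (Var v_i)) ;;
     Store a_nbr tail_i (Arr1 a_deg tail_i) head_i ;;
     Store1 a_deg tail_i (Inc (Arr1 a_deg tail_i))"
    let ?t = "ev w ?body (set_var v_i k s')"
    have A: "arr ?t a_arc a b = (if a = tail k \<and> b = head k then Suc k else arr s' a_arc a b)" for a b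
      by (simp add: th)
    have D: "arr ?t a_deg v 0 = (if v = tail k then Suc (arr s' a_deg v 0) else arr s' a_deg v 0)" for v
      by (simp add: th)
    have N: "arr ?t a_nbr v = (if v = tail k then (arr s' a_nbr v)(arr s' a_deg v 0 := head k) else arr s' a_nbr v)" for v
      by (simp add: th)
    have IH: "\<And>i. i < k \<Longrightarrow> arr s' a_arc (tail i) (head i) = Suc i" "\<And>a b. arr s' a_arc a b \<noteq> 0 \<Longrightarrow> gadj G a b"
      "\<And>v. arr s' a_deg v 0 = ?d k v" "\<And>v. arr s' a_nbr v ` {..<?d k v} = head ` {i. i < k \<and> tail i = v}"
      using 3(4) by auto
    have "arr ?t a_arc (tail i) (head i) = Suc i" if "i < Suc k" for i
      unfolding A using that arc_inj[of i k] 3(1) IH(1)[of i] by (auto simp: less_Suc_eq)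
    moreover have "gadj G a b" if "arr ?t a_arc a b \<noteq> 0" for a b
      using that IH(2)[of a b] arc_adj[OF 3(1)] unfolding A by (auto split: if_splits)
    moreover have "arr ?t a_deg v 0 = ?d (Suc k) v" for v
      unfolding D d IH(3) by simp
    moreover have "arr ?t a_nbr v ` {..<?d (Suc k) v} = head ` {i. i < Suc k \<and> tail i = v}" for v
    proof (cases "v = tail k")
      case False then show ?thesis unfolding N d ds using IH(4)[of v] by simp
    next
      case True
      have "((arr s' a_nbr v)(?d k v := head k)) ` {..<Suc (?d k v)} =
          insert (head k) (arr s' a_nbr v ` {..<?d k v})"
        by (auto simp: lessThan_Suc)
      then show ?thesis unfolding N d ds IH(3) using IH(4)[of v] True by simp
    qed
    ultimately show ?case by blast
  next
    case (4 s')
    have "head ` {i. i < 2 * m \<and> tail i = v} = {u. gadj G v u}" for v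
      using arc_adj arc_ex[of v] by (auto simp: image_iff) metis
    then show ?case using 4(3) unfolding arcs_listed_def degree_def by simp
  qed
qed

subsection \<open>Breadth-first search\<close>

text \<open>Invariant of a search from \<open>r\<close>: position \<open>h\<close> of the queue
  \<open>q\<close> is being expanded, its neighbours in \<open>K\<close> have been inspected,
  \<open>t\<close> is the length of the queue, and \<open>D\<close> holds distances plus one. The
  queue is sorted by distance and reaches at most one level beyond \<open>q h\<close>.\<close>

definition bfs :: "nat \<Rightarrow> nat \<Rightarrow> nat set \<Rightarrow> (nat \<Rightarrow> nat) \<Rightarrow> nat \<Rightarrow> (nat \<Rightarrow> nat) \<Rightarrow> bool" where
  "bfs r h K q t D \<longleftrightarrow> h < t \<and> q 0 = r \<and> inj_on q {..<t} \<and> q ` {..<t} \<subseteq> {..<n} \<and>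
     (\<forall>x. D x = (if x \<in> q ` {..<t} then Suc (hop r x) else 0)) \<and>
     (\<forall>i j. i \<le> j \<and> j < t \<longrightarrow> hop r (q i) \<le> hop r (q j)) \<and>
     (\<forall>i<h. \<forall>x. gadj G (q i) x \<longrightarrow> x \<in> q ` {..<t}) \<and>
     (\<forall>j<t. hop r (q j) \<le> Suc (hop r (q h))) \<and> K \<subseteq> q ` {..<t}"

lemma bfs_start: "r < n \<Longrightarrow> q 0 = r \<Longrightarrow> D = (\<lambda>_. 0)(r := 1) \<Longrightarrow> bfs r 0 {} q 1 D"
  unfolding bfs_def by (auto simp: lessThan_Suc)

lemma bfs_seen: "bfs r h K q t D \<Longrightarrow> D x \<noteq> 0 \<Longrightarrow> bfs r h (insert x K) q t D"
  unfolding bfs_def by (auto split: if_splits)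

text \<open>By induction on the distance: a predecessor of \<open>x\<close> has been expanded, so
  \<open>x\<close> is in the queue, and since the queue is sorted it stands before
  \<open>h\<close>.\<close>

lemma bfs_closer:
  assumes "bfs r h K q t D" "r < n" "x < n" "hop r x < hop r (q h)" shows "\<exists>i<h. q i = x"
  using assms(3,4)
proof (induction "hop r x" arbitrary: x)
  case 0
  then have "x = r" using hop_eq_0[of r x] assms(2) by auto
  then show ?case using 0 assms(1) unfolding bfs_def by (metis gr0I less_irrefl hop_self)
next
  case (Suc k)
  then have "r \<noteq> x" by auto
  then obtain p where p: "gadj G p x" "hop r x = hop r p + 1" using hop_pred[of r x] assms(2) Suc.prems by auto
  then obtain i where i: "i < h" "q i = p" using Suc.hyps(1)[of p] Suc.hyps(2) Suc.prems adj_V[OF p(1)] by auto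
  then obtain j where j: "j < t" "x = q j" using assms(1) p unfolding bfs_def by blast
  have "j < h"
  proof (rule ccontr)
    assume "\<not> j < h"
    then have "hop r (q h) \<le> hop r (q j)" using assms(1) j unfolding bfs_def by simp
    then show False using Suc.prems j by simp
  qed
  then show ?case using j by blast
qed

text \<open>If \<open>x\<close> were not one step farther than \<open>q h\<close>, its predecessor
  on a shortest path would be closer than \<open>q h\<close>, hence fully expanded, and
  \<open>x\<close> would not be new.\<close>

lemma bfs_new:
  assumes b: "bfs r h K q t D" and r: "r < n" and x: "gadj G (q h) x" "D x = 0"
  shows "bfs r h (insert x K) (q(t := x)) (Suc t) (D(x := Suc (D (q h))))"
proof -
  have ht: "h < t" and inj: "inj_on q {..<t}" and D: "\<And>x. D x = (if x \<in> q ` {..<t} then Suc (hop r x) else 0)"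
    and mono: "\<And>i j. i \<le> j \<Longrightarrow> j < t \<Longrightarrow> hop r (q i) \<le> hop r (q j)"
    and top: "\<And>j. j < t \<Longrightarrow> hop r (q j) \<le> Suc (hop r (q h))"
    and closed: "\<And>i x. i < h \<Longrightarrow> gadj G (q i) x \<Longrightarrow> x \<in> q ` {..<t}"
    using b unfolding bfs_def by blast+
  have new: "x \<notin> q ` {..<t}" using D[of x] x(2) by (auto split: if_splits)
  have xn: "x < n" using x adj_V' by auto
  have "hop r x = Suc (hop r (q h))"
  proof (rule ccontr)
    assume ne: "hop r x \<noteq> Suc (hop r (q h))"
    have "hop r x \<le> hop r (q h) + 1" using hop_step[of r "q h" x] r x by simp
    then have le: "hop r x \<le> hop r (q h)" using ne by simp
    have "r \<in> q ` {..<t}" using b ht unfolding bfs_def by force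
    then have "r \<noteq> x" using new by blast
    then obtain p where p: "gadj G p x" "hop r x = hop r p + 1" using hop_pred[of r x] r xn by auto
    then obtain i where "i < h" "q i = p" using bfs_closer[OF b r, of p] le adj_V[OF p(1)] by auto
    then show False using closed p new by blast
  qed
  then have hx: "hop r x = Suc (hop r (q h))" .
  have im: "(q(t := x)) ` {..<Suc t} = insert x (q ` {..<t})" by (auto simp: lessThan_Suc)
  have "inj_on (q(t := x)) {..<Suc t}" using inj new by (auto simp: inj_on_def less_Suc_eq)
  moreover have "D (q h) = Suc (hop r (q h))" using D[of "q h"] ht by auto
  then have "\<forall>y. (D(x := Suc (D (q h)))) y = (if y \<in> insert x (q ` {..<t}) then Suc (hop r y) else 0)"
    using D hx by auto
  moreover have "hop r ((q(t := x)) i) \<le> hop r ((q(t := x)) j)" if "i \<le> j" "j < Suc t" for i j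
    using that mono[of i j] top[of i] hx by (auto simp: less_Suc_eq)
  moreover have "hop r ((q(t := x)) j) \<le> Suc (hop r ((q(t := x)) h))" if "j < Suc t" for j
    using that top[of j] hx ht by (auto simp: less_Suc_eq)
  moreover have "\<forall>i<h. \<forall>y. gadj G ((q(t := x)) i) y \<longrightarrow> y \<in> insert x (q ` {..<t})"
    using closed ht by auto
  moreover have "q 0 = r" "q ` {..<t} \<subseteq> {..<n}" "K \<subseteq> q ` {..<t}" using b unfolding bfs_def by auto
  ultimately show ?thesis unfolding bfs_def im using ht xn by auto
qed

lemma bfs_size: "bfs r h K q t D \<Longrightarrow> t \<le> n"
  unfolding bfs_def using card_inj_on_le[of q "{..<t}" "{..<n}"] by simp

lemma bfs_next:
  assumes b: "bfs r h K q t D" and K: "{u. gadj G (q h) u} \<subseteq> K" and t: "Suc h < t"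
  shows "bfs r (Suc h) {} q t D"
proof -
  have mono: "\<forall>i j. i \<le> j \<and> j < t \<longrightarrow> hop r (q i) \<le> hop r (q j)"
    and top: "\<forall>j<t. hop r (q j) \<le> Suc (hop r (q h))"
    and closed: "\<forall>i<h. \<forall>x. gadj G (q i) x \<longrightarrow> x \<in> q ` {..<t}" and K': "K \<subseteq> q ` {..<t}"
    using b unfolding bfs_def by blast+
  have "hop r (q h) \<le> hop r (q (Suc h))" using mono t by simp
  then have "\<forall>j<t. hop r (q j) \<le> Suc (hop r (q (Suc h)))" using top by (meson Suc_le_mono le_trans)
  moreover have "\<forall>i<Suc h. \<forall>x. gadj G (q i) x \<longrightarrow> x \<in> q ` {..<t}"
    using closed K K' by (auto simp: less_Suc_eq)
  ultimately show ?thesis using b t unfolding bfs_def by blast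
qed

text \<open>When the queue is exhausted, its vertices are closed under adjacency and so are all
  vertices. Hence it cannot be exhausted before round \<open>n\<close>.\<close>

lemma bfs_finish:
  assumes b: "bfs r h K q t D" and "{u. gadj G (q h) u} \<subseteq> K" "Suc h = t" "r < n"
  shows "t = n" "q ` {..<n} = {..<n}"
proof -
  have closed: "x \<in> q ` {..<t}" if "y \<in> q ` {..<t}" "gadj G y x" for x y
  proof -
    from that(1) obtain i where i: "i < t" "q i = y" by auto
    have K: "K \<subseteq> q ` {..<t}" and c: "\<forall>i<h. \<forall>x. gadj G (q i) x \<longrightarrow> x \<in> q ` {..<t}"
      using b unfolding bfs_def by blast+
    show ?thesis
    proof (cases "i = h")
      case True then show ?thesis using i that(2) assms(2) K by auto
    next
      case False
      then have "i < h" using i assms(3) by simp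
      then show ?thesis using c i that(2) by blast
    qed
  qed
  have "{..<n} \<subseteq> q ` {..<t}"
  proof
    fix x assume "x \<in> {..<n}"
    then have "(r, x) \<in> arcs\<^sup>*" using connected assms by simp
    then show "x \<in> q ` {..<t}"
    proof (induction rule: rtrancl_induct)
      case base then show ?case using b unfolding bfs_def by force
    qed (use closed in auto)
  qed
  then have e: "q ` {..<t} = {..<n}" using b unfolding bfs_def by blast
  have "inj_on q {..<t}" using b unfolding bfs_def by blast
  then show "t = n" using card_image[of q "{..<t}"] e by simp
  then show "q ` {..<n} = {..<n}" using e by simp
qed

definition bfs_state :: "nat \<Rightarrow> nat \<Rightarrow> nat set \<Rightarrow> store \<Rightarrow> bool" where
  "bfs_state r h K s \<longleftrightarrow> bfs r h K (arr s a_queue r) (vars s v_t) (arr s a_hop r)"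

lemma visit:
  assumes s: "vars s v_s = r" "r < n" "vars s v_v = arr s a_queue r h" "bfs_state r h K s"
    and x: "arr s a_nbr (vars s v_v) (vars s v_k) = x" "gadj G (vars s v_v) x"
  shows "bfs_state r h (insert x K) (ev w visit s)"
    and "i \<le> h \<Longrightarrow> arr (ev w visit s) a_queue r i = arr s a_queue r i"
    and "r' \<noteq> r \<Longrightarrow> arr (ev w visit s) a_hop r' = arr s a_hop r'"
proof -
  have ht: "h < vars s v_t" using s(4) unfolding bfs_state_def bfs_def by blast
  show "bfs_state r h (insert x K) (ev w visit s)"
  proof (cases "arr s a_hop r x = 0")
    case True
    then show ?thesis using bfs_new[OF s(4)[unfolded bfs_state_def] s(2), of x] s(1,3) x
      unfolding bfs_state_def visit_def by simp
  next
    case False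
    then show ?thesis using bfs_seen[OF s(4)[unfolded bfs_state_def] False] s(1,3) x
      unfolding bfs_state_def visit_def by simp
  qed
  show "i \<le> h \<Longrightarrow> arr (ev w visit s) a_queue r i = arr s a_queue r i"
    using ht s(1) unfolding visit_def by simp
  show "r' \<noteq> r \<Longrightarrow> arr (ev w visit s) a_hop r' = arr s a_hop r'"
    using s(1) unfolding visit_def by simp
qed

lemma expand:
  fixes w :: "nat \<Rightarrow> real"
  assumes s: "vars s v_s = r" "r < n" "vars s v_h = h" "bfs_state r h {} s" "arcs_listed s"
  defines "q \<equiv> arr s a_queue r" and "s' \<equiv> ev w expand s"
  shows "bfs_state r h {u. gadj G (q h) u} s'" (is ?A)
    and "\<forall>i\<le>h. arr s' a_queue r i = q i" (is ?B)
    and "\<forall>r'. r' \<noteq> r \<longrightarrow> arr s' a_hop r' = arr s a_hop r'" (is ?C)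
    and "cost w expand s \<le> 50 + degree (q h) * (max_cost (\<lambda>_. 0) visit + 4)" (is ?D)
proof -
  let ?s1 = "set_var v_lim (degree (q h)) (set_var v_v (q h) s)"
  have deg: "arr s a_deg (q h) 0 = degree (q h)" "arr s a_nbr (q h) ` {..<degree (q h)} = {u. gadj G (q h) u}"
    using s(5) unfolding arcs_listed_def by auto
  have "?A \<and> ?B \<and> ?C"
    unfolding s'_def expand_def ev.simps(4)
  proof (rule For_rule[where N = "degree (q h)" and I = "\<lambda>k t. bfs_state r h (arr s a_nbr (q h) ` {..<k}) t \<and>
       (\<forall>i\<le>h. arr t a_queue r i = q i) \<and> (\<forall>r'. r' \<noteq> r \<longrightarrow> arr t a_hop r' = arr s a_hop r')"], goal_cases)
    case 1 then show ?case using s deg by (simp add: q_def)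
  next
    case 2 then show ?case using s by (simp add: bfs_state_def q_def)
  next
    case (3 k t)
    let ?t = "set_var v_k k t"
    have f: "vars t v_s = r" "vars t v_v = q h" "arr t a_nbr = arr s a_nbr"
      using 3(2)[of v_s] 3(3)[of a_nbr] 3(4) s
      by (simp_all add: visit_def q_def) (use 3(2)[of v_v] s in \<open>simp add: visit_def\<close>)
    have adj: "gadj G (q h) (arr s a_nbr (q h) k)" using deg(2) 3(1) by blast
    have b: "bfs_state r h (arr s a_nbr (q h) ` {..<k}) ?t" using 3(4) unfolding bfs_state_def by simp
    have Q: "\<forall>i\<le>h. arr t a_queue r i = q i" "\<forall>r'. r' \<noteq> r \<longrightarrow> arr t a_hop r' = arr s a_hop r'"
      using 3(4) by auto
    have "vars ?t v_v = arr ?t a_queue r h" using f Q by simp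
    note v = visit[OF _ s(2) this b, of "arr s a_nbr (q h) k"]
    have "insert (arr s a_nbr (q h) k) (arr s a_nbr (q h) ` {..<k}) = arr s a_nbr (q h) ` {..<Suc k}"
      by (auto simp: lessThan_Suc)
    then show ?case using v f adj Q by auto
  next
    case (4 t)
    then show ?case using deg unfolding bfs_state_def by simp
  qed
  then show ?A ?B ?C by auto
  \<comment> \<open>\<open>visit\<close> contains no loop, so its cost is bounded with arbitrary
    loop limits, here 0.\<close>
  have "cost w (For v_k v_lim visit) ?s1 \<le> 2 + degree (q h) * (max_cost (\<lambda>_. 0) visit + 4)"
  proof (rule cost_For)
    show "cost w visit t \<le> max_cost (\<lambda>_. 0) visit" for t
      by (rule limits_cost[where Y = "{}", THEN conjunct1]) (simp_all add: visit_def)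
  qed simp
  then show ?D using s deg by (simp add: expand_def q_def)
qed

lemma search:
  assumes s: "vars s v_s = r" "r < n" "vars s v_n = n" "arcs_listed s" "arr s a_hop r = (\<lambda>_. 0)"
  shows "(\<forall>x<n. arr (ev w search s) a_hop r x = Suc (hop r x)) \<and>
    (\<forall>r'. r' \<noteq> r \<longrightarrow> arr (ev w search s) a_hop r' = arr s a_hop r') \<and>
    cost w search s \<le> 100 + n * 54 + 2 * m * (max_cost (\<lambda>_. 0) visit + 4)"
proof -
  let ?K = "max_cost (\<lambda>_. 0) visit + 4"
  let ?init = "Store a_hop (Var v_s) (Var v_s) (Const 1) ;;
     Store a_queue (Var v_s) (Const 0) (Var v_s) ;; Assign v_t (Const 1)"
  let ?s1 = "ev w ?init s"
  \<comment> \<open>After the last round no position is left to expand and \<open>bfs\<close> cannot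
    hold, since it demands \<open>h < t\<close>; the invariant then states the final result
    instead.\<close>
  let ?I = "\<lambda>h t C. (if h < n then bfs_state r h {} t
      else inj_on (arr t a_queue r) {..<n} \<and> arr t a_queue r ` {..<n} = {..<n} \<and>
        (\<forall>x<n. arr t a_hop r x = Suc (hop r x))) \<and>
      (\<forall>r'. r' \<noteq> r \<longrightarrow> arr t a_hop r' = arr s a_hop r') \<and>
      C \<le> (\<Sum>i<h. 54 + degree (arr t a_queue r i) * ?K)"
  have "(\<lambda>t C. (\<forall>x<n. arr t a_hop r x = Suc (hop r x)) \<and>
    (\<forall>r'. r' \<noteq> r \<longrightarrow> arr t a_hop r' = arr s a_hop r') \<and> C \<le> 2 + n * 54 + 2 * m * ?K)
    (ev w (For v_h v_n expand) ?s1) (cost w (For v_h v_n expand) ?s1)"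
  proof (rule For_rule_cost[where N = n and I = ?I], goal_cases)
    case 1 then show ?case using s by simp
  next
    case 2
    then show ?case using s n_pos by (simp add: bfs_state_def bfs_start[OF _ _ refl, simplified])
  next
    case (3 h t C)
    let ?t = "set_var v_h h t" and ?q = "arr t a_queue r"
    have vs: "vars t v_s = r"
      using 3(2)[of v_s] s by (simp add: visit_def expand_def)
    have al: "arcs_listed ?t"
      using s(4) 3(3)[of a_arc] 3(3)[of a_deg] 3(3)[of a_nbr] unfolding arcs_listed_def
      by (simp add: visit_def expand_def)
    have b: "bfs_state r h {} ?t" using 3(1,4) unfolding bfs_state_def by simp
    note e = expand[where s = ?t and r = r and h = h and w = w]
    have e1: "bfs_state r h {u. gadj G (?q h) u} (ev w expand ?t)"
      "\<forall>i\<le>h. arr (ev w expand ?t) a_queue r i = ?q i"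
      "\<forall>r'. r' \<noteq> r \<longrightarrow> arr (ev w expand ?t) a_hop r' = arr t a_hop r'"
      "cost w expand ?t \<le> 50 + degree (?q h) * ?K"
      using e[OF _ s(2) _ b al] vs by auto
    let ?u = "ev w expand ?t"
    have "(\<Sum>i<h. 54 + degree (?q i) * ?K) = (\<Sum>i<h. 54 + degree (arr ?u a_queue r i) * ?K)"
      using e1(2) by (intro sum.cong) auto
    moreover have "arr ?u a_queue r h = ?q h" using e1(2) by simp
    ultimately have C: "C + (cost w expand ?t + 4) \<le> (\<Sum>i<Suc h. 54 + degree (arr ?u a_queue r i) * ?K)"
      using 3(4) e1(4) by simp
    let ?Q = "arr ?u a_queue r"
    have bu: "bfs r h {u. gadj G (?Q h) u} ?Q (vars ?u v_t) (arr ?u a_hop r)"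
      using e1(1,2) unfolding bfs_state_def by simp
    have "if Suc h < n then bfs_state r (Suc h) {} ?u
      else inj_on ?Q {..<n} \<and> ?Q ` {..<n} = {..<n} \<and> (\<forall>x<n. arr ?u a_hop r x = Suc (hop r x))"
    proof (cases "Suc h < vars ?u v_t")
      case True
      have "vars ?u v_t \<le> n" using bfs_size[OF bu] .
      then show ?thesis using bfs_next[OF bu order_refl True] True unfolding bfs_state_def by simp
    next
      case False
      moreover have "h < vars ?u v_t" using bu unfolding bfs_def by blast
      ultimately have eq: "Suc h = vars ?u v_t" by simp
      note fin = bfs_finish[OF bu order_refl eq s(2)]
      have "inj_on ?Q {..<n}" using bu fin(1) unfolding bfs_def by simp
      moreover have "arr ?u a_hop r x = Suc (hop r x)" if "x < n" for x
      proof -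
        have "x \<in> ?Q ` {..<vars ?u v_t}" using fin that by simp
        then show ?thesis using bu unfolding bfs_def by simp
      qed
      ultimately show ?thesis using fin eq by simp
    qed
    then show ?case using C e1(3) 3(4) by simp
  next
    case (4 t C)
    let ?q = "arr t a_queue r"
    have q: "inj_on ?q {..<n}" "?q ` {..<n} = {..<n}" using 4(3) by auto
    \<comment> \<open>The queue is a permutation of the vertices, so the degrees along it add up to
      the number of arcs.\<close>
    have "(\<Sum>i<n. degree (?q i)) = (\<Sum>v\<in>?q ` {..<n}. degree v)" using q(1) by (simp add: sum.reindex)
    also have "\<dots> = 2 * m" using sum_degrees q(2) by (simp add: degree_def)
    finally have "(\<Sum>i<n. 54 + degree (?q i) * ?K) = n * 54 + 2 * m * ?K"
      by (simp add: sum.distrib sum_distrib_right[symmetric])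
    then show ?case using 4(3) by simp
  qed
  then show ?thesis unfolding search_def by simp
qed

definition hops_known :: "store \<Rightarrow> bool" where
  "hops_known s \<longleftrightarrow> (\<forall>u<n. \<forall>v<n. arr s a_hop u v = Suc (hop u v))"

lemma hops:
  assumes s: "vars s v_n = n" "arcs_listed s" "\<And>u v. arr s a_hop u v = 0"
  shows "hops_known (ev w hops s) \<and>
    cost w hops s \<le> 2 + n * (104 + n * 54 + 2 * m * (max_cost (\<lambda>_. 0) visit + 4))"
proof -
  let ?S = "104 + n * 54 + 2 * m * (max_cost (\<lambda>_. 0) visit + 4)"
  have "(\<lambda>t C. hops_known t \<and> C \<le> 2 + n * ?S) (ev w (For v_s v_n search) s) (cost w (For v_s v_n search) s)"
  proof (rule For_rule_cost[where N = n and I = "\<lambda>k t C. (\<forall>u<k. \<forall>v<n. arr t a_hop u v = Suc (hop u v)) \<and>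
      (\<forall>u\<ge>k. \<forall>v. arr t a_hop u v = 0) \<and> C \<le> k * ?S"], goal_cases)
    case (3 k t C)
    let ?t = "set_var v_s k t"
    have al: "arcs_listed ?t"
      using s(2) 3(3)[of a_arc] 3(3)[of a_deg] 3(3)[of a_nbr] unfolding arcs_listed_def
      by (simp add: visit_def expand_def search_def)
    have vn: "vars ?t v_n = n" using s(1) 3(2)[of v_n] by (simp add: visit_def expand_def search_def)
    have z: "arr ?t a_hop k = (\<lambda>_. 0)" using 3(4) by auto
    have vk: "vars ?t v_s = k" by simp
    from search[OF vk 3(1) vn al z, of w] 3(4) show ?case by (auto simp: less_Suc_eq)
  next
    case (4 t C) then show ?case unfolding hops_known_def by simp
  qed (use s in auto)
  then show ?thesis unfolding hops_def by simp
qed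

section \<open>Squares with equal opposite sides\<close>

definition real_input :: "nat \<Rightarrow> (nat \<Rightarrow> real) \<Rightarrow> bool" where
  "real_input k w \<longleftrightarrow> (\<forall>e<k. w e = edge_weight e)"

definition squares_known :: "store \<Rightarrow> bool" where
  "squares_known s \<longleftrightarrow> (\<forall>i<2 * m. \<forall>g<2 * m. tail i = tail g \<longrightarrow>
     (arr s a_square i (Suc g) = 0 \<longleftrightarrow> \<not> spans_square (tail i) (head i) (head g)))"

lemma squares:
  assumes s: "input_read s" "arcs_listed s" "\<And>i j. arr s a_square i j = 0" and w: "real_input m w"
  shows "squares_known (ev w squares s)"
proof -
  \<comment> \<open>All tests succeed for the opposite sides \<open>i\<close> and \<open>j\<close>,
    and \<open>x\<close> is the shifted number of the side from \<open>tail i\<close> to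
    \<open>tail j\<close>.\<close>
  define P where "P i j x \<longleftrightarrow> arr s a_arc (tail i) (tail j) = x \<and> x \<noteq> 0 \<and>
    arr s a_arc (head i) (head j) \<noteq> 0 \<and> tail i \<noteq> head j \<and> w (i div 2) = w (j div 2) \<and>
    w (arr s a_edge (arr s a_arc (tail i) (tail j)) 0) = w (arr s a_edge (arr s a_arc (head i) (head j)) 0)" for i j x
  let ?J = "\<lambda>i k t t'. \<forall>i' x. arr t' a_square i' x \<noteq> 0 \<longleftrightarrow>
    arr t a_square i' x \<noteq> 0 \<or> (i' = i \<and> (\<exists>j<k. P i j x))"
  let ?body = "When False (Eq (Arr a_arc tail_i tail_j) (Const 0)) (
     When False (Eq (Arr a_arc head_i head_j) (Const 0)) (
     When False (Eq tail_i head_j) (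
     When True (WeightEq (Arr1 a_edge (Inc (Var v_i))) (Arr1 a_edge (Inc (Var v_j)))) (
     When True (WeightEq (Arr1 a_edge (Arr a_arc tail_i tail_j)) (Arr1 a_edge (Arr a_arc head_i head_j))) (
       Store a_square (Var v_i) (Arr a_arc tail_i tail_j) (Const 1))))))"
  have inner: "?J i (2 * m) t (ev w (For v_j v_arcs ?body) t)"
    if t: "vars t v_i = i" "i < 2 * m" "vars t v_arcs = 2 * m" "\<And>a. a \<noteq> a_square \<Longrightarrow> arr t a = arr s a" for t i
  proof (rule For_rule[where N = "2 * m" and I = "\<lambda>k t'. ?J i k t t'"], goal_cases)
    case (3 k u)
    have f: "vars u v_i = i" "\<And>a. a \<noteq> a_square \<Longrightarrow> arr u a = arr s a"
      using 3(2)[of v_i] 3(3) t by simp_all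
    have a: "arr s a_tail i 0 = tail i" "arr s a_head i 0 = head i" "arr s a_tail k 0 = tail k"
      "arr s a_head k 0 = head k" "arr s a_edge (Suc i) 0 = i div 2" "arr s a_edge (Suc k) 0 = k div 2"
      using s(1) 3(1) t(2) unfolding input_read_def by auto
    have "arr (ev w ?body (set_var v_j k u)) a_square i' x \<noteq> 0 \<longleftrightarrow>
        arr u a_square i' x \<noteq> 0 \<or> (i' = i \<and> P i k x)" for i' x
      by (auto simp: f a P_def)
    then show ?case using 3(4) by (auto simp: less_Suc_eq)
  qed (use t in auto)
  have "\<forall>i x. arr (ev w squares s) a_square i x \<noteq> 0 \<longleftrightarrow> i < 2 * m \<and> (\<exists>j<2 * m. P i j x)"
    unfolding squares_def
  proof (rule For_rule[where N = "2 * m" and I = "\<lambda>k t. \<forall>i x. arr t a_square i x \<noteq> 0 \<longleftrightarrow> i < k \<and> (\<exists>j<2 * m. P i j x)"], goal_cases)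
    case 1 then show ?case using s unfolding input_read_def by blast
  next
    case 2 then show ?case using s by simp
  next
    case (3 k u)
    have "?J k (2 * m) (set_var v_i k u) (ev w (For v_j v_arcs ?body) (set_var v_i k u))"
      by (rule inner) (use 3 s in \<open>auto simp: input_read_def\<close>)
    then show ?case using 3(4) by (auto simp: less_Suc_eq)
  qed simp
  note res = this
  have E: "arr s a_arc (tail i) (head i) = Suc i" if "i < 2 * m" for i
    using s(2) that unfolding arcs_listed_def by blast
  have E0: "gadj G a b" if "arr s a_arc a b \<noteq> 0" for a b using s(2) that unfolding arcs_listed_def by blast
  have we: "w (arr s a_edge (Suc i) 0) = gweight G (tail i) (head i)" "w (i div 2) = gweight G (tail i) (head i)"
    if "i < 2 * m" for i
    using s(1) w arc_weight[OF that] that unfolding input_read_def real_input_def by auto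
  have eqv: "(\<exists>j<2 * m. P i j (Suc g)) \<longleftrightarrow> spans_square (tail i) (head i) (head g)"
    if ig: "i < 2 * m" "g < 2 * m" "tail i = tail g" for i g
  proof
    assume "\<exists>j<2 * m. P i j (Suc g)"
    then obtain j where j: "j < 2 * m" "P i j (Suc g)" by blast
    then have "gadj G (tail i) (tail j)" using E0[of "tail i" "tail j"] unfolding P_def by simp
    then obtain g' where g': "g' < 2 * m" "tail g' = tail i" "head g' = tail j" by (rule arc_ex)
    \<comment> \<open>The matrix entry of an arc is its own shifted number, so equal entries mean
      equal arcs.\<close>
    then have "g' = g" using E[of g'] j(2) unfolding P_def by simp
    then have tj: "tail j = head g" using g' by simp
    have "gadj G (head i) (head j)" using E0 j(2) unfolding P_def by blast
    then obtain h where h: "h < 2 * m" "tail h = head i" "head h = head j" by (rule arc_ex)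
    have Eh: "arr s a_arc (head i) (head j) = Suc h" using E[of h] h by simp
    have "gweight G (tail i) (head i) = gweight G (tail j) (head j)"
      "gweight G (tail g) (head g) = gweight G (tail h) (head h)" "tail i \<noteq> head j"
      using j we[OF ig(1)] we[OF ig(2)] we[OF j(1)] we[OF h(1)] Eh unfolding P_def by auto
    then show "spans_square (tail i) (head i) (head g)"
      unfolding spans_square_def using arc_adj[OF j(1)] arc_adj[OF h(1)] h tj ig(3) by metis
  next
    assume "spans_square (tail i) (head i) (head g)"
    then obtain c where c: "c \<noteq> tail i" "gadj G (head i) c" "gadj G (head g) c"
      "gweight G (tail i) (head i) = gweight G (head g) c" "gweight G (tail i) (head g) = gweight G (head i) c"
      unfolding spans_square_def by auto
    obtain j where j: "j < 2 * m" "tail j = head g" "head j = c" using arc_ex[OF c(3)] .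
    obtain h where h: "h < 2 * m" "tail h = head i" "head h = c" using arc_ex[OF c(2)] .
    have "arr s a_arc (tail i) (tail j) = Suc g" "arr s a_arc (head i) (head j) = Suc h"
      using E[OF ig(2)] E[OF h(1)] j h ig(3) by simp_all
    then have "P i j (Suc g)" unfolding P_def using we[OF ig(1)] we[OF ig(2)] we[OF j(1)] we[OF h(1)] c j h ig(3) by auto
    then show "\<exists>j<2 * m. P i j (Suc g)" using j by blast
  qed
  show ?thesis unfolding squares_known_def
  proof (intro allI impI)
    fix i g assume ig: "i < 2 * m" "g < 2 * m" "tail i = tail g"
    have "arr (ev w squares s) a_square i (Suc g) \<noteq> 0 \<longleftrightarrow> (\<exists>j<2 * m. P i j (Suc g))"
      using res ig(1) by blast
    then show "arr (ev w squares s) a_square i (Suc g) = 0 \<longleftrightarrow> \<not> spans_square (tail i) (head i) (head g)"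
      using eqv[OF ig] by blast
  qed
qed

section \<open>The finest compatible labelling\<close>

definition arc_related :: "nat \<Rightarrow> nat \<Rightarrow> bool" where
  "arc_related i j \<longleftrightarrow> related (tail i) (head i) (tail j) (head j)"

text \<open>The second clause says that the labels are the finest compatible ones.\<close>

definition labelled :: "nat \<Rightarrow> (nat \<Rightarrow> nat) \<Rightarrow> bool" where
  "labelled k L \<longleftrightarrow> (\<forall>i<k. \<forall>j<k. arc_related i j \<longrightarrow> L i = L j) \<and>
     (\<forall>col :: nat \<Rightarrow> nat \<Rightarrow> bool. compatible col \<longrightarrow> (\<forall>i<k. \<forall>j<k. L i = L j \<longrightarrow>
        col (tail i) (head i) = col (tail j) (head j))) \<and>
     (\<forall>i<k. L i < k \<and> L (L i) = L i)"

text \<open>Classes are merged as a whole, which preserves that a label is the number of an arc in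
  its own class. So each class is found later as exactly one fixed point of the labelling.\<close>

lemma labelled_Suc:
  assumes L: "labelled k L" and k: "k < 2 * m"
    and L': "\<And>i. i < k \<Longrightarrow> L' i = (if \<exists>j<k. L j = L i \<and> arc_related k j then k else L i)" "L' k = k"
  shows "labelled (Suc k) L'"
proof -
  let ?M = "\<lambda>i. \<exists>j<k. L j = L i \<and> arc_related k j"
  have IH1: "arc_related i j \<Longrightarrow> L i = L j" if "i < k" "j < k" for i j
    using L that unfolding labelled_def by blast
  have IH2: "L i = L j \<Longrightarrow> col (tail i) (head i) = col (tail j) (head j)" if "compatible col" "i < k" "j < k"
    for i j and col :: "nat \<Rightarrow> nat \<Rightarrow> bool" using L that unfolding labelled_def by blast
  have IH3: "L i < k" "L (L i) = L i" if "i < k" for i using L that unfolding labelled_def by auto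
  have sym: "arc_related i j \<Longrightarrow> arc_related j i" for i j unfolding arc_related_def by (rule related_sym)
  have "L' i = L' j" if ij: "i < Suc k" "j < Suc k" "arc_related i j" for i j
  proof -
    consider "i < k" "j < k" | "i = k" "j < k" | "i < k" "j = k" | "i = k" "j = k" using ij by linarith
    then show ?thesis
    proof cases
      case 1 show ?thesis unfolding L'(1)[OF 1(1)] L'(1)[OF 1(2)] IH1[OF 1 ij(3)] by (rule refl)
    next
      case 2 then show ?thesis using L' ij(3) by auto
    next
      case 3 then show ?thesis using L' sym[OF ij(3)] by auto
    qed simp
  qed
  moreover have "col (tail i) (head i) = col (tail j) (head j)"
    if col: "compatible col" and ij: "i < Suc k" "j < Suc k" "L' i = L' j" for i j and col :: "nat \<Rightarrow> nat \<Rightarrow> bool"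
  proof -
    have key: "col (tail i) (head i) = col (tail k) (head k)" if i: "i < Suc k" "L' i = k" for i
    proof (cases "i = k")
      case False
      then have "i < k" using i by simp
      then have "?M i" using i L'(1)[of i] IH3(1)[of i] by (auto split: if_splits)
      then obtain j where j: "j < k" "L j = L i" "arc_related k j" by blast
      have "col (tail k) (head k) = col (tail j) (head j)"
        using col j k arc_adj[of k] arc_adj[of j] unfolding compatible_def arc_related_def by simp
      then show ?thesis using IH2[OF col j(1) \<open>i < k\<close> j(2)] by simp
    qed simp
    show ?thesis
    proof (cases "L' i = k")
      case True then show ?thesis using key[OF ij(1)] key[OF ij(2)] ij(3) by simp
    next
      case False
      then have "i < k" "j < k" using ij L'(2) by (auto simp: less_Suc_eq)
      then show ?thesis using IH2[OF col] L'(1) ij(3) False by (metis (no_types, lifting))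
    qed
  qed
  moreover have "L' i < Suc k \<and> L' (L' i) = L' i" if "i < Suc k" for i
  proof (cases "L' i = k")
    case True then show ?thesis using L'(2) by simp
  next
    case False
    then have i: "i < k" using that L'(2) by (auto simp: less_Suc_eq)
    have nM: "\<not> ?M i"
    proof
      assume "?M i"
      then have "L' i = k" unfolding L'(1)[OF i] by (rule if_P)
      then show False using False by blast
    qed
    then have "L' i = L i" unfolding L'(1)[OF i] by (rule if_not_P)
    \<comment> \<open>\<open>L i\<close> is itself in the class of \<open>i\<close>, so the two are
      renamed together or not at all.\<close>
    moreover have "L' (L i) = L i" unfolding L'(1)[OF IH3(1)[OF i]] IH3(2)[OF i] using nM by (rule if_not_P)
    ultimately show ?thesis using IH3(1)[OF i] by simp
  qed
  ultimately show ?thesis unfolding labelled_def by blast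
qed

abbreviation lab_of :: "store \<Rightarrow> nat \<Rightarrow> nat" where
  "lab_of s i \<equiv> arr s a_lab i 0"

lemma mark_arc:
  assumes s: "input_read s" "hops_known s" "squares_known s" and ij: "vars s v_i = i" "vars s v_j = j" "j < i" "i < 2 * m"
  shows "arr (ev w mark_arc s) a_mark i' l =
    (if i' = i \<and> l = lab_of s j \<and> arc_related i j then 1 else arr s a_mark i' l)"
proof -
  have a: "arr s a_tail i 0 = tail i" "arr s a_head i 0 = head i" "arr s a_tail j 0 = tail j" "arr s a_head j 0 = head j"
    using s(1) ij unfolding input_read_def by auto
  have h: "arr s a_hop u v = Suc (hop u v)" if "u < n" "v < n" for u v
    using s(2) that unfolding hops_known_def by blast
  have n: "tail i < n" "head i < n" "tail j < n" "head j < n" using arc_less ij by auto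
  have ne: "head i \<noteq> head j" if "tail i = tail j" using arc_inj[of i j] ij that by auto
  have "arr s a_square i (Suc j) = 0 \<longleftrightarrow> \<not> spans_square (tail i) (head i) (head j)" if "tail i = tail j"
    using s(3) ij that unfolding squares_known_def by simp
  then have "arc_related i j \<longleftrightarrow> hop (tail i) (tail j) + hop (head i) (head j) \<noteq> hop (tail i) (head j) + hop (head i) (tail j)
      \<or> tail i = tail j \<and> arr s a_square i (Suc j) = 0"
    unfolding arc_related_def related_def theta_def using ne by blast
  \<comment> \<open>Both sides of the tested equation contain two distances shifted by one, so the
    shifts cancel.\<close>
  then show ?thesis unfolding mark_arc_def by (auto simp: ij a h n)
qed

lemma labels:
  assumes s: "input_read s" "hops_known s" "squares_known s" "\<And>i l. arr s a_mark i l = 0"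
  shows "labelled (2 * m) (lab_of (ev w labels s))"
  unfolding labels_def
proof (rule For_rule[where N = "2 * m" and I = "\<lambda>k t. labelled k (lab_of t) \<and> (\<forall>i\<ge>k. \<forall>l. arr t a_mark i l = 0)"], goal_cases)
  case 1 then show ?case using s unfolding input_read_def by blast
next
  case 2 then show ?case using s by (simp add: labelled_def)
next
  case (3 k t)
  let ?t1 = "set_arr a_lab k 0 k (set_var v_i k t)"
  let ?t2 = "ev w (For v_j v_i mark_arc) ?t1"
  let ?t3 = "ev w (For v_j v_i merge_arc) ?t2"
  have t1: "input_read ?t1" "hops_known ?t1" "squares_known ?t1"
    using s 3(2)[of v_n] 3(2)[of v_m] 3(2)[of v_arcs] 3(3)
    by (simp_all add: input_read_def hops_known_def squares_known_def mark_arc_def merge_arc_def)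
  have mark: "\<forall>i l. arr ?t2 a_mark i l =
      (if i = k \<and> (\<exists>j<k. lab_of ?t1 j = l \<and> arc_related k j) then 1 else arr t a_mark i l)"
  proof (rule For_rule[where N = k and I = "\<lambda>j u. \<forall>i l. arr u a_mark i l =
      (if i = k \<and> (\<exists>j'<j. lab_of ?t1 j' = l \<and> arc_related k j') then 1 else arr t a_mark i l)"], goal_cases)
    case (3 j u)
    have u: "input_read (set_var v_j j u)" "hops_known (set_var v_j j u)" "squares_known (set_var v_j j u)"
      using t1 3(2)[of v_n] 3(2)[of v_m] 3(2)[of v_arcs] 3(3)
      by (simp_all add: input_read_def hops_known_def squares_known_def mark_arc_def)
    have l: "lab_of (set_var v_j j u) = lab_of ?t1" using 3(3)[of a_lab] by (simp add: mark_arc_def)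
    have vi: "vars (set_var v_j j u) v_i = k" using 3(2)[of v_i] by (simp add: mark_arc_def)
    have vj: "vars (set_var v_j j u) v_j = j" by simp
    have lj: "lab_of (set_var v_j j u) j = lab_of ?t1 j" using l by metis
    have ar: "arr (set_var v_j j u) a_mark = arr u a_mark" by simp
    show ?case using mark_arc[OF u vi vj 3(1), of w] 3(4) \<open>k < 2 * m\<close>
      unfolding lj ar by (auto simp: less_Suc_eq)
  qed auto
  have a2: "arr ?t2 a_lab = arr ?t1 a_lab" by (rule arr_frame) (simp add: mark_arc_def)
  have "vars ?t2 v_i = vars ?t1 v_i" by (rule vars_frame) (simp add: mark_arc_def)
  then have vi2: "vars ?t2 v_i = k" by (simp del: ev.simps)
  have mark2: "arr ?t2 a_mark k l = (if \<exists>j<k. lab_of ?t1 j = l \<and> arc_related k j then 1 else 0)" for l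
  proof -
    have z: "arr t a_mark k l = 0" using 3(4) by simp
    show ?thesis unfolding mark[rule_format] z by (simp only: simp_thms refl)
  qed
  \<comment> \<open>A round of the second pass reads and writes only the label of its own arc, so
    every test still sees a label of the marking pass.\<close>
  have "\<forall>i. lab_of ?t3 i = (if i < k \<and> arr ?t2 a_mark k (lab_of ?t2 i) = 1 then k else lab_of ?t2 i)"
  proof (rule For_rule[where c = merge_arc and N = k and I = "\<lambda>j u. \<forall>i. lab_of u i =
      (if i < j \<and> arr ?t2 a_mark k (lab_of ?t2 i) = 1 then k else lab_of ?t2 i)"], goal_cases)
    case (3 j u)
    have "vars u v_i = vars ?t2 v_i" by (rule 3(2)) (simp add: merge_arc_def)
    then have f1: "vars u v_i = k" using vi2 by (rule trans)
    have f2: "arr u a_mark = arr ?t2 a_mark" by (rule 3(3)) (simp add: merge_arc_def)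
    note f = f1 f2
    have "lab_of (ev w merge_arc (set_var v_j j u)) i =
        (if i = j \<and> arr ?t2 a_mark k (lab_of u j) = 1 then k else lab_of u i)" for i
      by (simp add: merge_arc_def f del: ev.simps(6))
    then show ?case using 3(4) by (auto simp: less_Suc_eq)
  qed (use vi2 in \<open>auto simp del: ev.simps\<close>)
  note merged = this[unfolded mark2 a2, rule_format]
  have indicator: "(if Q then 1 else 0 :: nat) = 1 \<longleftrightarrow> Q" for Q by simp
  have lab3: "lab_of ?t3 i = (if i < k \<and> (\<exists>j<k. lab_of ?t1 j = lab_of ?t1 i \<and> arc_related k j) then k
      else lab_of ?t1 i)" for i
    using merged unfolding indicator .
  have "labelled (Suc k) (lab_of ?t3)"
  proof (rule labelled_Suc)
    show "labelled k (lab_of t)" "k < 2 * m" using 3 by auto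
    show "lab_of ?t3 k = k" unfolding lab3 by simp
    fix i assume "i < k"
    then show "lab_of ?t3 i = (if \<exists>j<k. lab_of t j = lab_of t i \<and> arc_related k j then k else lab_of t i)"
      unfolding lab3 by (auto simp: nat_less_le)
  qed
  moreover have "arr ?t3 a_mark = arr ?t2 a_mark" by (rule arr_frame) (simp add: merge_arc_def)
  then have "\<forall>i\<ge>Suc k. \<forall>l. arr ?t3 a_mark i l = 0" using mark 3(4) by simp
  moreover have "ev w (Store1 a_lab (Var v_i) (Var v_i) ;; For v_j v_i mark_arc ;; For v_j v_i merge_arc) (set_var v_i k t) = ?t3"
    by (simp only: ev.simps(3,4) aval.simps) simp
  ultimately show ?case by simp
next
  case (4 t) then show ?case by simp
qed

section \<open>Distance differences to the root\<close>

definition differing :: "(nat \<Rightarrow> nat) \<Rightarrow> nat \<Rightarrow> nat \<Rightarrow> nat set" where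
  "differing L k z = L ` {i. i < k \<and> hop z (tail i) + hop 0 (head i) \<noteq> hop z (head i) + hop 0 (tail i)}"

definition differences_known :: "store \<Rightarrow> bool" where
  "differences_known s \<longleftrightarrow> (\<forall>z<n. (\<forall>c. arr s a_diff c z = of_bool (c \<in> differing (lab_of s) (2 * m) z)) \<and>
     arr s a_ndiff z 0 = card (differing (lab_of s) (2 * m) z))"

lemma differences:
  assumes s: "input_read s" "hops_known s" "\<And>c z. arr s a_diff c z = 0" "\<And>z. arr s a_ndiff z 0 = 0"
  shows "differences_known (ev w differences s)"
proof -
  let ?L = "lab_of s"
  let ?body = "When False (SumEq (Arr a_hop (Var v_z) tail_i) (Arr a_hop (Const 0) head_i)
                       (Arr a_hop (Var v_z) head_i) (Arr a_hop (Const 0) tail_i)) (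
       When True (Eq (Arr a_diff (Arr1 a_lab (Var v_i)) (Var v_z)) (Const 0)) (
         Store a_diff (Arr1 a_lab (Var v_i)) (Var v_z) (Const 1) ;;
         Store1 a_ndiff (Var v_z) (Inc (Arr1 a_ndiff (Var v_z)))))"
  let ?ok = "\<lambda>k z t. (\<forall>c. arr t a_diff c z = of_bool (c \<in> differing ?L k z)) \<and>
     arr t a_ndiff z 0 = card (differing ?L k z)"
  have fin: "finite (differing ?L k z)" for k z unfolding differing_def by simp
  have SucD: "differing ?L (Suc k) z = (if hop z (tail k) + hop 0 (head k) \<noteq> hop z (head k) + hop 0 (tail k)
      then insert (?L k) (differing ?L k z) else differing ?L k z)" for k z
    unfolding differing_def by (auto simp: less_Suc_eq)
  have inner: "?ok (2 * m) z (ev w (For v_i v_arcs ?body) t) \<and>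
      (\<forall>z'. z' \<noteq> z \<longrightarrow> (\<forall>c. arr (ev w (For v_i v_arcs ?body) t) a_diff c z' = arr t a_diff c z') \<and>
        arr (ev w (For v_i v_arcs ?body) t) a_ndiff z' 0 = arr t a_ndiff z' 0)"
    if t: "vars t v_z = z" "z < n" "vars t v_arcs = 2 * m" "\<And>a. a \<noteq> a_diff \<Longrightarrow> a \<noteq> a_ndiff \<Longrightarrow> arr t a = arr s a"
      "\<And>c. arr t a_diff c z = 0" "arr t a_ndiff z 0 = 0" for t z
  proof (rule For_rule[where N = "2 * m" and I = "\<lambda>k t'. ?ok k z t' \<and> (\<forall>z'. z' \<noteq> z \<longrightarrow>
      (\<forall>c. arr t' a_diff c z' = arr t a_diff c z') \<and> arr t' a_ndiff z' 0 = arr t a_ndiff z' 0)"], goal_cases)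
    case 1 then show ?case using t by simp
  next
    case 2 then show ?case using t by (simp add: differing_def)
  next
    case (3 k u)
    have f: "vars u v_z = z" "\<And>a. a \<noteq> a_diff \<Longrightarrow> a \<noteq> a_ndiff \<Longrightarrow> arr u a = arr s a"
      using 3(2)[of v_z] 3(3) t by simp_all
    have a: "arr s a_tail k 0 = tail k" "arr s a_head k 0 = head k" using s(1) 3(1) unfolding input_read_def by auto
    have h: "arr s a_hop x y = Suc (hop x y)" if "x < n" "y < n" for x y
      using s(2) that unfolding hops_known_def by blast
    have u: "\<And>c. arr u a_diff c z = of_bool (c \<in> differing ?L k z)" "arr u a_ndiff z 0 = card (differing ?L k z)"
      using 3(4) by auto
    note n' = n_pos arc_less[OF 3(1)] t(2)
    show ?case
    proof (cases "hop z (tail k) + hop 0 (head k) \<noteq> hop z (head k) + hop 0 (tail k) \<and> ?L k \<notin> differing ?L k z")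
      case True
      then have "differing ?L (Suc k) z = insert (?L k) (differing ?L k z)"
        "card (differing ?L (Suc k) z) = Suc (card (differing ?L k z))" using SucD fin by auto
      then show ?thesis using True 3(4) by (simp add: f a h n' u)
    next
      case False
      then have "differing ?L (Suc k) z = differing ?L k z" using SucD by auto
      then show ?thesis using False 3(4) by (auto simp: f a h n' u)
    qed
  next
    case (4 u) then show ?case by simp
  qed
  have "\<forall>z<n. ?ok (2 * m) z (ev w differences s)"
    unfolding differences_def
  proof (rule For_rule[where N = n and I = "\<lambda>k t. (\<forall>z<k. ?ok (2 * m) z t) \<and>
      (\<forall>z\<ge>k. (\<forall>c. arr t a_diff c z = 0) \<and> arr t a_ndiff z 0 = 0)"], goal_cases)
    case 1 then show ?case using s unfolding input_read_def by blast
  next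
    case 2 then show ?case using s by simp
  next
    case (3 k u)
    let ?t = "set_var v_z k u"
    have "vars ?t v_arcs = 2 * m" using 3(2)[of v_arcs] s unfolding input_read_def by simp
    from inner[of ?t k, OF _ 3(1) this] 3(3,4)
    show ?case by (auto simp: less_Suc_eq simp del: ev.simps)
  next
    case (4 u) then show ?case by simp
  qed
  moreover have "arr (ev w differences s) a_lab = arr s a_lab"
    by (rule arr_frame) (simp add: differences_def)
  ultimately show ?thesis unfolding differences_known_def by simp
qed

end

section \<open>The factors\<close>

locale labelled_graph = presented_graph G n es
  for G :: "nat wgraph" and n and es :: "(nat \<times> nat \<times> real) list" +
  fixes L :: "nat \<Rightarrow> nat"
  assumes labelled: "labelled (2 * length es) L" and no_edges: "es = [] \<Longrightarrow> L 0 = 0"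
begin

definition arc_index :: "nat \<Rightarrow> nat \<Rightarrow> nat" where
  "arc_index a b = (THE i. i < 2 * m \<and> tail i = a \<and> head i = b)"

lemma arc_index: "i < 2 * m \<Longrightarrow> arc_index (tail i) (head i) = i"
  unfolding arc_index_def using arc_inj by (intro the_equality) auto

definition lab :: "nat \<Rightarrow> nat \<Rightarrow> nat" where
  "lab a b = L (arc_index a b)"

lemma lab: "i < 2 * m \<Longrightarrow> lab (tail i) (head i) = L i"
  by (simp add: lab_def arc_index)

lemma labelled_related: "i < 2 * m \<Longrightarrow> j < 2 * m \<Longrightarrow> related (tail i) (head i) (tail j) (head j) \<Longrightarrow> L i = L j"
  using labelled unfolding labelled_def arc_related_def by blast

lemma labelled_finest:
  fixes col :: "nat \<Rightarrow> nat \<Rightarrow> bool"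
  shows "compatible col \<Longrightarrow> i < 2 * m \<Longrightarrow> j < 2 * m \<Longrightarrow> L i = L j \<Longrightarrow>
    col (tail i) (head i) = col (tail j) (head j)"
  using labelled unfolding labelled_def by blast

lemma labelled_fix: "i < 2 * m \<Longrightarrow> L i < 2 * m" "i < 2 * m \<Longrightarrow> L (L i) = L i"
  using labelled unfolding labelled_def by blast+

sublocale rooted_coloured_graph "{..<n}" "gadj G" "gweight G" lab 0
proof
  show "compatible lab"
    unfolding compatible_def
  proof (intro allI impI)
    fix a b x y assume *: "gadj G a b" "gadj G x y" "related a b x y"
    obtain i where "i < 2 * m" "tail i = a" "head i = b" using arc_ex[OF *(1)] .
    moreover obtain j where "j < 2 * m" "tail j = x" "head j = y" using arc_ex[OF *(2)] .
    ultimately show "lab a b = lab x y" using labelled_related[of i j] *(3) lab by metis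
  qed
qed (use n_pos in simp)

definition label_bound :: nat where
  "label_bound = (if m = 0 then 1 else 2 * m)"

definition label_list :: "nat list" where
  "label_list = filter (\<lambda>c. L c = c) [0..<label_bound]"

lemma label_list: assumes "m \<noteq> 0" shows "set label_list = L ` {..<2 * m}"
proof -
  have "set label_list = {c. c < 2 * m \<and> L c = c}" using assms by (auto simp: label_list_def label_bound_def)
  also have "\<dots> = L ` {..<2 * m}"
  proof (intro equalityI subsetI)
    fix c assume "c \<in> {c. c < 2 * m \<and> L c = c}"
    then show "c \<in> L ` {..<2 * m}" by (intro image_eqI[of _ _ c]) auto
  qed (use labelled_fix in auto)
  finally show ?thesis .
qed

lemma label_list_trivial: "m = 0 \<Longrightarrow> label_list = [0]"
  unfolding label_list_def label_bound_def using no_edges by simp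

text \<open>\<open>differing\<close> collects the colours of the coordinates in which
  \<open>z\<close> differs from the root 0, and a vertex of the fibre differs from it at most in
  coordinate \<open>c\<close>.\<close>

lemma fibre_eq: "fibre c = {z. z < n \<and> differing L (2 * m) z \<subseteq> {c}}"
proof -
  have "(\<forall>a b. gadj G a b \<longrightarrow> lab a b \<noteq> c \<longrightarrow> hop 0 a + hop z b = hop 0 b + hop z a) \<longleftrightarrow>
      (\<forall>i<2 * m. L i \<noteq> c \<longrightarrow> hop z (tail i) + hop 0 (head i) = hop z (head i) + hop 0 (tail i))" (is "?A \<longleftrightarrow> ?B") for z
  proof
    assume ?A
    show ?B
    proof (intro allI impI)
      fix i assume i: "i < 2 * m" "L i \<noteq> c"
      then have "hop 0 (tail i) + hop z (head i) = hop 0 (head i) + hop z (tail i)"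
        using \<open>?A\<close> arc_adj[of i] lab[of i] by simp
      then show "hop z (tail i) + hop 0 (head i) = hop z (head i) + hop 0 (tail i)" by simp
    qed
  next
    assume B: ?B
    show ?A
    proof (intro allI impI)
      fix a b assume ab: "gadj G a b" "lab a b \<noteq> c"
      obtain i where i: "i < 2 * m" "tail i = a" "head i = b" using arc_ex[OF ab(1)] .
      then have "L i \<noteq> c" using lab[of i] ab by simp
      then have "hop z (tail i) + hop 0 (head i) = hop z (head i) + hop 0 (tail i)" using B i by blast
      then show "hop 0 a + hop z b = hop 0 b + hop z a" using i by simp
    qed
  qed
  then show ?thesis unfolding differing_def set_eq_iff fibre_iff_hop by (auto simp: image_subset_iff)
qed

text \<open>The rank of a vertex within its fibre. As the fibre lies below \<open>n\<close>, the
  value \<open>number c n\<close> is its size.\<close>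

definition number :: "nat \<Rightarrow> nat \<Rightarrow> nat" where
  "number c z = card {z'. z' < z \<and> z' \<in> fibre c}"

definition fibre_edges :: "nat \<Rightarrow> nat list" where
  "fibre_edges c = filter (\<lambda>e. edge_fst e \<in> fibre c \<and> edge_snd e \<in> fibre c) [0..<m]"

definition factor_code :: "nat \<Rightarrow> graph_code" where
  "factor_code c = (number c n,
     map (\<lambda>e. (number c (edge_fst e), number c (edge_snd e), edge_weight e)) (fibre_edges c))"

definition factor :: "nat \<Rightarrow> nat wgraph" where
  "factor c = \<lparr>verts = {..<number c n},
     edges = {{number c u, number c v} | u v. u \<in> fibre c \<and> v \<in> fibre c \<and> gadj G u v},
     weight = (\<lambda>X. weight G (inv_into (fibre c) (number c) ` X))\<rparr>"

lemma number_Suc: "number c (Suc z) = (if z \<in> fibre c then Suc (number c z) else number c z)"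
proof -
  have "{z'. z' < Suc z \<and> z' \<in> fibre c} =
      (if z \<in> fibre c then insert z {z'. z' < z \<and> z' \<in> fibre c} else {z'. z' < z \<and> z' \<in> fibre c})"
    by (auto simp: less_Suc_eq)
  then show ?thesis unfolding number_def by simp
qed

lemma number_bij: "bij_betw (number c) (fibre c) {..<number c n}"
proof -
  have less: "number c z < number c z'" if "z < z'" "z \<in> fibre c" for z z'
    unfolding number_def using that by (intro psubset_card_mono) auto
  have inj: "inj_on (number c) (fibre c)"
  proof (rule inj_onI)
    fix x y assume "x \<in> fibre c" "y \<in> fibre c" "number c x = number c y"
    then show "x = y" using less[of x y] less[of y x] by (cases x y rule: linorder_cases) auto
  qed
  have "{z. z < n \<and> z \<in> fibre c} = fibre c" using fibre_V by auto
  then have card: "number c n = card (fibre c)" unfolding number_def by (rule arg_cong)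
  have "number c z < number c n" if "z \<in> fibre c" for z
    using less[of z n] fibre_V[of z c] that by simp
  then have "number c ` fibre c \<subseteq> {..<number c n}" by auto
  moreover have "card (number c ` fibre c) = number c n"
    unfolding card by (rule card_image[OF inj])
  ultimately have "number c ` fibre c = {..<number c n}" by (intro card_subset_eq) auto
  then show ?thesis using inj unfolding bij_betw_def by blast
qed

lemma factor_weight:
  assumes "u \<in> fibre c" "v \<in> fibre c" shows "weight (factor c) {number c u, number c v} = gweight G u v"
  using assms number_bij[of c] by (simp add: factor_def gweight_def bij_betw_def)

lemma induces_factor: "induces c (number c) (factor c)"
proof (rule inducesI)
  show "bij_betw (number c) (fibre c) (verts (factor c))" using number_bij by (simp add: factor_def)
  show "gweight G u v > 0" if "gadj G u v" for u v
    using G that unfolding weighted_graph_def gadj_def gweight_def by blast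
qed (use factor_weight in \<open>auto simp: factor_def\<close>)

lemma presents_factor: "presents (factor_code c) (factor c)"
proof -
  let ?f = "\<lambda>e. {number c (edge_fst e), number c (edge_snd e)}"
  have inj: "inj_on (number c) (fibre c)" using number_bij by (simp add: bij_betw_def)
  have es: "e < m \<and> edge_fst e \<in> fibre c \<and> edge_snd e \<in> fibre c" if "e \<in> set (fibre_edges c)" for e
    using that by (simp add: fibre_edges_def)
  have "inj_on ?f (set (fibre_edges c))"
  proof (rule inj_onI)
    fix e e' assume e: "e \<in> set (fibre_edges c)" "e' \<in> set (fibre_edges c)" "?f e = ?f e'"
    then have "number c ` {edge_fst e, edge_snd e} = number c ` {edge_fst e', edge_snd e'}" by simp
    then have "{edge_fst e, edge_snd e} = {edge_fst e', edge_snd e'}"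
      using inj_on_image_eq_iff[OF inj, of "{edge_fst e, edge_snd e}" "{edge_fst e', edge_snd e'}"]
        es[OF e(1)] es[OF e(2)] by simp
    then show "e = e'" using edge_inj[of e e'] es[OF e(1)] es[OF e(2)] by simp
  qed
  then have "distinct (map ?f (fibre_edges c))" by (simp add: distinct_map fibre_edges_def)
  moreover have "edges (factor c) = set (map ?f (fibre_edges c))"
  proof -
    have A: "\<exists>e\<in>set (fibre_edges c). {number c u, number c v} = ?f e"
      if uv: "u \<in> fibre c" "v \<in> fibre c" "gadj G u v" for u v
    proof -
      obtain e where e: "e < m" "{u, v} = {edge_fst e, edge_snd e}" using uv unfolding gadj_def edges_eq by auto
      then have "e \<in> set (fibre_edges c)" using uv by (auto simp: fibre_edges_def doubleton_eq_iff)
      moreover have "{number c u, number c v} = ?f e" using e(2) by (auto simp: doubleton_eq_iff)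
      ultimately show ?thesis by blast
    qed
    have "?f e \<in> edges (factor c)" if "e \<in> set (fibre_edges c)" for e
      using es[OF that] edge_adj[of e] by (auto simp: factor_def)
    then have "set (map ?f (fibre_edges c)) \<subseteq> edges (factor c)" by auto
    moreover have "edges (factor c) \<subseteq> set (map ?f (fibre_edges c))"
    proof
      fix X assume "X \<in> edges (factor c)"
      then obtain u v where X: "X = {number c u, number c v}" "u \<in> fibre c" "v \<in> fibre c" "gadj G u v"
        by (auto simp: factor_def)
      then obtain e where "e \<in> set (fibre_edges c)" "X = ?f e" using A by metis
      then show "X \<in> set (map ?f (fibre_edges c))" by (simp del: insert_iff)
    qed
    ultimately show ?thesis by blast
  qed
  moreover have "weight (factor c) (?f e) = edge_weight e" if "e \<in> set (fibre_edges c)" for e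
    using es[OF that] factor_weight edge_weight by simp
  ultimately show ?thesis by (simp add: factor_code_def comp_def) (simp add: factor_def)
qed

lemma factorization_factors: "factorization (map factor label_list) G"
  unfolding factorization_def
proof (intro conjI ballI impI)
  show "map factor label_list \<noteq> []"
    using label_list label_list_trivial by (cases "m = 0") (auto simp: lessThan_empty_iff)
  show "weighted_graph H" if "H \<in> set (map factor label_list)" for H
    using that induces_factor unfolding induces_def by auto
  show "graph_iso G (cart_prod (map factor label_list))"
  proof (rule iso_cart_prod[where cs = label_list and \<iota> = "\<lambda>i. number (label_list ! i)"])
    show "distinct label_list" by (simp add: label_list_def)
    show "lab a b \<in> set label_list" if ab: "gadj G a b" for a b
    proof -
      obtain i where "i < 2 * m" "tail i = a" "head i = b" using arc_ex[OF ab] .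
      then show ?thesis using lab[of i] label_list by (cases "m = 0") auto
    qed
  qed (use induces_factor verts in auto)
  show "\<not> is_K1 H" if G1: "\<not> is_K1 G" and H: "H \<in> set (map factor label_list)" for H
  proof -
    have "m \<noteq> 0" using G1 trivial verts unfolding is_K1_def by auto
    then obtain i where i: "i < 2 * m" "H = factor (L i)" using H label_list by auto
    then show ?thesis using induces_not_K1[OF induces_factor arc_adj[OF i(1)] lab[OF i(1)]] by simp
  qed
qed

lemma prime_factor: "prime_graph (factor c)"
proof (rule prime_induced[OF induces_factor])
  fix col :: "nat \<Rightarrow> nat \<Rightarrow> bool" and a b x y
  assume *: "compatible col" "gadj G a b" "gadj G x y" "lab a b = c" "lab x y = c"
  obtain i where "i < 2 * m" "tail i = a" "head i = b" using arc_ex[OF *(2)] .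
  moreover obtain j where "j < 2 * m" "tail j = x" "head j = y" using arc_ex[OF *(3)] .
  ultimately show "col a b = col x y" using labelled_finest[OF *(1), of i j] lab *(4,5) by metis
qed

section \<open>Output of the factors\<close>

definition ready :: "store \<Rightarrow> bool" where
  "ready s \<longleftrightarrow> input_read s \<and> differences_known s \<and> lab_of s = L"

lemma ready_frame:
  assumes "ready s" "{v_n, v_m, v_arcs} \<inter> assigned c = {}"
    "{a_tail, a_head, a_edge, a_fst, a_snd, a_diff, a_ndiff, a_lab} \<inter> stored c = {}"
  shows "ready (ev w c s)"
  using assms input_read_frame[of s c w] unfolding ready_def differences_known_def by (simp add: arr_frame)

lemma ready_cong:
  assumes "ready s" "\<And>v. v \<in> {v_n, v_m, v_arcs} \<Longrightarrow> vars t v = vars s v"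
    "\<And>a. a \<in> {a_tail, a_head, a_edge, a_fst, a_snd, a_diff, a_ndiff, a_lab} \<Longrightarrow> arr t a = arr s a"
  shows "ready t"
  using assms unfolding ready_def differences_known_def input_read_def by simp

lemma in_fibre:
  assumes "ready s" "vars s v_c = c" "aval e s = z" "z < n"
  shows "holds w (in_fibre e) s \<longleftrightarrow> z \<in> fibre c"
proof -
  let ?S = "differing L (2 * m) z"
  have "finite ?S" unfolding differing_def by simp
  then have "card ?S = of_bool (c \<in> ?S) \<longleftrightarrow> ?S \<subseteq> {c}"
    by (auto simp: card_1_singleton_iff)
  moreover have "holds w (in_fibre e) s \<longleftrightarrow> card ?S = of_bool (c \<in> ?S)"
    using assms unfolding ready_def differences_known_def by simp
  ultimately show ?thesis using assms(4) fibre_eq by simp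
qed

lemma number_vertices:
  assumes s: "ready s" "vars s v_c = c"
  shows "(\<forall>z\<in>fibre c. arr (ev w number_vertices s) a_id c z = number c z) \<and>
    outs (ev w number_vertices s) = outs s @ [number c n] \<and> routs (ev w number_vertices s) = routs s"
proof -
  let ?body = "When True (in_fibre (Var v_z)) (
       Store a_id (Var v_c) (Var v_z) (Var v_t) ;; Assign v_t (Inc (Var v_t)))"
  let ?s = "set_var v_t 0 s"
  let ?P = "\<lambda>k t. vars t v_t = number c k \<and> (\<forall>z<k. z \<in> fibre c \<longrightarrow> arr t a_id c z = number c z) \<and>
      outs t = outs s \<and> routs t = routs s"
  have "?P n (ev w (For v_z v_n ?body) ?s)"
  proof (rule For_rule[where N = n and I = ?P], goal_cases)
    case 1 then show ?case using s unfolding ready_def input_read_def by simp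
  next
    case 2 then show ?case by (simp add: number_def)
  next
    case (3 k t)
    let ?t = "set_var v_z k t"
    have "ready ?t" by (rule ready_cong[OF s(1)]) (use 3(2,3) in auto)
    moreover have vc: "vars ?t v_c = c" using 3(2)[of v_c] s by simp
    ultimately have "holds w (in_fibre (Var v_z)) ?t \<longleftrightarrow> k \<in> fibre c"
      using in_fibre[of ?t c "Var v_z" k w] 3(1) by simp
    then show ?case using 3(4) vc by (auto simp: number_Suc less_Suc_eq simp del: holds.simps)
  next
    case (4 t) then show ?case by simp
  qed
  then show ?thesis unfolding number_vertices_def ev.simps(2,4,7) using fibre_V by simp
qed

lemma fibre_edge_loop:
  assumes s: "ready s" "vars s v_c = c" and P0: "P 0 s"
    and c: "assigned body \<inter> {v_n, v_m, v_arcs, v_c, v_e} = {}"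
      "stored body = {}"
    and step: "\<And>e t. e < m \<Longrightarrow> ready t \<Longrightarrow> vars t v_c = c \<Longrightarrow> vars t v_e = e \<Longrightarrow> arr t a_id = arr s a_id \<Longrightarrow>
      edge_fst e \<in> fibre c \<Longrightarrow> edge_snd e \<in> fibre c \<Longrightarrow> P e t \<Longrightarrow> P (Suc e) (ev w body t)"
    and skip: "\<And>e t. e < m \<Longrightarrow> \<not> (edge_fst e \<in> fibre c \<and> edge_snd e \<in> fibre c) \<Longrightarrow> P e t \<Longrightarrow> P (Suc e) t"
    and ins: "\<And>k e t. P k t \<Longrightarrow> P k (set_var v_e e t)"
  shows "P m (ev w (on_fibre_edges body) s)"
proof (rule For_rule[where N = m and I = P], goal_cases)
  case 1 then show ?case using s unfolding ready_def input_read_def by simp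
next
  case 2 then show ?case by (rule P0)
next
  case (3 e t)
  let ?t = "set_var v_e e t"
  have r: "ready ?t" by (rule ready_cong[OF s(1)]) (use 3(2,3) c in auto)
  have vc: "vars ?t v_c = c" using 3(2)[of v_c] s c by auto
  have id: "arr ?t a_id = arr s a_id" using 3(3)[of a_id] c by simp
  have ends: "aval (Arr1 a_fst (Var v_e)) ?t = edge_fst e" "aval (Arr1 a_snd (Var v_e)) ?t = edge_snd e"
    using r 3(1) unfolding ready_def input_read_def by auto
  have le: "edge_fst e < n" "edge_snd e < n" using edge_adj[OF 3(1)] adj_V adj_V' by auto
  note h = in_fibre[OF r vc ends(1) le(1), of w] in_fibre[OF r vc ends(2) le(2), of w]
  show ?case
    unfolding ev.simps(5) h
    using step[OF 3(1) r vc _ id] skip[OF 3(1)] ins[OF 3(4)] by auto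
next
  case (4 t) then show ?case using ins by blast
qed

lemma count_edges:
  assumes s: "ready s" "vars s v_c = c"
  shows "outs (ev w count_edges s) = outs s @ [length (fibre_edges c)] \<and> routs (ev w count_edges s) = routs s"
proof -
  let ?s = "set_var v_t 0 s"
  let ?P = "\<lambda>k t. vars t v_t = length (filter (\<lambda>e. edge_fst e \<in> fibre c \<and> edge_snd e \<in> fibre c) [0..<k]) \<and>
    outs t = outs s \<and> routs t = routs s"
  have "?P m (ev w (on_fibre_edges (Assign v_t (Inc (Var v_t)))) ?s)"
  proof (rule fibre_edge_loop[where P = ?P])
    show "ready ?s" by (rule ready_cong[OF s(1)]) auto
  qed (use s in auto)
  then show ?thesis unfolding count_edges_def ev.simps(2,4,7) fibre_edges_def by simp
qed

lemma write_edges: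
  assumes s: "ready s" "vars s v_c = c" "\<forall>z\<in>fibre c. arr s a_id c z = number c z"
  shows "outs (ev w write_edges s) = outs s @
      concat (map (\<lambda>e. [number c (edge_fst e), number c (edge_snd e)]) (fibre_edges c)) \<and>
    routs (ev w write_edges s) = routs s @ fibre_edges c"
proof -
  let ?es = "\<lambda>k. filter (\<lambda>e. edge_fst e \<in> fibre c \<and> edge_snd e \<in> fibre c) [0..<k]"
  let ?P = "\<lambda>k t. outs t = outs s @ concat (map (\<lambda>e. [number c (edge_fst e), number c (edge_snd e)]) (?es k)) \<and>
    routs t = routs s @ ?es k"
  have "?P m (ev w write_edges s)"
    unfolding write_edges_def
  proof (rule fibre_edge_loop[where P = ?P, OF s(1,2)], goal_cases)
    case (4 e t)
    then have "arr t a_fst e 0 = edge_fst e" "arr t a_snd e 0 = edge_snd e"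
      unfolding ready_def input_read_def by auto
    then show ?case using 4 s(3) by simp
  qed auto
  then show ?thesis by (simp add: fibre_edges_def)
qed

lemma graph_nats_factor: "graph_nats (factor_code c) = number c n # length (fibre_edges c) #
    concat (map (\<lambda>e. [number c (edge_fst e), number c (edge_snd e)]) (fibre_edges c))"
  by (simp add: factor_code_def comp_def)

lemma write_factors:
  assumes s: "ready s" "vars s v_labels = label_bound"
  shows "outs (ev w write_factors s) = outs s @ concat (map (\<lambda>c. graph_nats (factor_code c)) label_list) \<and>
    routs (ev w write_factors s) = routs s @ concat (map fibre_edges label_list)"
proof -
  let ?body = "number_vertices ;; count_edges ;; write_edges"
  let ?P = "\<lambda>k t. outs t = outs s @ concat (map (\<lambda>c. graph_nats (factor_code c)) (filter (\<lambda>c. L c = c) [0..<k])) \<and>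
    routs t = routs s @ concat (map fibre_edges (filter (\<lambda>c. L c = c) [0..<k]))"
  have "?P label_bound (ev w write_factors s)"
    unfolding write_factors_def
  proof (rule For_rule[where N = label_bound and I = ?P], goal_cases)
    case (3 c t)
    let ?t = "set_var v_c c t"
    have r: "ready ?t" by (rule ready_cong[OF s(1)]) (use 3(2,3) in \<open>auto simp: number_vertices_def count_edges_def write_edges_def\<close>)
    have vc: "vars ?t v_c = c" by simp
    let ?t1 = "ev w number_vertices ?t" and ?t2 = "ev w count_edges (ev w number_vertices ?t)"
    have r1: "ready ?t1" by (rule ready_frame[OF r]) (auto simp: number_vertices_def)
    have r2: "ready ?t2" by (rule ready_frame[OF r1]) (auto simp: count_edges_def)
    have c1: "vars ?t1 v_c = c" by (subst vars_frame) (auto simp: number_vertices_def)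
    have c2: "vars ?t2 v_c = c" by (subst vars_frame) (auto simp: count_edges_def c1)
    have i2: "arr ?t2 a_id = arr ?t1 a_id" by (rule arr_frame) (auto simp: count_edges_def)
    have lab: "holds w is_label ?t \<longleftrightarrow> L c = c"
      using r unfolding ready_def by (auto simp: fun_eq_iff)
    show ?case
    proof (cases "L c = c")
      case False then show ?thesis using 3(4) lab by (simp del: holds.simps)
    next
      case True
      have n1: "\<forall>z\<in>fibre c. arr ?t1 a_id c z = number c z" "outs ?t1 = outs ?t @ [number c n]" "routs ?t1 = routs ?t"
        using number_vertices[OF r vc, of w] by blast+
      have n2: "outs ?t2 = outs ?t1 @ [length (fibre_edges c)]" "routs ?t2 = routs ?t1"
        using count_edges[OF r1 c1, of w] by blast+
      have n3: "outs (ev w write_edges ?t2) = outs ?t2 @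
        concat (map (\<lambda>e. [number c (edge_fst e), number c (edge_snd e)]) (fibre_edges c))"
        "routs (ev w write_edges ?t2) = routs ?t2 @ fibre_edges c"
        using write_edges[OF r2 c2, of w] n1(1) unfolding i2 by blast+
      have e: "ev w (When True is_label ?body) ?t = ev w write_edges ?t2"
        unfolding ev.simps(4,5) using lab True by simp
      show ?thesis unfolding e n3 n2 n1 using 3(4) True by (simp add: graph_nats_factor del: graph_nats.simps)
    qed
  qed (use s in auto)
  then show ?thesis by (simp add: label_list_def)
qed

lemma count_labels:
  assumes s: "ready s"
  shows "ready (ev w count_labels s)" "vars (ev w count_labels s) v_labels = label_bound"
    "outs (ev w count_labels s) = outs s @ [length label_list]" "routs (ev w count_labels s) = routs s"
proof -
  let ?init = "Assign v_labels (Var v_arcs) ;; When True (Eq (Var v_m) (Const 0)) (Assign v_labels (Const 1)) ;;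
     Assign v_count (Const 0)"
  let ?loop = "For v_c v_labels (When True is_label (Assign v_count (Inc (Var v_count))))"
  let ?s = "ev w ?init s"
  have b: "vars ?s v_labels = label_bound" "vars ?s v_count = 0" "arr ?s = arr s" "outs ?s = outs s" "routs ?s = routs s"
    using s unfolding ready_def input_read_def label_bound_def by auto
  let ?P = "\<lambda>k t. vars t v_count = length (filter (\<lambda>c. L c = c) [0..<k]) \<and> outs t = outs s \<and> routs t = routs s"
  have loop: "?P label_bound (ev w ?loop ?s)"
  proof (rule For_rule[where N = label_bound and I = ?P and s = ?s], goal_cases)
    case 1 show ?case by (rule b(1))
  next
    case 2 show ?case using b by (simp del: ev.simps)
  next
    case (3 c t)
    have "arr t a_lab = arr ?s a_lab" by (rule 3(3)) simp
    then have "lab_of t = L" using s b(3) unfolding ready_def by simp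
    then have "arr t a_lab c 0 = L c" by (simp add: fun_eq_iff)
    then show ?case using 3(4) by simp
  next
    case (4 t) then show ?case by simp
  qed
  have e: "ev w count_labels s = ev w (Out (Var v_count)) (ev w ?loop ?s)"
    unfolding count_labels_def ev.simps(4) by simp
  show "ready (ev w count_labels s)" by (rule ready_frame[OF s]) (auto simp: count_labels_def)
  have "vars (ev w ?loop ?s) v_labels = vars ?s v_labels" by (rule vars_frame) simp
  then show "vars (ev w count_labels s) v_labels = label_bound" unfolding e using b by simp
  show "outs (ev w count_labels s) = outs s @ [length label_list]" "routs (ev w count_labels s) = routs s"
    unfolding e using loop by (simp_all add: label_list_def)
qed

lemma output_factors:
  assumes s: "ready s" "outs s = []" "routs s = []" and w: "real_input m w"
  shows "(outs (ev w write_factors (ev w count_labels s)), map w (routs (ev w write_factors (ev w count_labels s)))) =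
    family_output (map factor_code label_list)"
proof -
  note c = count_labels[OF s(1), of w]
  note f = write_factors[OF c(1,2), of w]
  \<comment> \<open>The weight of edge \<open>e\<close> is in real cell \<open>e\<close>, so the
    edge numbers themselves are the addresses collected by \<open>ROut\<close>.\<close>
  have "map w (fibre_edges c) = graph_reals (factor_code c)" for c
    using w by (auto simp: factor_code_def fibre_edges_def real_input_def comp_def)
  then have "map w (concat (map fibre_edges label_list)) = concat (map graph_reals (map factor_code label_list))"
    by (simp add: map_concat comp_def)
  then show ?thesis using f c s unfolding family_output_def by (simp add: comp_def)
qed

end

section \<open>Running time\<close>

primrec nesting :: "com \<Rightarrow> nat" where
  "nesting Skip = 0"
| "nesting (Assign x e) = 0"
| "nesting (Store a i j e) = 0"
| "nesting (c1 ;; c2) = max (nesting c1) (nesting c2)"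
| "nesting (When b q c) = nesting c"
| "nesting (For x y c) = Suc (nesting c)"
| "nesting (Out e) = 0"
| "nesting (ROut e) = 0"

text \<open>With one common limit \<open>B\<close>, \<open>max_cost\<close> is a polynomial in
  \<open>B\<close> with nonnegative coefficients and of degree at most \<open>nesting c\<close>; its
  value at 1 is the sum of the coefficients.\<close>

lemma max_cost_power:
  assumes B: "1 \<le> B" shows "max_cost (\<lambda>_. B) c \<le> max_cost (\<lambda>_. 1) c * B ^ nesting c"
proof (induction c)
  case (Seq c1 c2)
  have p: "B ^ nesting c1 \<le> B ^ nesting (c1 ;; c2)" "B ^ nesting c2 \<le> B ^ nesting (c1 ;; c2)"
    using B by (intro power_increasing; simp)+
  have "max_cost (\<lambda>_. B) c1 \<le> max_cost (\<lambda>_. 1) c1 * B ^ nesting (c1 ;; c2)"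
    "max_cost (\<lambda>_. B) c2 \<le> max_cost (\<lambda>_. 1) c2 * B ^ nesting (c1 ;; c2)"
    using Seq p by (meson le_trans mult_le_mono2)+
  then show ?case by (simp add: distrib_right del: nesting.simps)
next
  case (When b q c)
  have "ccost q \<le> ccost q * B ^ nesting c" using B by simp
  then show ?case unfolding nesting.simps max_cost.simps distrib_right using When by (rule add_mono)
next
  case (For x y c)
  have "1 \<le> B ^ nesting c" using B by simp
  then have p: "1 \<le> B ^ nesting (For x y c)" "B \<le> B ^ nesting (For x y c)" using B by auto
  have "max_cost (\<lambda>_. B) (For x y c) = 2 + (B * max_cost (\<lambda>_. B) c + 4 * B)" by (simp add: algebra_simps)
  also have "\<dots> \<le> 2 * B ^ nesting (For x y c) + (B * (max_cost (\<lambda>_. 1) c * B ^ nesting c) + 4 * B ^ nesting (For x y c))"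
    using p For by (intro add_mono mult_le_mono) auto
  also have "\<dots> = max_cost (\<lambda>_. 1) (For x y c) * B ^ nesting (For x y c)" by (simp add: algebra_simps)
  finally show ?case .
qed (use B in auto)

text \<open>This serves all phases but \<open>hops\<close>, whose three nested loops would give a
  cubic bound and which is handled by summing degrees.\<close>

lemma phase_cost:
  assumes "limits_ok Y (\<lambda>_. B) c" "\<And>y. y \<in> Y \<Longrightarrow> vars s y \<le> B" "nesting c \<le> 2" "1 \<le> B"
  shows "cost w c s \<le> max_cost (\<lambda>_. 1) c * B\<^sup>2"
proof -
  have "cost w c s \<le> max_cost (\<lambda>_. B) c" using limits_cost[OF assms(1,2)] by blast
  also have "\<dots> \<le> max_cost (\<lambda>_. 1) c * B ^ nesting c" using max_cost_power assms by blast
  also have "\<dots> \<le> max_cost (\<lambda>_. 1) c * B\<^sup>2" using assms by (intro mult_le_mono2 power_increasing)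
  finally show ?thesis .
qed

definition phases_cost :: nat where
  "phases_cost = max_cost (\<lambda>_. 1) read_edges + max_cost (\<lambda>_. 1) list_arcs + max_cost (\<lambda>_. 1) squares +
     max_cost (\<lambda>_. 1) labels + max_cost (\<lambda>_. 1) differences + max_cost (\<lambda>_. 1) count_labels +
     max_cost (\<lambda>_. 1) write_factors"

text \<open>The factor 4 comes from the common loop limit \<open>2 * (m + 1)\<close>, which enters
  squared; the other terms are the cost of \<open>hops\<close>.\<close>

definition cost_factor :: nat where
  "cost_factor = 4 * phases_cost + 168 + 2 * max_cost (\<lambda>_. 0) visit"

context presented_graph
begin

lemma factorize:
  assumes w: "real_input m w"
  defines "s0 \<equiv> init_store cell_in"
  shows "\<exists>L. labelled_graph G n es L \<and>
      (outs (ev w factorize s0), map w (routs (ev w factorize s0))) =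
        family_output (map (labelled_graph.factor_code G n es L) (labelled_graph.label_list es L))"
    and "cost w factorize s0 \<le> cost_factor * (m + 1)\<^sup>2"
proof -
  define s1 where "s1 = ev w read_edges s0"
  define s2 where "s2 = ev w list_arcs s1"
  define s3 where "s3 = ev w hops s2"
  define s4 where "s4 = ev w squares s3"
  define s5 where "s5 = ev w labels s4"
  define s6 where "s6 = ev w differences s5"
  define s7 where "s7 = ev w count_labels s6"
  define L where "L = lab_of s5"
  have z0: "arr s0 a i j = 0" if "a \<noteq> 0" for a i j using that by (simp add: s0_def init_store_def)
  have a1: "arr s1 a = arr s0 a" if "a \<notin> {a_tail, a_head, a_edge, a_fst, a_snd}" for a
    unfolding s1_def by (rule arr_frame) (use that in \<open>simp add: read_edges_def\<close>)
  have a2: "arr s2 a = arr s1 a" if "a \<notin> {a_arc, a_nbr, a_deg}" for a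
    unfolding s2_def by (rule arr_frame) (use that in \<open>simp add: list_arcs_def\<close>)
  have a3: "arr s3 a = arr s2 a" if "a \<notin> {a_hop, a_queue}" for a
    unfolding s3_def by (rule arr_frame) (use that in \<open>simp add: hops_def search_def expand_def visit_def\<close>)
  have a4: "arr s4 a = arr s3 a" if "a \<noteq> a_square" for a
    unfolding s4_def by (rule arr_frame) (use that in \<open>simp add: squares_def\<close>)
  have a5: "arr s5 a = arr s4 a" if "a \<notin> {a_lab, a_mark}" for a
    unfolding s5_def by (rule arr_frame) (use that in \<open>simp add: labels_def mark_arc_def merge_arc_def\<close>)
  have a6: "arr s6 a = arr s5 a" if "a \<notin> {a_diff, a_ndiff}" for a
    unfolding s6_def by (rule arr_frame) (use that in \<open>simp add: differences_def\<close>)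
  have i1: "input_read s1"
    unfolding s1_def by (rule read_edges) (simp_all add: s0_def init_store_def cell_in)
  have i2: "input_read s2" unfolding s2_def by (rule input_read_frame[OF i1]) (simp_all add: list_arcs_def)
  have i3: "input_read s3" unfolding s3_def
    by (rule input_read_frame[OF i2]) (simp_all add: hops_def search_def expand_def visit_def)
  have i4: "input_read s4" unfolding s4_def by (rule input_read_frame[OF i3]) (simp_all add: squares_def)
  have i5: "input_read s5" unfolding s5_def
    by (rule input_read_frame[OF i4]) (simp_all add: labels_def mark_arc_def merge_arc_def)
  have i6: "input_read s6" unfolding s6_def by (rule input_read_frame[OF i5]) (simp_all add: differences_def)
  have n: "vars s v_n = n" "vars s v_m = m" "vars s v_arcs = 2 * m" if "input_read s" for s
    using that unfolding input_read_def by auto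
  have al2: "arcs_listed s2" unfolding s2_def by (rule list_arcs[OF i1]) (simp_all add: a1 z0)
  have "hops_known s3 \<and> cost w hops s2 \<le> 2 + n * (104 + n * 54 + 2 * m * (max_cost (\<lambda>_. 0) visit + 4))"
    unfolding s3_def by (rule hops[OF n(1)[OF i2] al2]) (simp add: a1 a2 z0)
  then have h3: "hops_known s3" and hc: "cost w hops s2 \<le> 2 + n * (104 + n * 54 + 2 * m * (max_cost (\<lambda>_. 0) visit + 4))"
    by auto
  have al3: "arcs_listed s3" using al2 unfolding arcs_listed_def by (simp add: a3)
  have h4: "hops_known s4" using h3 unfolding hops_known_def by (simp add: a4)
  have h5: "hops_known s5" using h4 unfolding hops_known_def by (simp add: a5)
  have q4: "squares_known s4" unfolding s4_def by (rule squares[OF i3 al3 _ w]) (simp add: a1 a2 a3 z0)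
  have l5: "labelled (2 * m) L" unfolding L_def s5_def
    by (rule labels[OF i4 h4 q4]) (simp add: a1 a2 a3 a4 z0)
  \<comment> \<open>Without arcs the label array keeps its initial zeros, so 0 is a fixed point and
    counts as the only label.\<close>
  have no_edges: "L 0 = 0" if "es = []"
  proof -
    have "vars s4 v_arcs = 0" using n(3)[OF i4] that by simp
    then show ?thesis unfolding L_def s5_def labels_def by (simp add: a1 a2 a3 a4 z0)
  qed
  interpret lg: labelled_graph G n es L
    by unfold_locales (use l5 no_edges in auto)
  have d6: "differences_known s6" unfolding s6_def
    by (rule differences[OF i5 h5]) (simp_all add: a1 a2 a3 a4 a5 z0)
  have "lab_of s6 = L" by (simp add: L_def a6)
  then have ready: "lg.ready s6" unfolding lg.ready_def using i6 d6 by simp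
  have "outs s6 = outs s0 \<and> routs s6 = routs s0"
    unfolding s6_def s5_def s4_def s3_def s2_def s1_def by (simp add: outs_frame factorize_defs del: ev.simps)
  then have o6: "outs s6 = []" "routs s6 = []" by (simp_all add: s0_def init_store_def)
  have ev: "ev w factorize s0 = ev w write_factors (ev w count_labels s6)"
    unfolding factorize_def ev.simps(4) s6_def s5_def s4_def s3_def s2_def s1_def ..
  show "\<exists>L. labelled_graph G n es L \<and>
      (outs (ev w factorize s0), map w (routs (ev w factorize s0))) =
        family_output (map (labelled_graph.factor_code G n es L) (labelled_graph.label_list es L))"
    unfolding ev using lg.output_factors[OF ready o6 w] lg.labelled_graph_axioms by blast
  let ?B = "2 * (m + 1)"
  have le: "n \<le> ?B" "m \<le> ?B" "2 * m \<le> ?B" "1 \<le> ?B" "lg.label_bound \<le> ?B"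
    using n_le by (simp_all add: lg.label_bound_def)
  have c1: "cost w read_edges s0 \<le> max_cost (\<lambda>_. 1) read_edges * ?B\<^sup>2"
    by (rule phase_cost[where Y = "{v_m}"]) (simp_all add: read_edges_def s0_def init_store_def cell_in)
  have c2: "cost w list_arcs s1 \<le> max_cost (\<lambda>_. 1) list_arcs * ?B\<^sup>2"
    by (rule phase_cost[where Y = "{v_arcs}"]) (use le n[OF i1] in \<open>simp_all add: list_arcs_def\<close>)
  have c4: "cost w squares s3 \<le> max_cost (\<lambda>_. 1) squares * ?B\<^sup>2"
    by (rule phase_cost[where Y = "{v_arcs}"]) (use le n[OF i3] in \<open>simp_all add: squares_def\<close>)
  \<comment> \<open>In \<open>labels\<close> the counter \<open>v_i\<close> also bounds inner loops,
    so its value on entry has to respect the limit; it is the one left over from the preceding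
    phase.\<close>
  have vi: "vars s4 v_i = 2 * m" unfolding s4_def squares_def using n[OF i3] by simp
  have c5: "cost w labels s4 \<le> max_cost (\<lambda>_. 1) labels * ?B\<^sup>2"
    by (rule phase_cost[where Y = "{v_arcs, v_i}"])
      (use le n[OF i4] vi in \<open>auto simp: labels_def mark_arc_def merge_arc_def\<close>)
  have c6: "cost w differences s5 \<le> max_cost (\<lambda>_. 1) differences * ?B\<^sup>2"
    by (rule phase_cost[where Y = "{v_n, v_arcs}"]) (use le n[OF i5] in \<open>auto simp: differences_def\<close>)
  have c7: "cost w count_labels s6 \<le> max_cost (\<lambda>_. 1) count_labels * ?B\<^sup>2"
  proof -
    \<comment> \<open>The first commands assign \<open>v_labels\<close>, which then bounds a loop.
      \<open>limits_ok\<close> forbids assigning a loop limit, so the phase is split here.\<close>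
    let ?init = "Assign v_labels (Var v_arcs) ;; When True (Eq (Var v_m) (Const 0)) (Assign v_labels (Const 1)) ;;
      Assign v_count (Const 0)"
    let ?rest = "For v_c v_labels (When True is_label (Assign v_count (Inc (Var v_count)))) ;; Out (Var v_count)"
    have "cost w ?init s6 \<le> max_cost (\<lambda>_. 1) ?init * ?B\<^sup>2"
      by (rule phase_cost[where Y = "{}"]) (use le in simp_all)
    moreover have "cost w ?rest (ev w ?init s6) \<le> max_cost (\<lambda>_. 1) ?rest * ?B\<^sup>2"
      by (rule phase_cost[where Y = "{v_labels}"]) (use le n[OF i6] in auto)
    moreover have "cost w count_labels s6 = cost w ?init s6 + cost w ?rest (ev w ?init s6)"
      unfolding count_labels_def by simp
    moreover have "max_cost (\<lambda>_. 1) count_labels = max_cost (\<lambda>_. 1) ?init + max_cost (\<lambda>_. 1) ?rest"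
      unfolding count_labels_def by simp
    ultimately show ?thesis by (simp only: distrib_right)
  qed
  have "lg.ready s7" "vars s7 v_labels = lg.label_bound" unfolding s7_def using lg.count_labels[OF ready] by auto
  then have c8: "cost w write_factors s7 \<le> max_cost (\<lambda>_. 1) write_factors * ?B\<^sup>2"
    by (intro phase_cost[where Y = "{v_n, v_m, v_labels}"])
      (use le n[of s7] in \<open>auto simp: lg.ready_def write_factors_def number_vertices_def count_edges_def write_edges_def\<close>)
  have "cost w factorize s0 = cost w read_edges s0 + cost w list_arcs s1 + cost w hops s2 + cost w squares s3 +
      cost w labels s4 + cost w differences s5 + cost w count_labels s6 + cost w write_factors s7"
    unfolding factorize_def cost.simps(4) s7_def s6_def s5_def s4_def s3_def s2_def s1_def by (simp only: add.assoc)
  also have "\<dots> \<le> phases_cost * ?B\<^sup>2 + cost w hops s2"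
    unfolding phases_cost_def distrib_right using c1 c2 c4 c5 c6 c7 c8 by linarith
  also have "cost w hops s2 \<le> (168 + 2 * max_cost (\<lambda>_. 0) visit) * (m + 1)\<^sup>2"
  proof -
    define q where "q = m + 1"
    have q: "n \<le> q" "m \<le> q" "1 \<le> q" using n_le unfolding q_def by auto
    have "104 + n * 54 + 2 * m * (max_cost (\<lambda>_. 0) visit + 4) \<le>
        104 * q + q * 54 + 2 * q * (max_cost (\<lambda>_. 0) visit + 4)"
      using q by (intro add_mono mult_le_mono) auto
    also have "\<dots> = (166 + 2 * max_cost (\<lambda>_. 0) visit) * q" by (simp add: algebra_simps)
    finally have "n * (104 + n * 54 + 2 * m * (max_cost (\<lambda>_. 0) visit + 4)) \<le>
        q * ((166 + 2 * max_cost (\<lambda>_. 0) visit) * q)" using q by (intro mult_le_mono)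
    moreover have "2 \<le> 2 * q\<^sup>2" using q by simp
    ultimately have "cost w hops s2 \<le> 2 * q\<^sup>2 + q * ((166 + 2 * max_cost (\<lambda>_. 0) visit) * q)" using hc by linarith
    also have "\<dots> = (168 + 2 * max_cost (\<lambda>_. 0) visit) * q\<^sup>2" by (simp add: algebra_simps power2_eq_square)
    finally show ?thesis unfolding q_def .
  qed
  finally have "cost w factorize s0 \<le> phases_cost * ?B\<^sup>2 + (168 + 2 * max_cost (\<lambda>_. 0) visit) * (m + 1)\<^sup>2" by simp
  also have "phases_cost * ?B\<^sup>2 = (4 * phases_cost) * (m + 1)\<^sup>2"
    by (simp only: power_mult_distrib) simp
  also have "\<dots> + (168 + 2 * max_cost (\<lambda>_. 0) visit) * (m + 1)\<^sup>2 = cost_factor * (m + 1)\<^sup>2"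
    unfolding cost_factor_def by (simp only: distrib_right add.assoc)
  finally show "cost w factorize s0 \<le> cost_factor * (m + 1)\<^sup>2" .
qed

end

section \<open>Time and word bounds of the complete program\<close>

definition prime_factor_program :: program where
  "prime_factor_program = program_of factorize"

definition time_factor :: nat where
  "time_factor = length prologue + 29 + cost_factor"

definition word_exponent :: nat where
  "word_exponent = 4 + (190 + 32 * (4 * (66 + cost_factor)\<^sup>2 + 2 * (66 + cost_factor) + 1))"

text \<open>With \<open>Z = n + m + 2\<close>, all values are at most a constant times the square of
  \<open>Z\<close>, and addresses are quadratic in the values, hence at most a constant times
  \<open>Z ^ 4\<close>.\<close>

lemma word_bound_suffices:
  fixes n m K c :: nat
  assumes c: "c \<le> K * (m + 1)\<^sup>2" and n: "1 \<le> n"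
  shows "fits (n + 126 * m + 64) (n + 2 * m + 64 + c)
    ((n + m + 2) ^ (4 + (190 + 32 * (4 * (66 + K)\<^sup>2 + 2 * (66 + K) + 1))))"
proof -
  define Z where "Z = n + m + 2"
  define D where "D = 190 + 32 * (4 * (66 + K)\<^sup>2 + 2 * (66 + K) + 1)"
  have Z: "2 \<le> Z" "m + 1 \<le> Z" unfolding Z_def using n by auto
  have Z1: "1 \<le> Z" using Z by simp
  have zz: "Z \<le> Z\<^sup>2" "Z\<^sup>2 \<le> Z ^ 4" "1 \<le> Z ^ 4" "Z \<le> Z ^ 4"
    using power_increasing[OF _ Z1, of 1 2] power_increasing[OF _ Z1, of 2 4] power_increasing[OF _ Z1, of 0 4]
      power_increasing[OF _ Z1, of 1 4] by simp_all
  have "n + 2 * m + 64 \<le> 66 * Z" unfolding Z_def by simp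
  also have "\<dots> \<le> 66 * Z\<^sup>2" using zz by simp
  finally have "n + 2 * m + 64 + c \<le> 66 * Z\<^sup>2 + K * Z\<^sup>2"
    using c Z(2) by (meson add_mono le_trans mult_le_mono2 power_mono zero_le)
  then have B: "n + 2 * m + 64 + c \<le> (66 + K) * Z\<^sup>2" by (simp add: distrib_right)
  then have "(n + 2 * m + 64 + c) * (n + 2 * m + 64 + c) \<le> ((66 + K) * Z\<^sup>2) * ((66 + K) * Z\<^sup>2)" by (intro mult_le_mono)
  also have "\<dots> = (66 + K)\<^sup>2 * Z ^ 4" by (simp add: power2_eq_square power4_eq_xxxx algebra_simps)
  finally have BB: "(n + 2 * m + 64 + c) * (n + 2 * m + 64 + c) \<le> (66 + K)\<^sup>2 * Z ^ 4" .
  have B': "n + 2 * m + 64 + c \<le> (66 + K) * Z ^ 4"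
    using B zz(2) by (meson le_trans mult_le_mono2)
  have "n + 126 * m + 64 \<le> 190 * Z" unfolding Z_def by simp
  then have off: "n + 126 * m + 64 \<le> 190 * Z ^ 4" using zz(4) by simp
  have "n + 126 * m + 64 + 32 * (4 * ((n + 2 * m + 64 + c) * (n + 2 * m + 64 + c)) + 2 * (n + 2 * m + 64 + c) + 1) \<le>
      190 * Z ^ 4 + 32 * (4 * ((66 + K)\<^sup>2 * Z ^ 4) + 2 * ((66 + K) * Z ^ 4) + Z ^ 4)"
    using off BB B' zz(3) by (intro add_mono mult_le_mono2)
  also have "\<dots> = D * Z ^ 4" unfolding D_def by (simp only: distrib_right distrib_left mult.assoc mult_1)
  \<comment> \<open>The constant factor is moved into the exponent, which works because the base
    \<open>Z\<close> is at least 2.\<close>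
  also have "\<dots> \<le> 2 ^ D * Z ^ 4" by (intro mult_le_mono1 less_imp_le less_exp)
  also have "\<dots> \<le> Z ^ D * Z ^ 4" using Z by (intro mult_le_mono1 power_mono) auto
  also have "\<dots> = Z ^ (4 + D)" by (simp add: power_add)
  finally show ?thesis unfolding fits_def Z_def D_def .
qed

text \<open>\<open>xs\<close> is whatever follows the weights in the real memory: the table of
  distances for one half of the result, nothing for the other.\<close>

theorem prime_factor_program:
  assumes "weighted_graph G" "presents (n, es) G"
  shows "\<exists>t \<le> time_factor * (card (edges G) + 1)\<^sup>2.
    prime_factorizes_in (word_bound word_exponent G) prime_factor_program
      (graph_nats (n, es), graph_reals (n, es) @ xs) G t"
proof -
  interpret presented_graph G n es using assms by unfold_locales
  define rs where "rs = graph_reals (n, es) @ xs"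
  define w where "w i = (if i < length rs then rs ! i else 0)" for i
  have w: "real_input m w"
    unfolding real_input_def
  proof (intro allI impI)
    fix e assume e: "e < m"
    have "length (graph_reals (n, es)) = m" by simp
    then show "w e = edge_weight e"
      using e graph_reals_nth[OF e] unfolding w_def rs_def by (simp add: nth_append del: graph_reals.simps)
  qed
  obtain L where L: "labelled_graph G n es L"
    "(outs (ev w factorize (init_store cell_in)), map w (routs (ev w factorize (init_store cell_in)))) =
        family_output (map (labelled_graph.factor_code G n es L) (labelled_graph.label_list es L))"
    using factorize(1)[OF w] by blast
  interpret lg: labelled_graph G n es L by (rule L(1))
  have cost: "cost w factorize (init_store cell_in) \<le> cost_factor * (m + 1)\<^sup>2" by (rule factorize(2)[OF w])
  have W: "word_bound word_exponent G = (n + m + 2) ^ word_exponent"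
    unfolding word_bound_def card_edges verts by simp
  have fits: "fits (n + 126 * m + 64) (n + 2 * m + 64 + cost w factorize (init_store cell_in)) (word_bound word_exponent G)"
    unfolding W unfolding word_exponent_def by (rule word_bound_suffices[OF cost]) (use n_pos in simp)
  have ns: "length (graph_nats (n, es)) = 2 * m + 2" "graph_nats (n, es) ! 0 = n" "graph_nats (n, es) ! 1 = m"
    using length_graph_nats by auto
  have le: "x \<le> n + 2 * m + 64" if "x \<in> set (graph_nats (n, es))" for x using graph_nats_le[OF that] by simp
  have ci: "(\<lambda>i. if i < length (graph_nats (n, es)) then graph_nats (n, es) ! i else 0) = cell_in"
    unfolding cell_in_def ..
  have wi: "(\<lambda>i. if i < length rs then rs ! i else 0) = w" unfolding w_def ..
  obtain t where t: "t \<le> length prologue + 14 * m + 15 + cost w factorize (init_store cell_in)"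
    "outputs_in (word_bound word_exponent G) prime_factor_program (graph_nats (n, es), rs) t
      (outs (ev w factorize (init_store cell_in)), map w (routs (ev w factorize (init_store cell_in))))"
    using program_outputs[OF ns(1,2,3) trivial le _ _ factorize_ok, of rs, unfolded ci wi, OF _ _ _ _ fits]
    unfolding prime_factor_program_def by auto
  have "prime_factorizes_in (word_bound word_exponent G) prime_factor_program (graph_nats (n, es), rs) G t"
    unfolding prime_factorizes_in_def
  proof (intro exI conjI)
    show "outputs_in (word_bound word_exponent G) prime_factor_program (graph_nats (n, es), rs) t
        (family_output (map lg.factor_code lg.label_list))"
      using t(2) L(2) by simp
    show "list_all2 presents (map lg.factor_code lg.label_list) (map lg.factor lg.label_list)"
      using lg.presents_factor by (simp add: list_all2_conv_all_nth)
    show "factorization (map lg.factor lg.label_list) G" by (rule lg.factorization_factors)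
    show "\<forall>H\<in>set (map lg.factor lg.label_list). prime_graph H" using lg.prime_factor by auto
  qed
  moreover have "t \<le> time_factor * (card (edges G) + 1)\<^sup>2"
  proof -
    have q: "1 \<le> (m + 1)\<^sup>2" "m \<le> (m + 1)\<^sup>2" by (simp_all add: power2_eq_square)
    have "t \<le> length prologue * 1 + 14 * m + 15 * 1 + cost_factor * (m + 1)\<^sup>2" using t(1) cost by simp
    also have "\<dots> \<le> length prologue * (m + 1)\<^sup>2 + 14 * (m + 1)\<^sup>2 + 15 * (m + 1)\<^sup>2 + cost_factor * (m + 1)\<^sup>2"
      using q by (intro add_mono mult_le_mono2) auto
    also have "\<dots> = time_factor * (m + 1)\<^sup>2" unfolding time_factor_def by (simp add: distrib_right)
    finally show ?thesis unfolding card_edges .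
  qed
  ultimately show ?thesis unfolding rs_def by blast
qed

lemma time_bound: "(\<lambda>m. real (K * (m + 1)\<^sup>2)) \<in> O(\<lambda>m. (real m)\<^sup>2)"
proof (rule bigoI[of _ "4 * real K"])
  show "\<forall>\<^sub>F m in at_top. norm (real (K * (m + 1)\<^sup>2)) \<le> 4 * real K * norm ((real m)\<^sup>2)"
    using eventually_ge_at_top[of "1 :: nat"]
  proof eventually_elim
    case (elim m)
    have "(m + 1)\<^sup>2 \<le> (2 * m)\<^sup>2" using elim by (intro power_mono) auto
    then have "K * (m + 1)\<^sup>2 \<le> K * (4 * m\<^sup>2)" by (intro mult_le_mono2) (simp add: power_mult_distrib)
    then have "real (K * (m + 1)\<^sup>2) \<le> real (K * (4 * m\<^sup>2))" by (simp only: of_nat_le_iff)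
    then show ?case by simp
  qed
qed

lemma time_bound2:
  "(\<lambda>(n, m). real (K * (m + 1)\<^sup>2)) \<in>
    O[at_top \<times>\<^sub>F at_top](\<lambda>(n :: nat, m :: nat). (real n)\<^sup>2 * ln (ln (real n)) + (real m)\<^sup>2)"
proof (rule bigoI[of _ "4 * real K"])
  \<comment> \<open>From \<open>n = 3\<close> on, \<open>n\<close> is at least \<open>exp 1\<close>
    and \<open>ln (ln n)\<close> is not negative, so the first summand may be dropped.\<close>
  have "\<forall>\<^sub>F x in (at_top :: nat filter) \<times>\<^sub>F (at_top :: nat filter). 3 \<le> fst x \<and> 1 \<le> snd x"
    by (rule eventually_prodI[OF eventually_ge_at_top eventually_ge_at_top])
  then show "\<forall>\<^sub>F x in at_top \<times>\<^sub>F at_top. norm (case x of (n, m) \<Rightarrow> real (K * (m + 1)\<^sup>2)) \<le>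
      4 * real K * norm (case x of (n :: nat, m :: nat) \<Rightarrow> (real n)\<^sup>2 * ln (ln (real n)) + (real m)\<^sup>2)"
  proof eventually_elim
    case (elim x)
    obtain n m where x: "x = (n, m)" by (cases x)
    have n: "3 \<le> n" and m: "1 \<le> m" using elim x by auto
    have "3 \<le> real n" using n by simp
    then have "exp 1 \<le> real n" by (rule order_trans[OF exp_le])
    then have "1 \<le> ln (real n)" using n by (subst ln_ge_iff) auto
    then have "0 \<le> (real n)\<^sup>2 * ln (ln (real n))" by simp
    then have ge: "(real m)\<^sup>2 \<le> norm ((real n)\<^sup>2 * ln (ln (real n)) + (real m)\<^sup>2)" by simp
    have "(m + 1)\<^sup>2 \<le> (2 * m)\<^sup>2" using m by (intro power_mono) auto
    then have "K * (m + 1)\<^sup>2 \<le> K * (4 * m\<^sup>2)" by (intro mult_le_mono2) (simp add: power_mult_distrib)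
    then have "real (K * (m + 1)\<^sup>2) \<le> real (K * (4 * m\<^sup>2))" by (simp only: of_nat_le_iff)
    also have "\<dots> = 4 * real K * (real m)\<^sup>2" by simp
    also have "\<dots> \<le> 4 * real K * norm ((real n)\<^sup>2 * ln (ln (real n)) + (real m)\<^sup>2)"
      using ge by (intro mult_left_mono) auto
    finally show ?case unfolding x by simp
  qed
qed

theorem theorem1p4:
  shows
    "(\<exists>(P :: program) (c :: nat) (T :: nat \<Rightarrow> nat).
        (\<lambda>m. real (T m)) \<in> O(\<lambda>m. (real m)^2) \<and>
        (\<forall>(G :: nat wgraph) (g :: graph_code).
           weighted_graph G \<and> minimal_graph G \<and> presents g G \<longrightarrow>
           (\<exists>t \<le> T (card (edges G)).
              prime_factorizes_in (word_bound c G) P (graph_dist_input g G) G t)))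
     \<and>
     (\<exists>(P :: program) (c :: nat) (T :: nat \<Rightarrow> nat \<Rightarrow> nat).
        (\<lambda>(n, m). real (T n m))
          \<in> O[at_top \<times>\<^sub>F at_top](\<lambda>(n, m). (real n)^2 * ln (ln (real n)) + (real m)^2) \<and>
        (\<forall>(G :: nat wgraph) (g :: graph_code).
           weighted_graph G \<and> minimal_graph G \<and> presents g G \<longrightarrow>
           (\<exists>t \<le> T (card (verts G)) (card (edges G)).
              prime_factorizes_in (word_bound c G) P (graph_input g) G t)))"
proof (rule conjI)
  show "\<exists>(P :: program) (c :: nat) (T :: nat \<Rightarrow> nat).
        (\<lambda>m. real (T m)) \<in> O(\<lambda>m. (real m)^2) \<and>
        (\<forall>(G :: nat wgraph) (g :: graph_code).
           weighted_graph G \<and> minimal_graph G \<and> presents g G \<longrightarrow>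
           (\<exists>t \<le> T (card (edges G)).
              prime_factorizes_in (word_bound c G) P (graph_dist_input g G) G t))"
  proof (rule exI[of _ prime_factor_program], rule exI[of _ word_exponent],
      rule exI[of _ "\<lambda>m. time_factor * (m + 1)\<^sup>2"], intro conjI allI impI)
    show "(\<lambda>m. real (time_factor * (m + 1)\<^sup>2)) \<in> O(\<lambda>m. (real m)^2)" by (rule time_bound)
    fix G :: "nat wgraph" and g :: graph_code
    assume *: "weighted_graph G \<and> minimal_graph G \<and> presents g G"
    obtain n es where g: "g = (n, es)" by (cases g)
    show "\<exists>t \<le> time_factor * (card (edges G) + 1)\<^sup>2.
        prime_factorizes_in (word_bound word_exponent G) prime_factor_program (graph_dist_input g G) G t"
      unfolding graph_dist_input_def g using prime_factor_program[of G n es] * g by blast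
  qed
  show "\<exists>(P :: program) (c :: nat) (T :: nat \<Rightarrow> nat \<Rightarrow> nat).
        (\<lambda>(n, m). real (T n m))
          \<in> O[at_top \<times>\<^sub>F at_top](\<lambda>(n, m). (real n)^2 * ln (ln (real n)) + (real m)^2) \<and>
        (\<forall>(G :: nat wgraph) (g :: graph_code).
           weighted_graph G \<and> minimal_graph G \<and> presents g G \<longrightarrow>
           (\<exists>t \<le> T (card (verts G)) (card (edges G)).
              prime_factorizes_in (word_bound c G) P (graph_input g) G t))"
  proof (rule exI[of _ prime_factor_program], rule exI[of _ word_exponent],
      rule exI[of _ "\<lambda>(n :: nat) m. time_factor * (m + 1)\<^sup>2"], intro conjI allI impI)
    show "(\<lambda>(n, m). real (time_factor * (m + 1)\<^sup>2))
          \<in> O[at_top \<times>\<^sub>F at_top](\<lambda>(n, m). (real n)^2 * ln (ln (real n)) + (real m)^2)"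
      by (rule time_bound2)
    fix G :: "nat wgraph" and g :: graph_code
    assume *: "weighted_graph G \<and> minimal_graph G \<and> presents g G"
    obtain n es where g: "g = (n, es)" by (cases g)
    show "\<exists>t \<le> time_factor * (card (edges G) + 1)\<^sup>2.
        prime_factorizes_in (word_bound word_exponent G) prime_factor_program (graph_input g) G t"
      unfolding graph_input_def g using prime_factor_program[of G n es "[]"] * g by simp
  qed
qed

end
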